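(* Let $X=\{X(t)\}_{t\ge0}$ be the generalized fractional Brownian motion with parameters $\gamma\in[0,1)$ and $\alpha\in\big(-\tfrac12+\tfrac{\gamma}{2},\,\tfrac12+\tfrac{\gamma}{2}\big)$, with covariance function $\Psi(s,t)=E[X(s)X(t)]$, let $H=\alpha-\tfrac{\gamma}{2}+\tfrac12$, and let $b>0$. If $\alpha>0$, then with probability one the set $$\left\{\frac{X(|X(ub)|)}{u^{H^2}(2\log\log u^{-1})^{(H+1)/2}},\ u>0\right\}$$ is relatively compact as $u\to0+$, and its limit set is $[-\sigma,\sigma]$, where $$\sigma=\sup_{0\le r\le\sqrt{\Psi(b,b)}}\sqrt{\Psi(r,r)}\,\big(1-r^2/\Psi(b,b)\big)^{1/2}.$$
   Context: Let $B(\mathrm{d}u)$ be a Gaussian random measure on $\mathbb{R}$ with Lebesgue control measure $\mathrm{d}u$ (equivalently, the white noise of a two-sided standard Brownian motion $B$). For $\gamma\in[0,1)$ and $\alpha\in(-\frac12+\frac{\gamma}{2},\frac12+\frac{\gamma}{2})$, the generalized fractional Brownian motion (GFBM) is the mean-zero Gaussian process with continuous sample paths given (in distribution, as a process) by $$X(t)= c\int_{\mathbb{R}}\big((t-u)_+^{\alpha}-(-u)_+^{\alpha}\big)\,|u|^{-\gamma/2}\,B(\mathrm{d}u),\qquad t\ge 0,$$ where $x_+^{\alpha}=x^{\alpha}$ if $x>0$ and $x_+^{\alpha}=0$ otherwise, and $c=c(\alpha,\gamma)>0$ is the normalization constant for which $\mathrm{Var}(X(t))=\Psi(t,t)=t^{2H}$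 for all $t\ge0$, that is, $c^{-2}=\int_0^1(1-v)^{2\alpha}v^{-\gamma}\,\mathrm{d}v+\int_0^\infty[(1+v)^{\alpha}-v^{\alpha}]^2v^{-\gamma}\,\mathrm{d}v$. The process is self-similar with Hurst parameter $H=\alpha-\frac{\gamma}{2}+\frac12\in(0,1)$. $X(|X(ub)|)$ is the composition of the path of $X$ with itself: the path $t\mapsto X(t)$ evaluated at the random time $|X(ub)|$. The displayed quantity is considered for small $u$ (so that $\log\log u^{-1}>0$). A real-valued family $\{z(u)\}$ is relatively compact as $u\to0+$ if for every sequence $u_n\to0+$ the sequence $z(u_n)$ has a convergent subsequence; its limit set is the set of all limits of convergent sequences $z(u_n)$ with $u_n\to0+$. *)

theory Defs
  imports "HOL-Probability.Probability"
begin

text \<open>The centred normal law with variance \<open>v\<close>; for \<open>v = 0\<close> it is the Dirac mass at \<open>0\<close>.\<close>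

definition centered_normal :: "real \<Rightarrow> real measure" where
  "centered_normal v =
     (if v = 0 then return borel 0
      else density lborel (\<lambda>x. ennreal (normal_density 0 (sqrt v) x)))"

definition centered_gaussian_process ::
  "'a measure \<Rightarrow> 't set \<Rightarrow> ('t \<Rightarrow> 'a \<Rightarrow> real) \<Rightarrow> bool" where
  "centered_gaussian_process M T X \<longleftrightarrow>
     (\<forall>t\<in>T. X t \<in> borel_measurable M) \<and>
     (\<forall>J a. finite J \<and> J \<subseteq> T \<longrightarrow>
        (\<exists>v\<ge>0. distr M borel (\<lambda>\<omega>. \<Sum>t\<in>J. a t * X t \<omega>) = centered_normal v))"

definition same_finite_dim_distributions ::
  "'t set \<Rightarrow> 'a measure \<Rightarrow> ('t \<Rightarrow> 'a \<Rightarrow> real) \<Rightarrow> 'b measure \<Rightarrow> ('t \<Rightarrow> 'b \<Rightarrow> real) \<Rightarrow> bool" where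
  "same_finite_dim_distributions T M X N Y \<longleftrightarrow>
     (\<forall>J. finite J \<and> J \<subseteq> T \<longrightarrow>
        distr M (Pi\<^sub>M J (\<lambda>_. borel)) (\<lambda>\<omega>. \<lambda>t\<in>J. X t \<omega>) =
        distr N (Pi\<^sub>M J (\<lambda>_. borel)) (\<lambda>\<omega>. \<lambda>t\<in>J. Y t \<omega>))"

definition finite_measure_sets :: "'c measure \<Rightarrow> 'c set set" where
  "finite_measure_sets K = {A \<in> sets K. emeasure K A < \<infinity>}"

text \<open>
  A Gaussian random measure \<open>B\<close> on the probability space \<open>N\<close> with control measure \<open>K\<close>:
  independently scattered, almost surely countably additive, with \<open>B A\<close> centred normal of
  variance \<open>K A\<close>. Independence is stated for disjoint sequences; finite disjoint families
  are covered by padding with empty sets.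
\<close>

definition gaussian_random_measure ::
  "'b measure \<Rightarrow> 'c measure \<Rightarrow> ('c set \<Rightarrow> 'b \<Rightarrow> real) \<Rightarrow> bool" where
  "gaussian_random_measure N K B \<longleftrightarrow>
     prob_space N \<and>
     (\<forall>A\<in>finite_measure_sets K.
        B A \<in> borel_measurable N \<and> distr N borel (B A) = centered_normal (measure K A)) \<and>
     (\<forall>A :: nat \<Rightarrow> 'c set. range A \<subseteq> finite_measure_sets K \<and> disjoint_family A \<longrightarrow>
        prob_space.indep_vars N (\<lambda>_. borel) (\<lambda>n. B (A n)) UNIV) \<and>
     (\<forall>A :: nat \<Rightarrow> 'c set. range A \<subseteq> finite_measure_sets K \<and> disjoint_family A \<and>
          (\<Union>n. A n) \<in> finite_measure_sets K \<longrightarrow>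
        (AE \<omega> in N. (\<lambda>n. B (A n) \<omega>) sums B (\<Union>n. A n) \<omega>))"

text \<open>
  A list of pairs \<open>(a, A)\<close> encodes the simple function that is the sum of the
  \<open>a\<close>-multiples of the indicators of the sets \<open>A\<close>.
\<close>

definition simple_fun :: "(real \<times> 'c set) list \<Rightarrow> 'c \<Rightarrow> real" where
  "simple_fun S u = (\<Sum>(a, A)\<leftarrow>S. a * indicator A u)"

definition simple_integral ::
  "('c set \<Rightarrow> 'b \<Rightarrow> real) \<Rightarrow> (real \<times> 'c set) list \<Rightarrow> 'b \<Rightarrow> real" where
  "simple_integral B S \<omega> = (\<Sum>(a, A)\<leftarrow>S. a * B A \<omega>)"

text \<open>
  \<open>Z\<close> is (a version of) the Wiener integral of \<open>f\<close> with respect to \<open>B\<close>: the mean-square limit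
  of the integrals of simple functions that converge to \<open>f\<close> in mean square.
\<close>

definition has_wiener_integral ::
  "'b measure \<Rightarrow> 'c measure \<Rightarrow> ('c set \<Rightarrow> 'b \<Rightarrow> real) \<Rightarrow> ('c \<Rightarrow> real) \<Rightarrow> ('b \<Rightarrow> real) \<Rightarrow> bool" where
  "has_wiener_integral N K B f Z \<longleftrightarrow>
     f \<in> borel_measurable K \<and> Z \<in> borel_measurable N \<and>
     (\<exists>S :: nat \<Rightarrow> (real \<times> 'c set) list.
        (\<forall>n. snd ` set (S n) \<subseteq> finite_measure_sets K) \<and>
        (\<lambda>n. \<integral>\<^sup>+u. ennreal ((f u - simple_fun (S n) u)\<^sup>2) \<partial>K) \<longlonglongrightarrow> 0 \<and>
        (\<lambda>n. \<integral>\<^sup>+\<omega>. ennreal ((Z \<omega> - simple_integral B (S n) \<omega>)\<^sup>2) \<partial>N) \<longlonglongrightarrow> 0)"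

definition pos_powr :: "real \<Rightarrow> real \<Rightarrow> real" where
  "pos_powr x a = (if x > 0 then x powr a else 0)"

text \<open>At \<open>u = 0\<close> the last factor takes the value \<open>0\<close>, even for \<open>\<gamma> = 0\<close>; this is one point only.\<close>

definition gfbm_kernel :: "real \<Rightarrow> real \<Rightarrow> real \<Rightarrow> real \<Rightarrow> real" where
  "gfbm_kernel \<alpha> \<gamma> t u =
     (pos_powr (t - u) \<alpha> - pos_powr (- u) \<alpha>) * \<bar>u\<bar> powr (- \<gamma> / 2)"

text \<open>The normalization that gives \<open>X t\<close> the variance \<open>t powr (2 * H)\<close>.\<close>

definition gfbm_const :: "real \<Rightarrow> real \<Rightarrow> real" where
  "gfbm_const \<alpha> \<gamma> =
     1 / sqrt ((LINT v:{0..1}|lborel. (1 - v) powr (2 * \<alpha>) * v powr (- \<gamma>)) +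
               (LINT v:{0..}|lborel. ((1 + v) powr \<alpha> - v powr \<alpha>)\<^sup>2 * v powr (- \<gamma>)))"

text \<open>
  The process \<open>X\<close> on \<open>M\<close>, with time set \<open>{0..}\<close>, is a generalized fractional Brownian motion.
  The random measure \<open>B\<close> on \<open>N\<close> enters only through the finite-dimensional distributions of
  the stochastic integral, so \<open>M\<close> and \<open>N\<close> may differ.
\<close>

definition generalized_fbm ::
  "'b measure \<Rightarrow> (real set \<Rightarrow> 'b \<Rightarrow> real) \<Rightarrow> real \<Rightarrow> real \<Rightarrow>
   'a measure \<Rightarrow> (real \<Rightarrow> 'a \<Rightarrow> real) \<Rightarrow> bool" where
  "generalized_fbm N B \<alpha> \<gamma> M X \<longleftrightarrow>
     prob_space M \<and>
     centered_gaussian_process M {0..} X \<and>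
     (\<forall>\<omega>\<in>space M. continuous_on {0..} (\<lambda>t. X t \<omega>)) \<and>
     (\<exists>I. (\<forall>t\<ge>0. has_wiener_integral N lborel B (gfbm_kernel \<alpha> \<gamma> t) (I t)) \<and>
          same_finite_dim_distributions {0..} M X N (\<lambda>t \<omega>. gfbm_const \<alpha> \<gamma> * I t \<omega>))"

definition relatively_compact_at_0 :: "(real \<Rightarrow> real) \<Rightarrow> bool" where
  "relatively_compact_at_0 z \<longleftrightarrow>
     (\<forall>s :: nat \<Rightarrow> real. filterlim s (at_right 0) sequentially \<longrightarrow>
        (\<exists>r :: nat \<Rightarrow> nat. strict_mono r \<and> convergent (\<lambda>n. z (s (r n)))))"

definition limit_set_at_0 :: "(real \<Rightarrow> real) \<Rightarrow> real set" where
  "limit_set_at_0 z =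
     {l. \<exists>s :: nat \<Rightarrow> real. filterlim s (at_right 0) sequentially \<and> (\<lambda>n. z (s n)) \<longlonglongrightarrow> l}"

end

(*
  For small u the value x = X (u b) lives on the time scale u, while X |x| lives on the scale
  T = u^H (2 log log (1/u))^(1/2), which is much coarser since H < 1. The covariance of X decays
  polynomially in the ratio of the times, so the two normalized values behave like independent
  standard Gaussians P, Q at level (2 log log (1/u))^(1/2), and their limit points fill the unit
  disc p^2 + q^2 <= 1. With r = |x| / T this gives r = p (Psi b b)^(1/2) and the value
  q (Psi r r)^(1/2), whence the formula for sigma.

  Upper bound: for the geometric times u = q^n and finitely many values of r, the linear
  combination a P + d Q has variance close to a^2 + d^2, and a Gaussian tail bound with the
  Borel-Cantelli lemma applies; the gaps are filled by dyadic chaining.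

  Lower bound: on a block of m well separated times the second moment method is applied to the
  sum of exp (beta (a1 P + a2 Q)) over those times at which (P, Q) is close to beta (a1, a2).
  It needs only the moment generating function of linear combinations, hence only second moments
  of the process, and shows that a hit occurs on the block with probability tending to one.
*)
theory Submission
  imports Defs "HOL-Real_Asymp.Real_Asymp"
begin

section \<open>Gaussian spaces\<close>

text \<open>The time is instead compared with deterministic times T r: a uniform modulus of
  continuity at scale T, with exceptional probability of order exp (- L) for L = 2 log log (1/u),
  makes a finite grid of r enough from above and a single r enough from below. Here \<alpha> > 0
  enters, since the kernel increments are bounded by (t - s)^\<alpha>.

  The restriction to times near the target is essential in the second moment sum. With \<beta>^2
  slightly below 2 log m, the unrestricted diagonal contributes about exp (\<beta>^2) / m, which
  diverges; the restricted one contributes about exp (\<beta>^2 / 2) / m, which vanishes.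

  The times of a block lie between exp (- (2-H) m^(1+\<delta>)) and exp (- m^(1+\<delta>)). Their
  log log (1/u) is close to (1+\<delta>) log m, so m candidates suffice for one common level \<beta>
  just below (2 log log (1/u))^(1/2).\<close>

lemma distr_centered_normal_moments:
  fixes Z :: "'a \<Rightarrow> real"
  assumes "prob_space M" and Z[measurable]: "Z \<in> borel_measurable M" and v: "0 \<le> v"
    and D: "distr M borel Z = centered_normal v"
  shows "integrable M (\<lambda>\<omega>. (Z \<omega>)\<^sup>2)" "(LINT \<omega>|M. (Z \<omega>)\<^sup>2) = v"
    "integrable M (\<lambda>\<omega>. exp (Z \<omega>))" "(LINT \<omega>|M. exp (Z \<omega>)) = exp (v / 2)"
proof -
  have *: "has_bochner_integral (centered_normal v) (\<lambda>x. x\<^sup>2) v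
      \<and> has_bochner_integral (centered_normal v) exp (exp (v / 2))"
  proof (cases "v = 0")
    case True
    have "has_bochner_integral (return borel (0::real)) f (f 0)" if [measurable]: "f \<in> borel_measurable borel"
      for f :: "real \<Rightarrow> real"
    proof -
      interpret R: prob_space "return borel (0::real)" by (rule prob_space_return) simp
      have "integrable (return borel (0::real)) f"
        by (rule R.integrable_const_bound[where B = "norm (f 0)"]) (auto simp: AE_return)
      then show ?thesis using integral_return[of "0::real" borel f] by (simp add: has_bochner_integral_iff)
    qed
    from this[of "\<lambda>x. x\<^sup>2"] this[of exp] show ?thesis using True by (simp add: centered_normal_def)
  next
    case False
    then have s: "0 < sqrt v" using v by simp
    have sq: "has_bochner_integral lborel (\<lambda>x. normal_density 0 (sqrt v) x * x\<^sup>2) v"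
      using normal_moment_even[OF s, of 0 1] v s by (simp add: fact_numeral)
    \<comment> \<open>Completing the square: the weight \<open>exp x\<close> moves the mean of the
      density from 0 to \<open>v\<close> and leaves the factor \<open>exp (v / 2)\<close>.\<close>
    have "normal_density 0 (sqrt v) x * exp x = exp (v / 2) * normal_density v (sqrt v) x" for x
    proof -
      have "exp (-(x - 0)\<^sup>2 / (2 * (sqrt v)\<^sup>2)) * exp x = exp (v/2) * exp (-(x - v)\<^sup>2 / (2 * (sqrt v)\<^sup>2))"
        unfolding exp_add[symmetric] using False v by (simp add: field_simps power2_eq_square)
      then show ?thesis by (simp add: normal_density_def)
    qed
    then have ex: "has_bochner_integral lborel (\<lambda>x. normal_density 0 (sqrt v) x * exp x) (exp (v / 2))"
      using s by (simp add: has_bochner_integral_iff)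
    have "has_bochner_integral (density lborel (\<lambda>x. ennreal (normal_density 0 (sqrt v) x))) f w"
      if "f \<in> borel_measurable borel" "has_bochner_integral lborel (\<lambda>x. normal_density 0 (sqrt v) x * f x) w"
      for f w
      using that by (intro has_bochner_integral_density) auto
    from this[OF _ sq] this[OF _ ex] False show ?thesis unfolding centered_normal_def by simp
  qed
  have tr: "has_bochner_integral M (\<lambda>\<omega>. f (Z \<omega>)) w"
    if "has_bochner_integral (centered_normal v) f w" and [measurable]: "f \<in> borel_measurable borel"
    for f :: "real \<Rightarrow> real" and w
    using that(1) unfolding D[symmetric] has_bochner_integral_iff
    by (simp add: integrable_distr_eq integral_distr)
  from * show "integrable M (\<lambda>\<omega>. (Z \<omega>)\<^sup>2)" "(LINT \<omega>|M. (Z \<omega>)\<^sup>2) = v"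
    "integrable M (\<lambda>\<omega>. exp (Z \<omega>))" "(LINT \<omega>|M. exp (Z \<omega>)) = exp (v / 2)"
    using tr[of "\<lambda>x. x\<^sup>2" v] tr[of exp "exp (v/2)"] by (auto simp: has_bochner_integral_iff)
qed

section \<open>Linear spaces of centred Gaussian variables and their tails\<close>

abbreviation (in prob_space) cross :: "('a \<Rightarrow> real) \<Rightarrow> ('a \<Rightarrow> real) \<Rightarrow> real" where
  "cross Z W \<equiv> expectation (\<lambda>\<omega>. Z \<omega> * W \<omega>)"

abbreviation (in prob_space) msq :: "('a \<Rightarrow> real) \<Rightarrow> real" where
  "msq Z \<equiv> expectation (\<lambda>\<omega>. (Z \<omega>)\<^sup>2)"

text \<open>Joint normality is encoded through one-dimensional laws: every linear combination is
  centred normal, possibly degenerate. Exponential moments of combinations are then functions of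
  covariances, and this is the form in which joint normality is used.\<close>

locale gaussian_space = prob_space M for M :: "'a measure" +
  fixes G :: "('a \<Rightarrow> real) set"
  assumes add: "Z \<in> G \<Longrightarrow> W \<in> G \<Longrightarrow> (\<lambda>\<omega>. Z \<omega> + W \<omega>) \<in> G"
    and scale: "Z \<in> G \<Longrightarrow> (\<lambda>\<omega>. a * Z \<omega>) \<in> G"
    and measurable_G: "Z \<in> G \<Longrightarrow> Z \<in> borel_measurable M"
    and normal: "Z \<in> G \<Longrightarrow> \<exists>v\<ge>0. distr M borel Z = centered_normal v"
begin

lemma square_integrable: "Z \<in> G \<Longrightarrow> integrable M (\<lambda>\<omega>. (Z \<omega>)\<^sup>2)"
  and exp_integrable: "Z \<in> G \<Longrightarrow> integrable M (\<lambda>\<omega>. exp (Z \<omega>))"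
  and expectation_exp: "Z \<in> G \<Longrightarrow> expectation (\<lambda>\<omega>. exp (Z \<omega>)) = exp (msq Z / 2)"
  using distr_centered_normal_moments[OF prob_space_axioms measurable_G] normal by metis+

lemma product_integrable: 
  assumes "Z \<in> G" "W \<in> G" shows "integrable M (\<lambda>\<omega>. Z \<omega> * W \<omega>)"
proof -
  have "integrable M (\<lambda>\<omega>. ((Z \<omega> + W \<omega>)\<^sup>2 - (Z \<omega>)\<^sup>2 - (W \<omega>)\<^sup>2) / 2)"
    using assms add[OF assms] by (intro Bochner_Integration.integrable_diff integrable_divide_zero square_integrable) auto
  then show ?thesis by (simp add: power2_eq_square algebra_simps)
qed

lemma expectation_square_lincomb:
  assumes "Z \<in> G" "W \<in> G"
  shows "expectation (\<lambda>\<omega>. (a * Z \<omega> + b * W \<omega>)\<^sup>2)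
    = a\<^sup>2 * msq Z + b\<^sup>2 * msq W + 2 * a * b * cross Z W"
proof -
  have "expectation (\<lambda>\<omega>. (a * Z \<omega> + b * W \<omega>)\<^sup>2)
    = expectation (\<lambda>\<omega>. a\<^sup>2 * (Z \<omega>)\<^sup>2 + b\<^sup>2 * (W \<omega>)\<^sup>2 + 2 * a * b * (Z \<omega> * W \<omega>))"
    by (intro Bochner_Integration.integral_cong) (auto simp: power2_eq_square algebra_simps)
  also have "\<dots> = a\<^sup>2 * msq Z + b\<^sup>2 * msq W + 2 * a * b * cross Z W"
    using product_integrable[OF assms] square_integrable assms by simp
  finally show ?thesis .
qed

lemma expectation_mult_lincomb:
  assumes "Z \<in> G" "W \<in> G" "Y \<in> G"
  shows "expectation (\<lambda>\<omega>. (a * Z \<omega> + b * W \<omega>) * Y \<omega>)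
    = a * cross Z Y + b * cross W Y"
proof -
  have "expectation (\<lambda>\<omega>. (a * Z \<omega> + b * W \<omega>) * Y \<omega>)
    = expectation (\<lambda>\<omega>. a * (Z \<omega> * Y \<omega>) + b * (W \<omega> * Y \<omega>))"
    by (intro Bochner_Integration.integral_cong) (auto simp: algebra_simps)
  then show ?thesis
    using product_integrable assms by simp
qed

lemma lincomb_in: "Z \<in> G \<Longrightarrow> W \<in> G \<Longrightarrow> (\<lambda>\<omega>. a * Z \<omega> + b * W \<omega>) \<in> G"
  by (intro add scale)

text \<open>Chernoff's bound; \<open>l = x / v\<close> minimises
  \<open>l\<^sup>2 * v / 2 - l * x\<close>. Since \<open>v\<close> may exceed the variance, the
  bound covers combinations whose variance is only estimated.\<close>

lemma upper_tail:
  assumes Z: "Z \<in> G" and v: "msq Z \<le> v" "0 < v" and "0 \<le> x"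
  shows "prob {\<omega>\<in>space M. x \<le> Z \<omega>} \<le> exp (- x\<^sup>2 / (2 * v))"
proof -
  note [measurable] = measurable_G[OF Z]
  define l where "l = x / v"
  have l: "0 \<le> l" using assms by (simp add: l_def)
  have lZ: "(\<lambda>\<omega>. l * Z \<omega>) \<in> G" by (rule scale[OF Z])
  have "prob {\<omega>\<in>space M. x \<le> Z \<omega>} \<le> prob {\<omega>\<in>space M. exp (l * x) \<le> exp (l * Z \<omega>)}"
    using l by (intro finite_measure_mono) (auto intro: mult_left_mono)
  also have "\<dots> \<le> expectation (\<lambda>\<omega>. exp (l * Z \<omega>)) / exp (l * x)"
    by (intro integral_Markov_inequality_measure[where A="{}"] exp_integrable[OF lZ]) auto
  also have "expectation (\<lambda>\<omega>. exp (l * Z \<omega>)) = exp (expectation (\<lambda>\<omega>. (l * Z \<omega>)\<^sup>2) / 2)"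
    by (rule expectation_exp[OF lZ])
  also have "expectation (\<lambda>\<omega>. (l * Z \<omega>)\<^sup>2) = l\<^sup>2 * msq Z"
    by (simp add: power_mult_distrib)
  also have "exp (l\<^sup>2 * msq Z / 2) / exp (l * x) \<le> exp (l\<^sup>2 * v / 2) / exp (l * x)"
    using v by (intro divide_right_mono) (auto intro: mult_left_mono)
  also have "\<dots> = exp (- x\<^sup>2 / (2 * v))"
    using v(2) by (simp add: l_def exp_diff[symmetric] field_simps power2_eq_square)
  finally show ?thesis .
qed

lemma abs_tail:
  assumes Z: "Z \<in> G" and v: "msq Z \<le> v" "0 < v" and "0 \<le> x"
  shows "prob {\<omega>\<in>space M. x \<le> \<bar>Z \<omega>\<bar>} \<le> 2 * exp (- x\<^sup>2 / (2 * v))"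
proof -
  note [measurable] = measurable_G[OF Z]
  have "prob {\<omega>\<in>space M. x \<le> \<bar>Z \<omega>\<bar>} = prob ({\<omega>\<in>space M. x \<le> Z \<omega>} \<union> {\<omega>\<in>space M. x \<le> -1 * Z \<omega>})"
    by (intro arg_cong[where f=prob]) auto
  also have "\<dots> \<le> prob {\<omega>\<in>space M. x \<le> Z \<omega>} + prob {\<omega>\<in>space M. x \<le> -1 * Z \<omega>}"
    by (intro measure_Un_le) auto
  also have "\<dots> \<le> 2 * exp (- x\<^sup>2 / (2 * v))"
    using upper_tail[OF assms] upper_tail[OF scale[OF Z, of "-1"] _ v(2) assms(4)] v by simp
  finally show ?thesis .
qed

text \<open>With signs \<open>s\<close>, \<open>t\<close> matching those of \<open>Z\<close> and
  \<open>W\<close>, the event forces \<open>a * s * Z + d * t * W\<close> above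
  \<open>(a\<^sup>2 + d\<^sup>2) * x\<close>, while the variance of this combination is at most
  \<open>(a\<^sup>2 + d\<^sup>2) * (1 + \<rho>)\<close> because
  \<open>2 * a * d \<le> a\<^sup>2 + d\<^sup>2\<close>. The tail is thus governed by the squared
  distance of \<open>(a, d)\<close> from the origin, and the four sign patterns give the factor
  4.\<close>

lemma joint_abs_tail:
  assumes Z: "Z \<in> G" "msq Z = 1" and W: "W \<in> G" "msq W = 1"
    and \<rho>: "\<bar>cross Z W\<bar> \<le> \<rho>"
    and ad: "0 \<le> a" "0 \<le> d" "0 < e" "e \<le> a\<^sup>2 + d\<^sup>2" and x: "0 \<le> x"
  shows "prob {\<omega>\<in>space M. a * x \<le> \<bar>Z \<omega>\<bar> \<and> d * x \<le> \<bar>W \<omega>\<bar>} \<le> 4 * exp (- e * x\<^sup>2 / (2 * (1 + \<rho>)))"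
proof -
  note [measurable] = measurable_G[OF Z(1)] measurable_G[OF W(1)]
  have \<rho>0: "0 \<le> \<rho>" using \<rho> by linarith
  let ?m = "a\<^sup>2 + d\<^sup>2"
  define T where "T s t = {\<omega>\<in>space M. ?m * x \<le> (a * s) * Z \<omega> + (d * t) * W \<omega>}" for s t :: real
  have [measurable]: "T s t \<in> events" for s t by (simp add: T_def)
  have m: "0 < ?m" using ad by linarith
  have bound: "prob (T s t) \<le> exp (- e * x\<^sup>2 / (2 * (1 + \<rho>)))" if "\<bar>s\<bar> = 1" "\<bar>t\<bar> = 1" for s t
  proof -
    have "expectation (\<lambda>\<omega>. ((a * s) * Z \<omega> + (d * t) * W \<omega>)\<^sup>2)
       = (a * s)\<^sup>2 + (d * t)\<^sup>2 + 2 * (a * s) * (d * t) * cross Z W"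
      unfolding expectation_square_lincomb[OF Z(1) W(1)] Z W by simp
    also have "\<dots> \<le> ?m + \<bar>2 * (a * s) * (d * t) * cross Z W\<bar>"
    proof -
      have "s\<^sup>2 = 1" "t\<^sup>2 = 1" using that by (auto simp: power2_eq_1_iff)
      then show ?thesis by (simp add: power_mult_distrib)
    qed
    also have "\<dots> = ?m + 2 * a * d * \<bar>cross Z W\<bar>"
      using that ad by (simp add: abs_mult)
    also have "\<dots> \<le> ?m + ?m * \<rho>"
    proof -
      have "2 * a * d \<le> ?m" by (rule sum_squares_bound)
      then have "2 * a * d * \<bar>cross Z W\<bar> \<le> ?m * \<rho>"
        using \<rho> ad by (intro mult_mono) auto
      then show ?thesis by simp
    qed
    finally have var: "expectation (\<lambda>\<omega>. ((a * s) * Z \<omega> + (d * t) * W \<omega>)\<^sup>2) \<le> ?m * (1 + \<rho>)"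
      by (simp add: algebra_simps)
    have "prob (T s t) \<le> exp (- (?m * x)\<^sup>2 / (2 * (?m * (1 + \<rho>))))"
      unfolding T_def using m \<rho>0 x
      by (intro upper_tail var lincomb_in Z W mult_nonneg_nonneg mult_pos_pos) auto
    also have "\<dots> = exp (- (?m * x\<^sup>2) / (2 * (1 + \<rho>)))"
    proof -
      have "(c * x)\<^sup>2 / (2 * (c * k)) = c * x\<^sup>2 / (2 * k)" if "0 < c" for c k :: real
        using that by (simp add: power2_eq_square)
      from this[OF m, of "1 + \<rho>"] show ?thesis by simp
    qed
    also have "\<dots> \<le> exp (- e * x\<^sup>2 / (2 * (1 + \<rho>)))"
      using ad \<rho>0 by (auto intro!: divide_right_mono mult_right_mono)
    finally show ?thesis .
  qed
  have "{\<omega>\<in>space M. a * x \<le> \<bar>Z \<omega>\<bar> \<and> d * x \<le> \<bar>W \<omega>\<bar>} \<subseteq> (T 1 1 \<union> T 1 (-1)) \<union> (T (-1) 1 \<union> T (-1) (-1))"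
  proof
    fix \<omega> assume "\<omega> \<in> {\<omega>\<in>space M. a * x \<le> \<bar>Z \<omega>\<bar> \<and> d * x \<le> \<bar>W \<omega>\<bar>}"
    then have w: "\<omega> \<in> space M" "a * x \<le> \<bar>Z \<omega>\<bar>" "d * x \<le> \<bar>W \<omega>\<bar>" by auto
    have "a * (a * x) + d * (d * x) \<le> a * \<bar>Z \<omega>\<bar> + d * \<bar>W \<omega>\<bar>"
      using w ad by (intro add_mono mult_left_mono) auto
    then show "\<omega> \<in> (T 1 1 \<union> T 1 (-1)) \<union> (T (-1) 1 \<union> T (-1) (-1))"
      using w(1) by (cases "Z \<omega> \<ge> 0"; cases "W \<omega> \<ge> 0") (auto simp: T_def power2_eq_square algebra_simps)
  qed
  then have "prob {\<omega>\<in>space M. a * x \<le> \<bar>Z \<omega>\<bar> \<and> d * x \<le> \<bar>W \<omega>\<bar>}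
      \<le> prob ((T 1 1 \<union> T 1 (-1)) \<union> (T (-1) 1 \<union> T (-1) (-1)))"
    by (intro finite_measure_mono) auto
  also have "\<dots> \<le> (prob (T 1 1) + prob (T 1 (-1))) + (prob (T (-1) 1) + prob (T (-1) (-1)))"
    by (intro order_trans[OF measure_Un_le] add_mono measure_Un_le) auto
  also have "\<dots> \<le> 4 * exp (- e * x\<^sup>2 / (2 * (1 + \<rho>)))"
    using bound[of 1 1] bound[of 1 "-1"] bound[of "-1" 1] bound[of "-1" "-1"] by simp
  finally show ?thesis .
qed


section \<open>Exponential tilting and the second moment method\<close>

lemma expectation_exp_lincomb_bounds:
  assumes P: "P \<in> G" "msq P = 1" and Q: "Q \<in> G" "msq Q = 1"
    and \<rho>: "\<bar>cross P Q\<bar> \<le> \<rho>" and k: "\<bar>x * y\<bar> \<le> k"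
  shows "integrable M (\<lambda>\<omega>. exp (\<beta> * (x * P \<omega> + y * Q \<omega>)))"
    "expectation (\<lambda>\<omega>. exp (\<beta> * (x * P \<omega> + y * Q \<omega>))) \<le> exp (\<beta>\<^sup>2 * ((x\<^sup>2 + y\<^sup>2) / 2 + k * \<rho>))"
    "exp (\<beta>\<^sup>2 * ((x\<^sup>2 + y\<^sup>2) / 2 - k * \<rho>)) \<le> expectation (\<lambda>\<omega>. exp (\<beta> * (x * P \<omega> + y * Q \<omega>)))"
proof -
  let ?c = "cross P Q"
  have in_G: "(\<lambda>\<omega>. \<beta> * (x * P \<omega> + y * Q \<omega>)) \<in> G"
    by (intro scale lincomb_in P Q)
  show "integrable M (\<lambda>\<omega>. exp (\<beta> * (x * P \<omega> + y * Q \<omega>)))"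
    by (rule exp_integrable[OF in_G])
  have "expectation (\<lambda>\<omega>. (\<beta> * (x * P \<omega> + y * Q \<omega>))\<^sup>2) = \<beta>\<^sup>2 * (x\<^sup>2 + y\<^sup>2 + 2 * (x * y * ?c))"
    using expectation_square_lincomb[OF P(1) Q(1), of x y] P Q by (simp add: power_mult_distrib)
  then have E: "expectation (\<lambda>\<omega>. exp (\<beta> * (x * P \<omega> + y * Q \<omega>))) = exp (\<beta>\<^sup>2 * ((x\<^sup>2 + y\<^sup>2) / 2 + x * y * ?c))"
    using expectation_exp[OF in_G] by (simp add: algebra_simps)
  \<comment> \<open>The exact exponent differs from that of the independent case by
    \<open>\<beta>\<^sup>2 * (x * y * ?c)\<close>, so bounding this term gives both
    estimates.\<close>
  have "\<bar>x * y * ?c\<bar> \<le> k * \<rho>"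
    unfolding abs_mult[of "x * y"] using k \<rho> by (intro mult_mono) auto
  then show "expectation (\<lambda>\<omega>. exp (\<beta> * (x * P \<omega> + y * Q \<omega>))) \<le> exp (\<beta>\<^sup>2 * ((x\<^sup>2 + y\<^sup>2) / 2 + k * \<rho>))"
    "exp (\<beta>\<^sup>2 * ((x\<^sup>2 + y\<^sup>2) / 2 - k * \<rho>)) \<le> expectation (\<lambda>\<omega>. exp (\<beta> * (x * P \<omega> + y * Q \<omega>)))"
    unfolding E by (auto intro!: mult_left_mono)
qed

lemma unit_circle_abs_le:
  fixes a1 a2 :: real
  assumes "a1\<^sup>2 + a2\<^sup>2 = 1"
  shows "\<bar>a1\<bar> \<le> 1" "\<bar>a2\<bar> \<le> 1" "\<bar>a1 * a2\<bar> \<le> 1"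
proof -
  have "a1\<^sup>2 \<le> 1" "a2\<^sup>2 \<le> 1" using assms zero_le_power2[of a1] zero_le_power2[of a2] by linarith+
  then show *: "\<bar>a1\<bar> \<le> 1" "\<bar>a2\<bar> \<le> 1" by (simp_all add: abs_square_le_1)
  show "\<bar>a1 * a2\<bar> \<le> 1" using mult_mono[OF *] by (simp add: abs_mult)
qed

text \<open>
  Under the density proportional to \<open>exp (\<beta> * (a1 * P + a2 * Q))\<close> the pair \<open>(P, Q)\<close> concentrates near
  \<open>\<beta> * (a1, a2)\<close>; the four exponential moments below bound the mass outside the \<open>\<epsilon> * \<beta>\<close>-box.
\<close>

lemma expectation_exp_near_ge:
  assumes P: "P \<in> G" "msq P = 1" and Q: "Q \<in> G" "msq Q = 1"
    and \<rho>: "\<bar>cross P Q\<bar> \<le> \<rho>"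
    and a: "a1\<^sup>2 + a2\<^sup>2 = 1" and \<epsilon>: "0 < \<epsilon>" "\<epsilon> \<le> 1" and \<beta>: "0 \<le> \<beta>"
  defines "F \<equiv> {\<omega>\<in>space M. \<bar>P \<omega> - a1 * \<beta>\<bar> \<le> \<epsilon> * \<beta> \<and> \<bar>Q \<omega> - a2 * \<beta>\<bar> \<le> \<epsilon> * \<beta>}"
  shows "exp (\<beta>\<^sup>2 / 2) * (exp (- \<beta>\<^sup>2 * \<rho>) - 4 * exp (\<beta>\<^sup>2 * (2 * \<rho> - \<epsilon>\<^sup>2 / 2)))
    \<le> expectation (\<lambda>\<omega>. exp (\<beta> * (a1 * P \<omega> + a2 * Q \<omega>)) * indicator F \<omega>)"
proof -
  note [measurable] = measurable_G[OF P(1)] measurable_G[OF Q(1)]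
  have [measurable]: "F \<in> events" by (simp add: F_def)
  have \<rho>0: "0 \<le> \<rho>" using \<rho> by linarith
  note a1 = unit_circle_abs_le(1)[OF a] and a2 = unit_circle_abs_le(2)[OF a] and a12 = unit_circle_abs_le(3)[OF a]
  \<comment> \<open>\<open>T s t\<close> is the tilted weight times \<open>exp (\<epsilon> * \<beta>
    * (s * (P - a1 * \<beta>) + t * (Q - a2 * \<beta>) - \<epsilon> * \<beta>))\<close>, so it
    dominates the weight where \<open>(P, Q)\<close> leaves the box through the side with outer
    normal \<open>(s, t)\<close>. The extra tilt costs \<open>\<epsilon>\<^sup>2 / 2\<close> in the
    exponent and the threshold gains \<open>\<epsilon>\<^sup>2\<close>; the net gain is the
    \<open>\<epsilon>\<^sup>2 / 2\<close> of the statement.\<close>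
  define T where "T s t \<omega> = exp (- \<epsilon> * \<beta>\<^sup>2 * (s * a1 + t * a2 + \<epsilon>)) * exp (\<beta> * ((a1 + s * \<epsilon>) * P \<omega> + (a2 + t * \<epsilon>) * Q \<omega>))"
    for s t :: real and \<omega>
  have T: "integrable M (T s t)" "expectation (T s t) \<le> exp (\<beta>\<^sup>2 / 2) * exp (\<beta>\<^sup>2 * (2 * \<rho> - \<epsilon>\<^sup>2 / 2))"
    if st: "\<bar>s\<bar> + \<bar>t\<bar> = 1" "s * t = 0" for s t
  proof -
    \<comment> \<open>Only one coordinate of the unit vector is shifted, by at most 1. The bound 2
      on the product becomes the \<open>2 * \<rho>\<close> of the statement.\<close>
    have "\<bar>(a1 + s * \<epsilon>) * (a2 + t * \<epsilon>)\<bar> \<le> 2"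
    proof (cases "s = 0")
      case True
      then have "\<bar>t\<bar> = 1" using st by simp
      then have "\<bar>t * \<epsilon>\<bar> \<le> 1" using \<epsilon> by (simp add: abs_mult)
      then have "\<bar>a2 + t * \<epsilon>\<bar> \<le> \<bar>a2\<bar> + 1" by linarith
      then have "\<bar>a1\<bar> * \<bar>a2 + t * \<epsilon>\<bar> \<le> 1 * 2" using a1 a2 by (intro mult_mono) auto
      then show ?thesis using True by (simp add: abs_mult)
    next
      case False
      then have t: "t = 0" using st by simp
      then have "\<bar>s\<bar> = 1" using st by simp
      then have "\<bar>s * \<epsilon>\<bar> \<le> 1" using \<epsilon> by (simp add: abs_mult)
      then have "\<bar>a1 + s * \<epsilon>\<bar> \<le> \<bar>a1\<bar> + 1" by linarith
      then have "\<bar>a1 + s * \<epsilon>\<bar> * \<bar>a2\<bar> \<le> 2 * 1" using a1 a2 by (intro mult_mono) auto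
      then show ?thesis using t by (simp add: abs_mult)
    qed
    note B = expectation_exp_lincomb_bounds[OF P Q \<rho> this, of \<beta>]
    show "integrable M (T s t)" unfolding T_def by (intro integrable_mult_right B)
    have st2: "s\<^sup>2 + t\<^sup>2 = 1" using st by (auto simp: abs_if split: if_splits)
    have "expectation (T s t) = exp (- \<epsilon> * \<beta>\<^sup>2 * (s * a1 + t * a2 + \<epsilon>)) * expectation (\<lambda>\<omega>. exp (\<beta> * ((a1 + s * \<epsilon>) * P \<omega> + (a2 + t * \<epsilon>) * Q \<omega>)))"
      unfolding T_def by simp
    also have "\<dots> \<le> exp (- \<epsilon> * \<beta>\<^sup>2 * (s * a1 + t * a2 + \<epsilon>)) * exp (\<beta>\<^sup>2 * (((a1 + s * \<epsilon>)\<^sup>2 + (a2 + t * \<epsilon>)\<^sup>2) / 2 + 2 * \<rho>))"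
      by (intro mult_left_mono B) auto
    also have "\<dots> = exp (\<beta>\<^sup>2 * (((a1 + s * \<epsilon>)\<^sup>2 + (a2 + t * \<epsilon>)\<^sup>2) / 2 + 2 * \<rho> - \<epsilon> * (s * a1 + t * a2 + \<epsilon>)))"
      by (simp add: exp_add[symmetric] algebra_simps)
    also have "((a1 + s * \<epsilon>)\<^sup>2 + (a2 + t * \<epsilon>)\<^sup>2) / 2 + 2 * \<rho> - \<epsilon> * (s * a1 + t * a2 + \<epsilon>) = (a1\<^sup>2 + a2\<^sup>2) / 2 + (s\<^sup>2 + t\<^sup>2) * \<epsilon>\<^sup>2 / 2 + 2 * \<rho> - \<epsilon>\<^sup>2"
      by (simp add: power2_eq_square field_simps)
    also have "exp (\<beta>\<^sup>2 * ((a1\<^sup>2 + a2\<^sup>2) / 2 + (s\<^sup>2 + t\<^sup>2) * \<epsilon>\<^sup>2 / 2 + 2 * \<rho> - \<epsilon>\<^sup>2)) = exp (\<beta>\<^sup>2 / 2) * exp (\<beta>\<^sup>2 * (2 * \<rho> - \<epsilon>\<^sup>2 / 2))"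
      by (simp add: st2 a exp_add[symmetric] algebra_simps)
    finally show "expectation (T s t) \<le> exp (\<beta>\<^sup>2 / 2) * exp (\<beta>\<^sup>2 * (2 * \<rho> - \<epsilon>\<^sup>2 / 2))" .
  qed
  note B = expectation_exp_lincomb_bounds[OF P Q \<rho> a12, of \<beta>]
  let ?e = "\<lambda>\<omega>. exp (\<beta> * (a1 * P \<omega> + a2 * Q \<omega>))"
  \<comment> \<open>Inside the box the subtracted terms are nonnegative; outside, one of the four
    exceeds the weight and the left side is at most 0.\<close>
  have pw: "?e \<omega> - (T 1 0 \<omega> + T (-1) 0 \<omega> + T 0 1 \<omega> + T 0 (-1) \<omega>) \<le> ?e \<omega> * indicator F \<omega>" if "\<omega> \<in> space M" for \<omega>
  proof (cases "\<omega> \<in> F")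
    case True
    have "0 \<le> T s t \<omega>" for s t by (simp add: T_def)
    from this[of 1 0] this[of "-1" 0] this[of 0 1] this[of 0 "-1"] True show ?thesis by simp
  next
    case False
    have T_eq: "T s t \<omega> = ?e \<omega> * exp (\<epsilon> * \<beta> * (s * (P \<omega> - a1 * \<beta>) + t * (Q \<omega> - a2 * \<beta>) - \<epsilon> * \<beta>))" for s t
      by (simp add: T_def exp_add[symmetric] algebra_simps power2_eq_square)
    have ge: "?e \<omega> \<le> T s t \<omega>" if "\<epsilon> * \<beta> \<le> s * (P \<omega> - a1 * \<beta>) + t * (Q \<omega> - a2 * \<beta>)" for s t
      unfolding T_eq using that \<epsilon> \<beta> by simp
    have nn: "0 \<le> T s t \<omega>" for s t by (simp add: T_def)
    from False that consider "\<epsilon> * \<beta> \<le> P \<omega> - a1 * \<beta>" | "\<epsilon> * \<beta> \<le> - (P \<omega> - a1 * \<beta>)"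
      | "\<epsilon> * \<beta> \<le> Q \<omega> - a2 * \<beta>" | "\<epsilon> * \<beta> \<le> - (Q \<omega> - a2 * \<beta>)" by (fastforce simp: F_def)
    then have "?e \<omega> \<le> T 1 0 \<omega> + T (-1) 0 \<omega> + T 0 1 \<omega> + T 0 (-1) \<omega>"
      using ge[of 1 0] ge[of "-1" 0] ge[of 0 1] ge[of 0 "-1"] nn[of 1 0] nn[of "-1" 0] nn[of 0 1] nn[of 0 "-1"]
      by cases simp_all
    then show ?thesis using False by simp
  qed
  have "exp (\<beta>\<^sup>2 / 2) * (exp (- \<beta>\<^sup>2 * \<rho>) - 4 * exp (\<beta>\<^sup>2 * (2 * \<rho> - \<epsilon>\<^sup>2 / 2)))
     = exp (\<beta>\<^sup>2 * ((a1\<^sup>2 + a2\<^sup>2) / 2 - 1 * \<rho>)) - 4 * (exp (\<beta>\<^sup>2 / 2) * exp (\<beta>\<^sup>2 * (2 * \<rho> - \<epsilon>\<^sup>2 / 2)))"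
    unfolding right_diff_distrib[of "exp (\<beta>\<^sup>2 / 2)"] a by (simp add: exp_add[symmetric] algebra_simps)
  also have "\<dots> \<le> expectation ?e - (expectation (T 1 0) + expectation (T (-1) 0) + expectation (T 0 1) + expectation (T 0 (-1)))"
    using B(3) T(2)[of 1 0] T(2)[of "-1" 0] T(2)[of 0 1] T(2)[of 0 "-1"] by simp
  also have "\<dots> = expectation (\<lambda>\<omega>. ?e \<omega> - (T 1 0 \<omega> + T (-1) 0 \<omega> + T 0 1 \<omega> + T 0 (-1) \<omega>))"
    using T(1)[of 1 0] T(1)[of "-1" 0] T(1)[of 0 1] T(1)[of 0 "-1"] B(1) by simp
  also have "\<dots> \<le> cross ?e (indicator F)"
  proof (rule integral_mono)
    show "integrable M (\<lambda>\<omega>. ?e \<omega> - (T 1 0 \<omega> + T (-1) 0 \<omega> + T 0 1 \<omega> + T 0 (-1) \<omega>))"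
      by (intro Bochner_Integration.integrable_diff Bochner_Integration.integrable_add T(1) B(1)) simp_all
    show "integrable M (\<lambda>\<omega>. ?e \<omega> * indicator F \<omega>)"
      by (intro integrable_real_mult_indicator B(1)) simp
  qed (rule pw)
  finally show ?thesis .
qed

text \<open>The sum \<open>S\<close> of the restricted weights vanishes unless some time is hit, so
  the hit probability is at least the ratio of \<open>(expectation S)\<^sup>2\<close> to the second
  moment. The mean is at least \<open>m * exp (\<beta>\<^sup>2 / 2) * A\<close>. After division by
  the square of \<open>m * exp (\<beta>\<^sup>2 / 2)\<close>, the off-diagonal terms leave
  \<open>exp (6 * \<beta>\<^sup>2 * \<rho>)\<close> and the diagonal ones leave the summand divided
  by \<open>real m\<close>.\<close>

theorem prob_ex_near_ge:
  fixes P Q :: "nat \<Rightarrow> 'a \<Rightarrow> real"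
  assumes P: "\<And>j. j < m \<Longrightarrow> P j \<in> G" "\<And>j. j < m \<Longrightarrow> msq (P j) = 1"
    and Q: "\<And>j. j < m \<Longrightarrow> Q j \<in> G" "\<And>j. j < m \<Longrightarrow> msq (Q j) = 1"
    and PQ: "\<And>i j. i < m \<Longrightarrow> j < m \<Longrightarrow> \<bar>cross (P i) (Q j)\<bar> \<le> \<rho>"
    and PP: "\<And>i j. i < m \<Longrightarrow> j < m \<Longrightarrow> i \<noteq> j \<Longrightarrow> \<bar>cross (P i) (P j)\<bar> \<le> \<rho>"
    and QQ: "\<And>i j. i < m \<Longrightarrow> j < m \<Longrightarrow> i \<noteq> j \<Longrightarrow> \<bar>cross (Q i) (Q j)\<bar> \<le> \<rho>"
    and a: "a1\<^sup>2 + a2\<^sup>2 = 1" and \<epsilon>: "0 < \<epsilon>" "\<epsilon> \<le> 1" and \<beta>: "0 \<le> \<beta>" and m: "0 < m"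
    and A: "A = exp (- \<beta>\<^sup>2 * \<rho>) - 4 * exp (\<beta>\<^sup>2 * (2 * \<rho> - \<epsilon>\<^sup>2 / 2))" "0 < A"
  shows "A\<^sup>2 / (exp (6 * \<beta>\<^sup>2 * \<rho>) + exp (\<beta>\<^sup>2 * (1/2 + 2 * \<epsilon> + \<rho>)) / real m)
    \<le> prob {\<omega>\<in>space M. \<exists>j<m. \<bar>P j \<omega> - a1 * \<beta>\<bar> \<le> \<epsilon> * \<beta> \<and> \<bar>Q j \<omega> - a2 * \<beta>\<bar> \<le> \<epsilon> * \<beta>}"
proof -
  note a1 = unit_circle_abs_le(1)[OF a] and a2 = unit_circle_abs_le(2)[OF a] and a12 = unit_circle_abs_le(3)[OF a]
  have \<rho>0: "0 \<le> \<rho>" using PQ[of 0 0] m by linarith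
  define l where "l j \<omega> = a1 * P j \<omega> + a2 * Q j \<omega>" for j \<omega>
  define F where "F j = {\<omega>\<in>space M. \<bar>P j \<omega> - a1 * \<beta>\<bar> \<le> \<epsilon> * \<beta> \<and> \<bar>Q j \<omega> - a2 * \<beta>\<bar> \<le> \<epsilon> * \<beta>}" for j
  define W where "W j \<omega> = exp (\<beta> * l j \<omega>) * indicator (F j) \<omega>" for j \<omega>
  define D where "D = (\<Union>j<m. F j)"
  have [measurable]: "P j \<in> borel_measurable M" "Q j \<in> borel_measurable M" if "j < m" for j
    using P Q measurable_G that by auto
  have F[measurable]: "F j \<in> events" if "j < m" for j using that by (simp add: F_def)
  have D[measurable]: "D \<in> events" unfolding D_def by auto
  have lG: "l j \<in> G" if "j < m" for j unfolding l_def using that by (intro lincomb_in P Q)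
  have l_meas[measurable]: "l j \<in> borel_measurable M" if "j < m" for j using lG measurable_G that by auto
  have W_meas[measurable]: "W j \<in> borel_measurable M" if "j < m" for j using that unfolding W_def by measurable
  have W0: "0 \<le> W j \<omega>" for j \<omega> by (simp add: W_def)
  have var_l: "msq (l j) \<le> 1 + 2 * \<rho>" if "j < m" for j
  proof -
    have "\<bar>a1 * a2 * cross (P j) (Q j)\<bar> \<le> 1 * \<rho>"
      unfolding abs_mult[of "a1 * a2"] using a12 PQ[OF that that] by (intro mult_mono) auto
    then show ?thesis
      unfolding l_def using expectation_square_lincomb[OF P(1) Q(1), OF that that, of a1 a2] P Q that a by simp
  qed
  have cov_l: "cross (l i) (l j) \<le> 4 * \<rho>" if "i < m" "j < m" "i \<noteq> j" for i j
  proof -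
    have sw: "cross Z Y = cross Y Z" for Z Y :: "'a \<Rightarrow> real"
      by (simp add: mult.commute)
    have e: "cross (l i) (l j) = a1 * (a1 * cross (P j) (P i) + a2 * cross (Q j) (P i))
      + a2 * (a1 * cross (P j) (Q i) + a2 * cross (Q j) (Q i))"
      unfolding l_def[of i] expectation_mult_lincomb[OF P(1)[OF that(1)] Q(1)[OF that(1)] lG[OF that(2)]]
      unfolding sw[of "P i" "l j"] sw[of "Q i" "l j"]
      unfolding l_def[of j]
      unfolding expectation_mult_lincomb[OF P(1)[OF that(2)] Q(1)[OF that(2)] P(1)[OF that(1)]]
        expectation_mult_lincomb[OF P(1)[OF that(2)] Q(1)[OF that(2)] Q(1)[OF that(1)]] ..
    have le: "a * x \<le> k" if "\<bar>a\<bar> \<le> 1" "\<bar>x\<bar> \<le> k" for a x k :: real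
    proof -
      have "\<bar>a\<bar> * \<bar>x\<bar> \<le> 1 * k" using that by (intro mult_mono) auto
      then show ?thesis by (simp add: abs_mult[symmetric])
    qed
    have le': "\<bar>a * x\<bar> \<le> k" if "\<bar>a\<bar> \<le> 1" "\<bar>x\<bar> \<le> k" for a x k :: real
      using le[OF that] le[of "-a" x k] that by auto
    have "\<bar>a1 * cross (P j) (P i) + a2 * cross (Q j) (P i)\<bar> \<le> 2 * \<rho>"
      using le'[OF a1 PP[of j i]] le'[OF a2, of "cross (Q j) (P i)" \<rho>] PQ[of i j] that by (simp add: sw[of "Q j" "P i"])
    moreover have "\<bar>a1 * cross (P j) (Q i) + a2 * cross (Q j) (Q i)\<bar> \<le> 2 * \<rho>"
      using le'[OF a1 PQ[of j i]] le'[OF a2 QQ[of j i]] that by simp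
    ultimately show ?thesis unfolding e using le[OF a1] le[OF a2] by fastforce
  qed
  \<comment> \<open>Off the diagonal the indicators are dropped: weakly correlated exponentials have
    a product moment close to the product of their means.\<close>
  have WW_le: "W i \<omega> * W j \<omega> \<le> exp (\<beta> * (1 * l i \<omega> + 1 * l j \<omega>))" for i j \<omega>
    by (simp add: W_def exp_add[symmetric] indicator_def algebra_simps)
  have lij: "(\<lambda>\<omega>. \<beta> * (1 * l i \<omega> + 1 * l j \<omega>)) \<in> G" if "i < m" "j < m" for i j
    using that by (intro scale lincomb_in lG)
  have WW_int: "integrable M (\<lambda>\<omega>. W i \<omega> * W j \<omega>)" if "i < m" "j < m" for i j
    using that WW_le[of i _ j] W0
    by (intro Bochner_Integration.integrable_bound[OF exp_integrable[OF lij[OF that]]]) (auto intro!: mult_nonneg_nonneg)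
  have W_int: "integrable M (W j)" if "j < m" for j
    unfolding W_def using that exp_integrable[OF scale[OF lG[OF that]]] by (intro integrable_real_mult_indicator) auto
  have off: "cross (W i) (W j) \<le> exp (\<beta>\<^sup>2 + 6 * \<beta>\<^sup>2 * \<rho>)" if ij: "i < m" "j < m" "i \<noteq> j" for i j
  proof -
    have "cross (W i) (W j) \<le> expectation (\<lambda>\<omega>. exp (\<beta> * (1 * l i \<omega> + 1 * l j \<omega>)))"
      using ij by (intro integral_mono WW_int exp_integrable lij WW_le) auto
    also have "\<dots> = exp (\<beta>\<^sup>2 * expectation (\<lambda>\<omega>. (1 * l i \<omega> + 1 * l j \<omega>)\<^sup>2) / 2)"
      by (subst expectation_exp[OF lij[OF ij(1,2)]]) (simp add: power_mult_distrib)
    \<comment> \<open>Two variances of at most \<open>1 + 2 * \<rho>\<close> and twice a covariance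
      of at most \<open>4 * \<rho>\<close>; half of \<open>12 * \<rho>\<close> is the 6 of the
      statement.\<close>
    also have "\<dots> \<le> exp (\<beta>\<^sup>2 * (2 + 12 * \<rho>) / 2)"
      unfolding expectation_square_lincomb[OF lG[OF ij(1)] lG[OF ij(2)]]
      using var_l[OF ij(1)] var_l[OF ij(2)] cov_l[OF ij]
      by (simp only: exp_le_cancel_iff) (intro divide_right_mono mult_left_mono, auto)
    also have "\<dots> = exp (\<beta>\<^sup>2 + 6 * \<beta>\<^sup>2 * \<rho>)" by (simp add: algebra_simps)
    finally show ?thesis .
  qed
  have diag: "cross (W j) (W j) \<le> exp (\<beta>\<^sup>2 * (3/2 + 2 * \<epsilon> + \<rho>))" if j: "j < m" for j
  proof -
    note B = expectation_exp_lincomb_bounds[OF P(1)[OF j] P(2)[OF j] Q(1)[OF j] Q(2)[OF j] PQ[OF j j] a12, of \<beta>]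
    \<comment> \<open>Here the restriction pays: on \<open>F j\<close> the variable
      \<open>l j\<close> is at most \<open>\<beta> * (1 + 2 * \<epsilon>)\<close>, so one of the two
      factors is bounded by a constant and a single exponential moment remains. Without it the
      diagonal term would be of order \<open>exp (2 * \<beta>\<^sup>2)\<close>.\<close>
    have pw: "W j \<omega> * W j \<omega> \<le> exp (\<beta>\<^sup>2 * (1 + 2 * \<epsilon>)) * exp (\<beta> * (a1 * P j \<omega> + a2 * Q j \<omega>))" for \<omega>
    proof (cases "\<omega> \<in> F j")
      case True
      have "a1 * (P j \<omega> - a1 * \<beta>) \<le> \<epsilon> * \<beta>" "a2 * (Q j \<omega> - a2 * \<beta>) \<le> \<epsilon> * \<beta>"
      proof -
        have "\<bar>a\<bar> * \<bar>x\<bar> \<le> 1 * k" if "\<bar>a\<bar> \<le> 1" "\<bar>x\<bar> \<le> k" for a x k :: real using that by (intro mult_mono) auto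
        then have "a * x \<le> k" if "\<bar>a\<bar> \<le> 1" "\<bar>x\<bar> \<le> k" for a x k :: real using that by (simp add: abs_mult[symmetric]) (meson abs_le_D1)
        then show "a1 * (P j \<omega> - a1 * \<beta>) \<le> \<epsilon> * \<beta>" "a2 * (Q j \<omega> - a2 * \<beta>) \<le> \<epsilon> * \<beta>"
          using True a1 a2 by (auto simp: F_def)
      qed
      then have "l j \<omega> \<le> (a1\<^sup>2 + a2\<^sup>2) * \<beta> + 2 * \<epsilon> * \<beta>" by (simp add: l_def power2_eq_square algebra_simps)
      then have "l j \<omega> \<le> \<beta> * (1 + 2 * \<epsilon>)" by (simp add: a algebra_simps)
      then have "\<beta> * l j \<omega> \<le> \<beta> * (\<beta> * (1 + 2 * \<epsilon>))" using \<beta> by (rule mult_left_mono)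
      then have "\<beta> * l j \<omega> \<le> \<beta>\<^sup>2 * (1 + 2 * \<epsilon>)" by (simp add: power2_eq_square mult.assoc)
      then have "exp (\<beta> * l j \<omega>) * exp (\<beta> * l j \<omega>) \<le> exp (\<beta>\<^sup>2 * (1 + 2 * \<epsilon>)) * exp (\<beta> * l j \<omega>)"
        by (intro mult_right_mono) auto
      then show ?thesis using True by (simp add: W_def l_def)
    qed (simp add: W_def)
    have "cross (W j) (W j) \<le> expectation (\<lambda>\<omega>. exp (\<beta>\<^sup>2 * (1 + 2 * \<epsilon>)) * exp (\<beta> * (a1 * P j \<omega> + a2 * Q j \<omega>)))"
      using j by (intro integral_mono WW_int pw integrable_mult_right B) auto
    also have "\<dots> = exp (\<beta>\<^sup>2 * (1 + 2 * \<epsilon>)) * expectation (\<lambda>\<omega>. exp (\<beta> * (a1 * P j \<omega> + a2 * Q j \<omega>)))" by simp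
    also have "\<dots> \<le> exp (\<beta>\<^sup>2 * (1 + 2 * \<epsilon>)) * exp (\<beta>\<^sup>2 * ((a1\<^sup>2 + a2\<^sup>2) / 2 + 1 * \<rho>))"
      by (intro mult_left_mono B) auto
    also have "\<dots> = exp (\<beta>\<^sup>2 * (3/2 + 2 * \<epsilon> + \<rho>))" by (simp add: a exp_add[symmetric] algebra_simps)
    finally show ?thesis .
  qed
  define S where "S \<omega> = (\<Sum>j<m. W j \<omega>)" for \<omega>
  define Bd where "Bd = (real m)\<^sup>2 * exp (\<beta>\<^sup>2 + 6 * \<beta>\<^sup>2 * \<rho>) + real m * exp (\<beta>\<^sup>2 * (3/2 + 2 * \<epsilon> + \<rho>))"
  define Ad where "Ad = real m * (exp (\<beta>\<^sup>2 / 2) * A)"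
  have Ad: "0 < Ad" using m A by (simp add: Ad_def)
  have Bd: "0 < Bd" using m by (auto simp: Bd_def intro!: add_pos_pos mult_pos_pos)
  have S_sq: "(S \<omega>)\<^sup>2 = (\<Sum>i<m. \<Sum>j<m. W i \<omega> * W j \<omega>)" for \<omega>
    by (simp add: S_def power2_eq_square sum_product)
  have S2_int: "integrable M (\<lambda>\<omega>. (S \<omega>)\<^sup>2)" unfolding S_sq by (intro Bochner_Integration.integrable_sum WW_int) auto
  have S_int: "integrable M S" unfolding S_def[abs_def] by (intro Bochner_Integration.integrable_sum W_int) auto
  have "msq S = (\<Sum>i<m. \<Sum>j<m. cross (W i) (W j))"
    unfolding S_sq
    by (subst Bochner_Integration.integral_sum; (intro sum.cong refl Bochner_Integration.integral_sum)?)
      (auto intro!: WW_int Bochner_Integration.integrable_sum)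
  also have "\<dots> \<le> (\<Sum>i<m. \<Sum>j<m. exp (\<beta>\<^sup>2 + 6 * \<beta>\<^sup>2 * \<rho>) + (if i = j then exp (\<beta>\<^sup>2 * (3/2 + 2 * \<epsilon> + \<rho>)) else 0))"
    using off diag by (intro sum_mono) (auto intro: add_increasing)
  also have "\<dots> = Bd" by (simp add: sum.distrib Bd_def power2_eq_square algebra_simps)
  finally have ES2: "msq S \<le> Bd" .
  have "Ad = (\<Sum>j<m. exp (\<beta>\<^sup>2 / 2) * A)" by (simp add: Ad_def)
  also have "\<dots> \<le> (\<Sum>j<m. expectation (W j))"
    unfolding A(1) W_def[abs_def] l_def F_def using PQ
    by (intro sum_mono expectation_exp_near_ge P Q a \<epsilon> \<beta>) auto
  also have "\<dots> = expectation S" unfolding S_def[abs_def] by (subst Bochner_Integration.integral_sum) (auto intro: W_int)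
  finally have ES: "Ad \<le> expectation S" .
  \<comment> \<open>The pointwise bound
    \<open>2 * t * S - S\<^sup>2 \<le> t\<^sup>2 * indicator D\<close> gives
    \<open>prob D \<ge> (2 * t * Ad - Bd) / t\<^sup>2\<close>, and this choice of \<open>t\<close>
    maximises the right side, with value \<open>Ad\<^sup>2 / Bd\<close>.\<close>
  define t where "t = Bd / Ad"
  have t: "0 < t" using Ad Bd by (simp add: t_def)
  have pw: "2 * t * S \<omega> - (S \<omega>)\<^sup>2 \<le> t\<^sup>2 * indicator D \<omega>" for \<omega>
  proof (cases "\<omega> \<in> D")
    case True
    have "0 \<le> (S \<omega> - t)\<^sup>2" by simp
    then show ?thesis using True by (simp add: power2_diff algebra_simps)
  next
    case False
    then have "S \<omega> = 0" by (simp add: S_def W_def D_def)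
    then show ?thesis using False by simp
  qed
  have "2 * t * Ad - Bd \<le> 2 * t * expectation S - msq S"
    using ES ES2 t by (intro diff_mono mult_left_mono) auto
  also have "\<dots> = expectation (\<lambda>\<omega>. 2 * t * S \<omega> - (S \<omega>)\<^sup>2)" using S_int S2_int by simp
  also have "\<dots> \<le> expectation (\<lambda>\<omega>. t\<^sup>2 * indicator D \<omega>)"
    using S_int S2_int
    by (intro integral_mono pw integrable_mult_right integrable_real_indicator) (auto simp: emeasure_eq_measure)
  also have "\<dots> = t\<^sup>2 * prob D" by simp
  finally have "Bd \<le> Bd\<^sup>2 / Ad\<^sup>2 * prob D" using Ad by (simp add: t_def power_divide)
  then have "Ad\<^sup>2 / Bd \<le> prob D" using Ad Bd by (simp add: field_simps power2_eq_square)
  moreover have "Ad\<^sup>2 / Bd = A\<^sup>2 / (exp (6 * \<beta>\<^sup>2 * \<rho>) + exp (\<beta>\<^sup>2 * (1/2 + 2 * \<epsilon> + \<rho>)) / real m)"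
  proof -
    have e1: "exp (\<beta>\<^sup>2 * (3/2 + 2 * \<epsilon> + \<rho>)) = exp (\<beta>\<^sup>2) * exp (\<beta>\<^sup>2 * (1/2 + 2 * \<epsilon> + \<rho>))"
      by (simp add: exp_add[symmetric] algebra_simps)
    have e2: "(exp (\<beta>\<^sup>2 / 2))\<^sup>2 = exp (\<beta>\<^sup>2)" by (simp add: power2_eq_square exp_add[symmetric])
    have "Bd = ((real m)\<^sup>2 * exp (\<beta>\<^sup>2)) * (exp (6 * \<beta>\<^sup>2 * \<rho>) + exp (\<beta>\<^sup>2 * (1/2 + 2 * \<epsilon> + \<rho>)) / real m)"
      using m unfolding Bd_def e1 by (simp add: exp_add power2_eq_square field_simps)
    moreover have "Ad\<^sup>2 = ((real m)\<^sup>2 * exp (\<beta>\<^sup>2)) * A\<^sup>2"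
      by (simp add: Ad_def power_mult_distrib e2)
    ultimately show ?thesis using m by simp
  qed
  moreover have "D = {\<omega>\<in>space M. \<exists>j<m. \<bar>P j \<omega> - a1 * \<beta>\<bar> \<le> \<epsilon> * \<beta> \<and> \<bar>Q j \<omega> - a2 * \<beta>\<bar> \<le> \<epsilon> * \<beta>}"
    by (auto simp: D_def F_def)
  ultimately show ?thesis by simp
qed

end

section \<open>Wiener integrals\<close>

text \<open>The hypothesis speaks of nonnegative integrals, which may be infinite, so integrability
  of the limit comes from one approximant at finite distance. Convergence of the norms follows from
  the pointwise bound \<open>\<bar>g\<^sup>2 - f\<^sup>2\<bar> \<le> (1 + 1 / \<theta>) * (f -
  g)\<^sup>2 + \<theta> * f\<^sup>2\<close> with \<open>\<theta>\<close> small.\<close>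

lemma L2_limit:
  fixes f :: "'c \<Rightarrow> real" and g :: "nat \<Rightarrow> 'c \<Rightarrow> real"
  assumes [measurable]: "f \<in> borel_measurable K" "\<And>n. g n \<in> borel_measurable K"
    and g: "\<And>n. integrable K (\<lambda>x. (g n x)\<^sup>2)"
    and lim: "(\<lambda>n. \<integral>\<^sup>+x. ennreal ((f x - g n x)\<^sup>2) \<partial>K) \<longlonglongrightarrow> 0"
  shows "integrable K (\<lambda>x. (f x)\<^sup>2)" "(\<lambda>n. LINT x|K. (g n x)\<^sup>2) \<longlonglongrightarrow> (LINT x|K. (f x)\<^sup>2)"
proof -
  have sq2: "(x + y)\<^sup>2 \<le> 2 * x\<^sup>2 + 2 * y\<^sup>2" for x y :: real
    using sum_squares_bound[of x y] by (simp add: power2_sum)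
  have "eventually (\<lambda>n. (\<integral>\<^sup>+x. ennreal ((f x - g n x)\<^sup>2) \<partial>K) < 1) sequentially"
    using lim by (rule order_tendstoD) simp
  then obtain n where "(\<integral>\<^sup>+x. ennreal ((f x - g n x)\<^sup>2) \<partial>K) < 1"
    by (auto simp: eventually_sequentially)
  then have h: "integrable K (\<lambda>x. (f x - g n x)\<^sup>2)"
    by (intro integrableI_nonneg) (auto intro: less_trans)
  show f: "integrable K (\<lambda>x. (f x)\<^sup>2)"
  proof (rule Bochner_Integration.integrable_bound)
    show "integrable K (\<lambda>x. 2 * (f x - g n x)\<^sup>2 + 2 * (g n x)\<^sup>2)"
      using h g by (intro Bochner_Integration.integrable_add integrable_mult_right)
    show "AE x in K. norm ((f x)\<^sup>2) \<le> norm (2 * (f x - g n x)\<^sup>2 + 2 * (g n x)\<^sup>2)"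
      by (intro AE_I2) (use sq2[of "f x - g n x" "g n x" for x] in simp)
  qed simp
  have h: "integrable K (\<lambda>x. (f x - g n x)\<^sup>2)" for n
  proof (rule Bochner_Integration.integrable_bound)
    show "integrable K (\<lambda>x. 2 * (f x)\<^sup>2 + 2 * (g n x)\<^sup>2)"
      using f g by (intro Bochner_Integration.integrable_add integrable_mult_right)
    show "AE x in K. norm ((f x - g n x)\<^sup>2) \<le> norm (2 * (f x)\<^sup>2 + 2 * (g n x)\<^sup>2)"
      by (intro AE_I2) (use sq2[of "f x" "- g n x" for x] in simp)
  qed simp
  define e where "e n = (LINT x|K. (f x - g n x)\<^sup>2)" for n
  have e0: "0 \<le> e n" for n by (simp add: e_def)
  have "(\<lambda>n. ennreal (e n)) \<longlonglongrightarrow> ennreal 0"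
    using lim h by (simp add: e_def nn_integral_eq_integral)
  then have e: "e \<longlonglongrightarrow> 0" using e0 by (subst (asm) tendsto_ennreal_iff) auto
  let ?F = "LINT x|K. (f x)\<^sup>2"
  have F0: "0 \<le> ?F" by simp
  have bound: "\<bar>(LINT x|K. (g n x)\<^sup>2) - ?F\<bar> \<le> (1 + 1 / \<theta>) * e n + \<theta> * ?F" if \<theta>: "0 < \<theta>" for \<theta> n
  proof -
    have pw: "\<bar>(g n x)\<^sup>2 - (f x)\<^sup>2\<bar> \<le> (1 + 1 / \<theta>) * (f x - g n x)\<^sup>2 + \<theta> * (f x)\<^sup>2" for x
    proof -
      let ?h = "f x - g n x"
      have 1: "(g n x)\<^sup>2 - (f x)\<^sup>2 = ?h\<^sup>2 - 2 * (f x * ?h)" by (simp add: power2_eq_square algebra_simps)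
      \<comment> \<open>The mixed term is split with weights \<open>sqrt \<theta>\<close> and
        \<open>1 / sqrt \<theta>\<close>, so that \<open>f\<close> receives the small
        factor.\<close>
      have "2 * \<bar>sqrt \<theta> * f x\<bar> * \<bar>?h / sqrt \<theta>\<bar> \<le> \<bar>sqrt \<theta> * f x\<bar>\<^sup>2 + \<bar>?h / sqrt \<theta>\<bar>\<^sup>2"
        by (rule sum_squares_bound)
      then have "2 * \<bar>f x * ?h\<bar> \<le> \<theta> * (f x)\<^sup>2 + (1 / \<theta>) * ?h\<^sup>2"
        using \<theta> by (simp add: abs_mult power_mult_distrib power_divide)
      then have "\<bar>2 * (f x * ?h)\<bar> \<le> \<theta> * (f x)\<^sup>2 + (1 / \<theta>) * ?h\<^sup>2" by (simp add: abs_mult)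
      moreover have "\<bar>?h\<^sup>2 - 2 * (f x * ?h)\<bar> \<le> ?h\<^sup>2 + \<bar>2 * (f x * ?h)\<bar>" using abs_triangle_ineq4[of "?h\<^sup>2"] by simp
      ultimately show ?thesis unfolding 1 by (simp add: algebra_simps)
    qed
    have "\<bar>(LINT x|K. (g n x)\<^sup>2) - ?F\<bar> = \<bar>LINT x|K. (g n x)\<^sup>2 - (f x)\<^sup>2\<bar>" using f g by simp
    also have "\<dots> \<le> (LINT x|K. \<bar>(g n x)\<^sup>2 - (f x)\<^sup>2\<bar>)"
      by (rule integral_abs_bound)
    also have "\<dots> \<le> (LINT x|K. (1 + 1 / \<theta>) * (f x - g n x)\<^sup>2 + \<theta> * (f x)\<^sup>2)"
      using f g h by (intro integral_mono pw integrable_abs Bochner_Integration.integrable_diff Bochner_Integration.integrable_add integrable_mult_right) auto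
    also have "\<dots> = (1 + 1 / \<theta>) * e n + \<theta> * ?F" using f h by (simp add: e_def)
    finally show ?thesis .
  qed
  show "(\<lambda>n. LINT x|K. (g n x)\<^sup>2) \<longlonglongrightarrow> ?F"
  proof (rule LIMSEQ_I)
    fix r :: real assume r: "0 < r"
    \<comment> \<open>Adding 1 keeps the denominator positive when \<open>?F\<close> is 0.\<close>
    define \<theta> where "\<theta> = r / (2 * (?F + 1))"
    have \<theta>: "0 < \<theta>" unfolding \<theta>_def using r F0 by (intro divide_pos_pos mult_pos_pos add_nonneg_pos) auto
    have "\<theta> * ?F \<le> \<theta> * (?F + 1)" using \<theta> by (intro mult_left_mono) auto
    moreover have "?F + 1 \<noteq> 0" using F0 by linarith
    then have "\<theta> * (?F + 1) = r / 2" unfolding \<theta>_def by (metis nonzero_eq_divide_eq times_divide_times_eq divide_divide_eq_left mult.commute)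
    ultimately have \<theta>F: "\<theta> * ?F \<le> r / 2" by simp
    have "(\<lambda>n. (1 + 1 / \<theta>) * e n) \<longlonglongrightarrow> (1 + 1 / \<theta>) * 0" by (intro tendsto_intros e)
    then have "\<forall>\<^sub>F n in sequentially. (1 + 1 / \<theta>) * e n < r / 2" using r by (intro order_tendstoD(2)) auto
    then obtain N0 where "\<And>n. n \<ge> N0 \<Longrightarrow> (1 + 1 / \<theta>) * e n < r / 2" by (auto simp: eventually_sequentially)
    then show "\<exists>no. \<forall>n\<ge>no. norm ((LINT x|K. (g n x)\<^sup>2) - ?F) < r"
      using bound[OF \<theta>] \<theta>F by (intro exI[of _ N0]) (smt (verit) real_norm_def field_sum_of_halves)
  qed
qed

lemma L2_product_integrable:
  fixes f g :: "'c \<Rightarrow> real"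
  assumes [measurable]: "f \<in> borel_measurable K" "g \<in> borel_measurable K"
    and "integrable K (\<lambda>x. (f x)\<^sup>2)" "integrable K (\<lambda>x. (g x)\<^sup>2)"
  shows "integrable K (\<lambda>x. f x * g x)"
proof (rule Bochner_Integration.integrable_bound)
  show "integrable K (\<lambda>x. (f x)\<^sup>2 + (g x)\<^sup>2)" using assms by simp
  have "\<bar>x * y\<bar> \<le> x\<^sup>2 + y\<^sup>2" for x y :: real
    using sum_squares_bound[of "\<bar>x\<bar>" "\<bar>y\<bar>"] zero_le_power2[of x] zero_le_power2[of y]
    unfolding abs_mult power2_abs by linarith
  then show "AE x in K. norm (f x * g x) \<le> norm ((f x)\<^sup>2 + (g x)\<^sup>2)" by simp
qed simp

section \<open>Isometry of the Wiener integral\<close>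

locale gaussian_measure =
  fixes N :: "'b measure" and K :: "'c measure" and B :: "'c set \<Rightarrow> 'b \<Rightarrow> real"
  assumes grm: "gaussian_random_measure N K B"
begin

sublocale prob_space N using grm by (simp add: gaussian_random_measure_def)

abbreviation "fin \<equiv> finite_measure_sets K"

lemma fin_Diff: "A \<in> fin \<Longrightarrow> A' \<in> fin \<Longrightarrow> A - A' \<in> fin"
  and fin_Int: "A \<in> fin \<Longrightarrow> A' \<in> fin \<Longrightarrow> A \<inter> A' \<in> fin"
  and fin_Un: "A \<in> fin \<Longrightarrow> A' \<in> fin \<Longrightarrow> A \<union> A' \<in> fin"
  and fin_empty: "{} \<in> fin"
  by (auto simp: finite_measure_sets_def intro: le_less_trans[OF emeasure_mono, of _ A K] le_less_trans[OF emeasure_subadditive])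

lemma fin_integrable: "A \<in> fin \<Longrightarrow> integrable K (indicator A :: 'c \<Rightarrow> real)"
  by (auto simp: finite_measure_sets_def)

lemma B_meas: "A \<in> fin \<Longrightarrow> B A \<in> borel_measurable N"
  and B_distr: "A \<in> fin \<Longrightarrow> distr N borel (B A) = centered_normal (measure K A)"
  using grm by (auto simp: gaussian_random_measure_def)

lemma B_sq: "A \<in> fin \<Longrightarrow> integrable N (\<lambda>\<omega>. (B A \<omega>)\<^sup>2)" "A \<in> fin \<Longrightarrow> msq (B A) = measure K A"
  using distr_centered_normal_moments[OF prob_space_axioms B_meas _ B_distr] by auto

lemma B_empty: "AE \<omega> in N. B {} \<omega> = 0"
proof -
  have "AE \<omega> in N. (B {} \<omega>)\<^sup>2 = 0"
    using B_sq[OF fin_empty] by (subst integral_nonneg_eq_0_iff_AE[symmetric]) auto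
  then show ?thesis by simp
qed

text \<open>Countable additivity is applied to the sequence \<open>A\<close>, \<open>A'\<close>,
  \<open>{}\<close>, \<open>{}\<close>, and so on; the padding terms vanish outside one null set
  because \<open>B {}\<close> has variance 0.\<close>

lemma B_additive:
  assumes A: "A \<in> fin" "A' \<in> fin" "A \<inter> A' = {}"
  shows "AE \<omega> in N. B (A \<union> A') \<omega> = B A \<omega> + B A' \<omega>"
proof -
  have r: "range (binaryset A A') \<subseteq> fin" using A fin_empty by (auto simp: binaryset_def)
  have d: "disjoint_family (binaryset A A')"
    using A(3) by (auto simp: disjoint_family_on_def binaryset_def)
  have u: "(\<Union>n. binaryset A A' n) = A \<union> A'" by (rule UN_binaryset_eq)
  from grm have "AE \<omega> in N. (\<lambda>n. B (binaryset A A' n) \<omega>) sums B (\<Union>n. binaryset A A' n) \<omega>"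
    using r d fin_Un[OF A(1,2)] unfolding u[symmetric] by (auto simp: gaussian_random_measure_def)
  then show ?thesis using B_empty unfolding u
  proof eventually_elim
    case (elim \<omega>)
    have "(\<lambda>n. B (binaryset A A' n) \<omega>) sums (\<Sum>n\<in>{0, 1}. B (binaryset A A' n) \<omega>)"
      using elim(2) by (intro sums_finite) (auto simp: binaryset_def)
    with elim(1) show ?case by (simp add: sums_unique2 binaryset_def)
  qed
qed

lemma B_product_integrable: "A \<in> fin \<Longrightarrow> A' \<in> fin \<Longrightarrow> integrable N (\<lambda>\<omega>. B A \<omega> * B A' \<omega>)"
  by (intro L2_product_integrable B_meas B_sq)

text \<open>Both \<open>K\<close> and \<open>B\<close> are additive, so the two expressions for the
  variance of \<open>B (A \<union> A')\<close> agree only if the cross term vanishes.\<close>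

lemma B_orthogonal:
  assumes A: "A \<in> fin" "A' \<in> fin" "A \<inter> A' = {}"
  shows "cross (B A) (B A') = 0"
proof -
  have "measure K (A \<union> A') = msq (B (A \<union> A'))"
    using B_sq[OF fin_Un[OF A(1,2)]] by simp
  also have "\<dots> = expectation (\<lambda>\<omega>. (B A \<omega>)\<^sup>2 + (B A' \<omega>)\<^sup>2 + 2 * (B A \<omega> * B A' \<omega>))"
    using B_additive[OF A] A B_meas fin_Un
    by (intro integral_cong_AE) (auto simp: power2_sum)
  also have "\<dots> = measure K A + measure K A' + 2 * cross (B A) (B A')"
    using A B_sq B_product_integrable by simp
  also have "measure K (A \<union> A') = measure K A + measure K A'"
    using A by (intro measure_Union) (auto simp: finite_measure_sets_def)
  finally show ?thesis by simp
qed

text \<open>The common part contributes its variance; the other three products pair disjoint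
  sets.\<close>

lemma B_covariance:
  assumes A: "A \<in> fin" "A' \<in> fin"
  shows "cross (B A) (B A') = measure K (A \<inter> A')"
proof -
  let ?I = "A \<inter> A'"
  have fin: "?I \<in> fin" "A - A' \<in> fin" "A' - A \<in> fin" using A fin_Int fin_Diff by auto
  have eqs: "?I \<union> (A - A') = A" "?I \<union> (A' - A) = A'" by auto
  have ae: "AE \<omega> in N. B A \<omega> = B ?I \<omega> + B (A - A') \<omega>" "AE \<omega> in N. B A' \<omega> = B ?I \<omega> + B (A' - A) \<omega>"
    using B_additive[of ?I "A - A'"] B_additive[of ?I "A' - A"] fin unfolding eqs by auto
  have "cross (B A) (B A')
      = expectation (\<lambda>\<omega>. (B ?I \<omega>)\<^sup>2 + B ?I \<omega> * B (A' - A) \<omega> + B (A - A') \<omega> * B ?I \<omega> + B (A - A') \<omega> * B (A' - A) \<omega>)"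
  proof (rule integral_cong_AE)
    show "AE \<omega> in N. B A \<omega> * B A' \<omega> = (B ?I \<omega>)\<^sup>2 + B ?I \<omega> * B (A' - A) \<omega> + B (A - A') \<omega> * B ?I \<omega> + B (A - A') \<omega> * B (A' - A) \<omega>"
      using ae by eventually_elim (simp add: power2_eq_square algebra_simps)
  qed (use A fin B_meas in auto)
  also have "\<dots> = measure K ?I"
  proof -
    have disj: "?I \<inter> (A' - A) = {}" "(A - A') \<inter> ?I = {}" "(A - A') \<inter> (A' - A) = {}" by auto
    show ?thesis
      using fin B_sq B_product_integrable B_orthogonal[OF _ _ disj(1)] B_orthogonal[OF _ _ disj(2)] B_orthogonal[OF _ _ disj(3)]
      by simp
  qed
  finally show ?thesis .
qed

text \<open>Both sides are bilinear, so one induction over each list reduces the claim to a pair of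
  indicators. The sets of a list may overlap, which is why the covariance of arbitrary pairs is
  needed.\<close>

lemma simple_isometry:
  assumes S: "snd ` set S \<subseteq> fin" and S': "snd ` set S' \<subseteq> fin"
  shows "integrable K (\<lambda>u. simple_fun S u * simple_fun S' u)"
    "integrable N (\<lambda>\<omega>. simple_integral B S \<omega> * simple_integral B S' \<omega>)"
    "cross (simple_integral B S) (simple_integral B S') = (LINT u|K. simple_fun S u * simple_fun S' u)"
proof -
  have cons: "simple_fun ((a, A) # S) u = a * indicator A u + simple_fun S u"
    "simple_integral B ((a, A) # S) \<omega> = a * B A \<omega> + simple_integral B S \<omega>" for a A S u \<omega>
    by (simp_all add: simple_fun_def simple_integral_def)
  have single: "integrable K (\<lambda>u. indicator A u * simple_fun S' u) \<and>
     integrable N (\<lambda>\<omega>. B A \<omega> * simple_integral B S' \<omega>) \<and>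
    cross (B A) (simple_integral B S') = (LINT u|K. indicator A u * simple_fun S' u)"
    if A: "A \<in> fin" for A
    using S'
  proof (induction S')
    case Nil
    show ?case by (simp add: simple_fun_def simple_integral_def)
  next
    case (Cons p S')
    obtain c C where p: "p = (c, C)" by (cases p)
    have C: "C \<in> fin" and IH: "integrable K (\<lambda>u. indicator A u * simple_fun S' u)"
     "integrable N (\<lambda>\<omega>. B A \<omega> * simple_integral B S' \<omega>)"
     "cross (B A) (simple_integral B S') = (LINT u|K. indicator A u * simple_fun S' u)"
      using Cons p by auto
    have 1: "indicator A u * simple_fun (p # S') u = c * indicator (A \<inter> C) u + indicator A u * simple_fun S' u" for u
      by (simp add: p cons algebra_simps indicator_inter_arith)
    have 2: "B A \<omega> * simple_integral B (p # S') \<omega> = c * (B A \<omega> * B C \<omega>) + B A \<omega> * simple_integral B S' \<omega>" for \<omega>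
      by (simp add: p cons algebra_simps)
    have "A \<inter> C \<in> sets K" using fin_Int[OF A C] by (simp add: finite_measure_sets_def)
    then show ?case unfolding 1 2 using fin_integrable[OF fin_Int[OF A C]] B_product_integrable[OF A C] IH B_covariance[OF A C]
      by simp
  qed
  have "integrable K (\<lambda>u. simple_fun S u * simple_fun S' u) \<and>
    integrable N (\<lambda>\<omega>. simple_integral B S \<omega> * simple_integral B S' \<omega>) \<and>
    cross (simple_integral B S) (simple_integral B S') = (LINT u|K. simple_fun S u * simple_fun S' u)"
    using S
  proof (induction S)
    case Nil
    show ?case by (simp add: simple_fun_def simple_integral_def)
  next
    case (Cons p S)
    obtain c C where p: "p = (c, C)" by (cases p)
    have C: "C \<in> fin" using Cons p by auto
    have 1: "simple_fun (p # S) u * simple_fun S' u = c * (indicator C u * simple_fun S' u) + simple_fun S u * simple_fun S' u" for u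
      by (simp add: p cons algebra_simps)
    have 2: "simple_integral B (p # S) \<omega> * simple_integral B S' \<omega> = c * (B C \<omega> * simple_integral B S' \<omega>) + simple_integral B S \<omega> * simple_integral B S' \<omega>" for \<omega>
      by (simp add: p cons algebra_simps)
    show ?case unfolding 1 2 using single[OF C] Cons by simp
  qed
  then show "integrable K (\<lambda>u. simple_fun S u * simple_fun S' u)"
    "integrable N (\<lambda>\<omega>. simple_integral B S \<omega> * simple_integral B S' \<omega>)"
    "cross (simple_integral B S) (simple_integral B S') = (LINT u|K. simple_fun S u * simple_fun S' u)"
    by auto
qed

lemma simple_measurable:
  assumes "snd ` set S \<subseteq> fin"
  shows "simple_fun S \<in> borel_measurable K" "simple_integral B S \<in> borel_measurable N"
proof -
  have "simple_fun S \<in> borel_measurable K \<and> simple_integral B S \<in> borel_measurable N"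
    using assms
  proof (induction S)
    case (Cons p S)
    obtain c C where p: "p = (c, C)" by (cases p)
    have [measurable]: "C \<in> sets K" "B C \<in> borel_measurable N" using Cons p B_meas by (auto simp: finite_measure_sets_def)
    have "simple_fun (p # S) = (\<lambda>u. c * indicator C u + simple_fun S u)"
      "simple_integral B (p # S) = (\<lambda>\<omega>. c * B C \<omega> + simple_integral B S \<omega>)"
      by (auto simp: p simple_fun_def simple_integral_def fun_eq_iff)
    moreover have [measurable]: "simple_fun S \<in> borel_measurable K" "simple_integral B S \<in> borel_measurable N" using Cons by auto
    ultimately show ?case by simp
  qed (simp add: simple_fun_def[abs_def] simple_integral_def[abs_def])
  then show "simple_fun S \<in> borel_measurable K" "simple_integral B S \<in> borel_measurable N" by auto
qed

text \<open>Along one approximating sequence the squared norms on both sides agree term by term, and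
  each converges to the squared norm of its limit.\<close>

lemma wiener_isometry:
  assumes "has_wiener_integral N K B f Z"
  shows "integrable K (\<lambda>u. (f u)\<^sup>2)" "integrable N (\<lambda>\<omega>. (Z \<omega>)\<^sup>2)" "msq Z = (LINT u|K. (f u)\<^sup>2)"
proof -
  from assms obtain S where fZ: "f \<in> borel_measurable K" "Z \<in> borel_measurable N"
    and S: "\<And>n. snd ` set (S n) \<subseteq> fin"
    and lim: "(\<lambda>n. \<integral>\<^sup>+u. ennreal ((f u - simple_fun (S n) u)\<^sup>2) \<partial>K) \<longlonglongrightarrow> 0"
      "(\<lambda>n. \<integral>\<^sup>+\<omega>. ennreal ((Z \<omega> - simple_integral B (S n) \<omega>)\<^sup>2) \<partial>N) \<longlonglongrightarrow> 0"
    by (auto simp: has_wiener_integral_def)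
  note iso = simple_isometry[of "S n" "S n" for n, OF S S, folded power2_eq_square]
  note L = L2_limit[where g = "\<lambda>n. simple_fun (S n)", OF fZ(1) simple_measurable(1)[OF S] iso(1) lim(1)]
    L2_limit[where g = "\<lambda>n. simple_integral B (S n)", OF fZ(2) simple_measurable(2)[OF S] iso(2) lim(2)]
  show "integrable K (\<lambda>u. (f u)\<^sup>2)" "integrable N (\<lambda>\<omega>. (Z \<omega>)\<^sup>2)" by (rule L)+
  show "msq Z = (LINT u|K. (f u)\<^sup>2)"
    using L(2,4) unfolding iso(3) by (rule LIMSEQ_unique[rotated])
qed

lemma has_wiener_integral_add:
  assumes f: "has_wiener_integral N K B f Z" and g: "has_wiener_integral N K B g W"
  shows "has_wiener_integral N K B (\<lambda>u. f u + g u) (\<lambda>\<omega>. Z \<omega> + W \<omega>)"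
proof -
  from f obtain S where fZ[measurable]: "f \<in> borel_measurable K" "Z \<in> borel_measurable N"
    and S: "\<And>n. snd ` set (S n) \<subseteq> fin"
    and lim: "(\<lambda>n. \<integral>\<^sup>+u. ennreal ((f u - simple_fun (S n) u)\<^sup>2) \<partial>K) \<longlonglongrightarrow> 0"
      "(\<lambda>n. \<integral>\<^sup>+\<omega>. ennreal ((Z \<omega> - simple_integral B (S n) \<omega>)\<^sup>2) \<partial>N) \<longlonglongrightarrow> 0"
    by (auto simp: has_wiener_integral_def)
  from g obtain S' where gW[measurable]: "g \<in> borel_measurable K" "W \<in> borel_measurable N"
    and S': "\<And>n. snd ` set (S' n) \<subseteq> fin"
    and lim': "(\<lambda>n. \<integral>\<^sup>+u. ennreal ((g u - simple_fun (S' n) u)\<^sup>2) \<partial>K) \<longlonglongrightarrow> 0"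
      "(\<lambda>n. \<integral>\<^sup>+\<omega>. ennreal ((W \<omega> - simple_integral B (S' n) \<omega>)\<^sup>2) \<partial>N) \<longlonglongrightarrow> 0"
    by (auto simp: has_wiener_integral_def)
  \<comment> \<open>Stated for a general measure because it is applied on \<open>K\<close> to
    functions and on \<open>N\<close> to random variables.\<close>
  have L2_sum: "(\<lambda>n. \<integral>\<^sup>+u. ennreal ((p u + q u - (p' n u + q' n u))\<^sup>2) \<partial>Q) \<longlonglongrightarrow> 0"
    if [measurable]: "p \<in> borel_measurable Q" "q \<in> borel_measurable Q" "\<And>n. p' n \<in> borel_measurable Q" "\<And>n. q' n \<in> borel_measurable Q"
    and l: "(\<lambda>n. \<integral>\<^sup>+u. ennreal ((p u - p' n u)\<^sup>2) \<partial>Q) \<longlonglongrightarrow> 0" "(\<lambda>n. \<integral>\<^sup>+u. ennreal ((q u - q' n u)\<^sup>2) \<partial>Q) \<longlonglongrightarrow> 0"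
    for Q :: "'d measure" and p q :: "'d \<Rightarrow> real" and p' q' :: "nat \<Rightarrow> 'd \<Rightarrow> real"
  proof (rule tendsto_sandwich[OF _ _ tendsto_const])
    let ?U = "\<lambda>n. 2 * (\<integral>\<^sup>+u. ennreal ((p u - p' n u)\<^sup>2) \<partial>Q) + 2 * (\<integral>\<^sup>+u. ennreal ((q u - q' n u)\<^sup>2) \<partial>Q)"
    have "?U \<longlonglongrightarrow> 2 * 0 + 2 * 0"
      by (intro tendsto_add ennreal_tendsto_cmult l) auto
    then show "?U \<longlonglongrightarrow> 0" by simp
    have "(\<integral>\<^sup>+u. ennreal ((p u + q u - (p' n u + q' n u))\<^sup>2) \<partial>Q) \<le> ?U n" for n
    proof -
      have "(x + y)\<^sup>2 \<le> 2 * x\<^sup>2 + 2 * y\<^sup>2" for x y :: real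
        using sum_squares_bound[of x y] by (simp add: power2_sum)
      then have "(p u + q u - (p' n u + q' n u))\<^sup>2 \<le> 2 * (p u - p' n u)\<^sup>2 + 2 * (q u - q' n u)\<^sup>2" for u
        by (metis add_diff_add)
      then have "ennreal ((p u + q u - (p' n u + q' n u))\<^sup>2) \<le> 2 * ennreal ((p u - p' n u)\<^sup>2) + 2 * ennreal ((q u - q' n u)\<^sup>2)" for u
        using ennreal_leI by (fastforce simp: ennreal_plus[symmetric] ennreal_mult''[symmetric] ennreal_numeral[symmetric] simp del: ennreal_plus ennreal_numeral)
      then have "(\<integral>\<^sup>+u. ennreal ((p u + q u - (p' n u + q' n u))\<^sup>2) \<partial>Q)
        \<le> (\<integral>\<^sup>+u. 2 * ennreal ((p u - p' n u)\<^sup>2) + 2 * ennreal ((q u - q' n u)\<^sup>2) \<partial>Q)"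
        by (intro nn_integral_mono) auto
      also have "\<dots> = ?U n" by (simp add: nn_integral_add nn_integral_cmult)
      finally show ?thesis .
    qed
    then show "\<forall>\<^sub>F n in sequentially. (\<integral>\<^sup>+u. ennreal ((p u + q u - (p' n u + q' n u))\<^sup>2) \<partial>Q) \<le> ?U n" by simp
  qed simp
  have app: "simple_fun (S n @ S' n) u = simple_fun (S n) u + simple_fun (S' n) u"
    "simple_integral B (S n @ S' n) \<omega> = simple_integral B (S n) \<omega> + simple_integral B (S' n) \<omega>" for n u \<omega>
    by (auto simp: simple_fun_def simple_integral_def)
  show ?thesis
    unfolding has_wiener_integral_def
  proof (intro conjI exI[of _ "\<lambda>n. S n @ S' n"] allI)
    show "snd ` set (S n @ S' n) \<subseteq> fin" for n using S[of n] S'[of n] by auto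
    show "(\<lambda>n. \<integral>\<^sup>+u. ennreal ((f u + g u - simple_fun (S n @ S' n) u)\<^sup>2) \<partial>K) \<longlonglongrightarrow> 0"
      unfolding app by (intro L2_sum lim lim' simple_measurable S S' fZ gW)
    show "(\<lambda>n. \<integral>\<^sup>+\<omega>. ennreal ((Z \<omega> + W \<omega> - simple_integral B (S n @ S' n) \<omega>)\<^sup>2) \<partial>N) \<longlonglongrightarrow> 0"
      unfolding app by (intro L2_sum lim lim' simple_measurable S S' fZ gW)
  qed measurable
qed

text \<open>Polarisation of the isometry, applied to \<open>f\<close>, \<open>g\<close> and
  \<open>f + g\<close>.\<close>

lemma wiener_covariance:
  assumes f: "has_wiener_integral N K B f Z" and g: "has_wiener_integral N K B g W"
  shows "integrable K (\<lambda>u. f u * g u)" "cross Z W = (LINT u|K. f u * g u)"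
proof -
  have [measurable]: "f \<in> borel_measurable K" "Z \<in> borel_measurable N" "g \<in> borel_measurable K" "W \<in> borel_measurable N"
    using f g by (auto simp: has_wiener_integral_def)
  note f' = wiener_isometry[OF f] and g' = wiener_isometry[OF g]
    and fg = wiener_isometry[OF has_wiener_integral_add[OF f g]]
  show i: "integrable K (\<lambda>u. f u * g u)" using f' g' by (intro L2_product_integrable) auto
  have i': "integrable N (\<lambda>\<omega>. Z \<omega> * W \<omega>)" using f' g' by (intro L2_product_integrable) auto
  have pol: "(LINT u|Q. p u * q u) = ((LINT u|Q. (p u + q u)\<^sup>2) - (LINT u|Q. (p u)\<^sup>2) - (LINT u|Q. (q u)\<^sup>2)) / 2"
    if "integrable Q (\<lambda>u. p u * q u)" "integrable Q (\<lambda>u. (p u)\<^sup>2)" "integrable Q (\<lambda>u. (q u)\<^sup>2)"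
    for Q :: "'d measure" and p q :: "'d \<Rightarrow> real"
  proof -
    have "(LINT u|Q. (p u + q u)\<^sup>2) = (LINT u|Q. (p u)\<^sup>2 + (q u)\<^sup>2 + 2 * (p u * q u))"
      by (simp add: power2_sum mult.assoc)
    then show ?thesis using that by simp
  qed
  show "cross Z W = (LINT u|K. f u * g u)"
    using pol[OF i' f'(2) g'(2)] pol[OF i f'(1) g'(1)] f' g' fg by simp
qed

end

text \<open>A covariance is a functional of the two-dimensional law, so it transfers from the
  integrals on \<open>N\<close> to the process on \<open>M\<close>.\<close>

lemma gfbm_covariance:
  assumes grm: "gaussian_random_measure N lborel B" and X: "generalized_fbm N B \<alpha> \<gamma> M X"
    and st: "0 \<le> s" "0 \<le> t"
  shows "integrable lborel (\<lambda>u. gfbm_kernel \<alpha> \<gamma> s u * gfbm_kernel \<alpha> \<gamma> t u)"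
    "(LINT \<omega>|M. X s \<omega> * X t \<omega>) = (gfbm_const \<alpha> \<gamma>)\<^sup>2 * (LINT u|lborel. gfbm_kernel \<alpha> \<gamma> s u * gfbm_kernel \<alpha> \<gamma> t u)"
proof -
  interpret gaussian_measure N lborel B by unfold_locales (rule grm)
  let ?c = "gfbm_const \<alpha> \<gamma>"
  from X obtain I where I: "\<And>t. 0 \<le> t \<Longrightarrow> has_wiener_integral N lborel B (gfbm_kernel \<alpha> \<gamma> t) (I t)"
    and fdd: "same_finite_dim_distributions {0..} M X N (\<lambda>t \<omega>. ?c * I t \<omega>)"
    and Xm: "\<And>t. 0 \<le> t \<Longrightarrow> X t \<in> borel_measurable M"
    by (auto simp: generalized_fbm_def centered_gaussian_process_def)
  have Im: "0 \<le> t \<Longrightarrow> I t \<in> borel_measurable N" for t using I by (auto simp: has_wiener_integral_def)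
  note cov = wiener_covariance[OF I[OF st(1)] I[OF st(2)]]
  show "integrable lborel (\<lambda>u. gfbm_kernel \<alpha> \<gamma> s u * gfbm_kernel \<alpha> \<gamma> t u)" by (rule cov)
  \<comment> \<open>For \<open>s = t\<close> this is a singleton and both factors read the same
    coordinate, so variances are included.\<close>
  let ?J = "{s, t}"
  let ?P = "Pi\<^sub>M ?J (\<lambda>_. borel :: real measure)"
  have J: "finite ?J" "?J \<subseteq> {0..}" using st by auto
  have eq: "distr M ?P (\<lambda>\<omega>. \<lambda>t\<in>?J. X t \<omega>) = distr N ?P (\<lambda>\<omega>. \<lambda>t\<in>?J. ?c * I t \<omega>)"
    using fdd J unfolding same_finite_dim_distributions_def by blast
  have m1: "(\<lambda>\<omega>. \<lambda>t\<in>?J. X t \<omega>) \<in> measurable M ?P" using st Xm by (intro measurable_restrict) auto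
  have m2: "(\<lambda>\<omega>. \<lambda>t\<in>?J. ?c * I t \<omega>) \<in> measurable N ?P" using st Im by (intro measurable_restrict borel_measurable_times) auto
  have m3: "(\<lambda>y. y s * y t) \<in> borel_measurable ?P" by (intro borel_measurable_times measurable_component_singleton) auto
  have "(LINT \<omega>|M. X s \<omega> * X t \<omega>) = (LINT y|distr M ?P (\<lambda>\<omega>. \<lambda>t\<in>?J. X t \<omega>). y s * y t)"
    by (subst integral_distr[OF m1 m3]) simp
  also have "\<dots> = (LINT \<omega>|N. ?c\<^sup>2 * (I s \<omega> * I t \<omega>))"
    unfolding eq by (subst integral_distr[OF m2 m3]) (simp add: power2_eq_square ac_simps)
  also have "\<dots> = ?c\<^sup>2 * (LINT u|lborel. gfbm_kernel \<alpha> \<gamma> s u * gfbm_kernel \<alpha> \<gamma> t u)"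
    using cov by simp
  finally show "(LINT \<omega>|M. X s \<omega> * X t \<omega>) = ?c\<^sup>2 * (LINT u|lborel. gfbm_kernel \<alpha> \<gamma> s u * gfbm_kernel \<alpha> \<gamma> t u)" .
qed

section \<open>The kernel\<close>

text \<open>Split \<open>(x + a) * (x + a) powr (p - 1)\<close> along the first factor: since
  \<open>p - 1 \<le> 0\<close>, enlarging the base of the second factor from either summand to
  \<open>x + a\<close> only decreases it.\<close>

lemma powr_add_le_add_powr:
  fixes x a p :: real
  assumes "0 \<le> x" "0 \<le> a" "0 < p" "p \<le> 1"
  shows "(x + a) powr p \<le> x powr p + a powr p"
proof (cases "x + a = 0")
  case False
  have *: "y * (x + a) powr (p - 1) \<le> y powr p" if y: "0 \<le> y" "y \<le> x + a" for y
  proof (cases "y = 0")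
    case False
    then have "(x + a) powr (p - 1) \<le> y powr (p - 1)" using y assms by (intro powr_mono2') auto
    then have "y * (x + a) powr (p - 1) \<le> y * y powr (p - 1)" using y by (intro mult_left_mono)
    also have "\<dots> = y powr p" using y False by (simp add: powr_mult_base)
    finally show ?thesis .
  qed simp
  have "(x + a) powr p = (x + a) * (x + a) powr (p - 1)" using False assms by (simp add: powr_mult_base)
  also have "\<dots> = x * (x + a) powr (p - 1) + a * (x + a) powr (p - 1)" by (simp add: algebra_simps)
  also have "\<dots> \<le> x powr p + a powr p" using assms by (intro add_mono *) auto
  finally show ?thesis .
qed (use assms in auto)

text \<open>After factoring out \<open>x powr p\<close> the base \<open>1 + a / x\<close> is at
  least 1, so its exponent may be raised from \<open>p\<close> to 1.\<close>

lemma powr_add_diff_le: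
  fixes x a p :: real
  assumes "0 < x" "0 \<le> a" "0 < p" "p \<le> 1"
  shows "(x + a) powr p - x powr p \<le> a * x powr (p - 1)"
proof -
  have "(x + a) powr p = x powr p * (1 + a / x) powr p"
  proof -
    have "x + a = x * (1 + a / x)" using assms by (simp add: field_simps)
    then show ?thesis using assms by (simp only: powr_mult)
  qed
  also have "\<dots> \<le> x powr p * (1 + a / x) powr 1" using assms by (intro mult_left_mono powr_mono) auto
  also have "\<dots> = x powr p + a * (x powr p / x)" using assms by (simp add: field_simps)
  also have "x powr p / x = x powr (p - 1)" using assms by (simp add: powr_diff)
  finally show ?thesis by simp
qed

text \<open>Shape of the majorants for kernels with times in \<open>[0, 1]\<close>: a singularity at
  the origin, a decaying tail at minus infinity, and 0 to the right of 1, where such kernels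
  vanish.\<close>

definition two_powers :: "real \<Rightarrow> real \<Rightarrow> real \<Rightarrow> real" where
  "two_powers p q u = indicator {-1..1} u * \<bar>u\<bar> powr (- p) + indicator {..<-1} u * \<bar>u\<bar> powr (- q)"

lemma two_powers_nonneg: "0 \<le> two_powers p q u"
  by (simp add: two_powers_def)

lemma two_powers_integrable:
  assumes "p < 1" "1 < q"
  shows "integrable lborel (two_powers p q)"
proof -
  define g where "g u = indicator {0..1} u * u powr (- p)" for u :: real
  define h where "h u = indicator {1..} u * u powr (- q)" for u :: real
  have lebesgue: "integrable lborel (\<lambda>u. indicator S u * u powr r)"
    if "(\<lambda>u. u powr r) integrable_on S" "S \<in> sets borel" for S :: "real set" and r :: real
  proof -
    have "(\<lambda>u. u powr r) absolutely_integrable_on S"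
      using that(1) by (intro nonnegative_absolutely_integrable_1) auto
    then have "integrable lebesgue (\<lambda>u. indicator S u * u powr r)" by (simp add: set_integrable_def)
    moreover have "(\<lambda>u. indicator S u * u powr r) \<in> borel_measurable lborel" using that(2) by measurable
    ultimately show ?thesis by (simp add: integrable_completion)
  qed
  have "integrable lborel g" unfolding g_def
    using assms by (intro lebesgue integrable_on_powr_from_0) auto
  moreover have "integrable lborel h" unfolding h_def
    using assms by (intro lebesgue has_integral_integrable[OF has_integral_powr_to_inf]) auto
  moreover have "integrable lborel (\<lambda>u. f (- u))" if "integrable lborel f" for f :: "real \<Rightarrow> real"
    using lborel_integrable_real_affine[OF that, of "-1" 0] by simp
  ultimately have "integrable lborel (\<lambda>u. g u + g (- u) + h (- u))"
    by (intro Bochner_Integration.integrable_add) auto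
  then show ?thesis
  proof (rule integrable_cong_AE_imp)
    \<comment> \<open>At -1 both reflected pieces contribute, so the decomposition fails at this
      single point.\<close>
    have "AE u in lborel. u \<noteq> (-1::real)" by (rule AE_lborel_singleton)
    then show "AE u in lborel. g u + g (- u) + h (- u) = two_powers p q u"
    proof eventually_elim
      case (elim u)
      consider "u < -1" | "-1 < u" "u < 0" | "u = 0" | "0 < u" "u \<le> 1" | "1 < u" using elim by linarith
      then show ?case by cases (auto simp: g_def h_def two_powers_def)
    qed
  qed (simp add: two_powers_def[abs_def])
qed

section \<open>Kernel bounds, scaling, and the moments of the process\<close>

context
  fixes \<alpha> \<gamma> H \<eta> :: real
  assumes \<gamma>: "0 \<le> \<gamma>" "\<gamma> < 1" and \<alpha>: "0 < \<alpha>" "\<alpha> < 1/2 + \<gamma>/2"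
  defines "H \<equiv> \<alpha> - \<gamma>/2 + 1/2" and "\<eta> \<equiv> min ((1 - \<gamma>) / 4) (1/2 + \<gamma>/2 - \<alpha>)"
begin

lemma \<alpha>_le: "\<alpha> \<le> 1" using \<gamma> \<alpha> by linarith

text \<open>Two competing upper bounds: the Holder bound, from subadditivity of the power, serves
  near the origin; the bound linear in the increment serves for negative \<open>u\<close>, where its
  factor \<open>\<bar>u\<bar> powr (\<alpha> - 1)\<close> supplies decay.\<close>

lemma pos_powr_diff:
  assumes "0 \<le> s" "s \<le> t"
  shows "0 \<le> pos_powr (t - u) \<alpha> - pos_powr (s - u) \<alpha>"
    "pos_powr (t - u) \<alpha> - pos_powr (s - u) \<alpha> \<le> (t - s) powr \<alpha>"
    "u < 0 \<Longrightarrow> pos_powr (t - u) \<alpha> - pos_powr (s - u) \<alpha> \<le> (t - s) * \<bar>u\<bar> powr (\<alpha> - 1)"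
proof -
  show "0 \<le> pos_powr (t - u) \<alpha> - pos_powr (s - u) \<alpha>"
    using assms \<alpha> by (auto simp: pos_powr_def intro: powr_mono2)
  show "pos_powr (t - u) \<alpha> - pos_powr (s - u) \<alpha> \<le> (t - s) powr \<alpha>"
  proof (cases "s - u > 0")
    case True
    then show ?thesis using powr_add_le_add_powr[of "s - u" "t - s" \<alpha>] assms \<alpha> \<alpha>_le by (simp add: pos_powr_def)
  next
    case False
    then show ?thesis using assms \<alpha> by (auto simp: pos_powr_def intro: powr_mono2)
  qed
  assume u: "u < 0"
  have "pos_powr (t - u) \<alpha> - pos_powr (s - u) \<alpha> \<le> (t - s) * (s - u) powr (\<alpha> - 1)"
    using powr_add_diff_le[of "s - u" "t - s" \<alpha>] u assms \<alpha> \<alpha>_le by (simp add: pos_powr_def)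
  also have "\<dots> \<le> (t - s) * \<bar>u\<bar> powr (\<alpha> - 1)"
    using u assms \<alpha>_le by (intro mult_left_mono powr_mono2') auto
  finally show "pos_powr (t - u) \<alpha> - pos_powr (s - u) \<alpha> \<le> (t - s) * \<bar>u\<bar> powr (\<alpha> - 1)" .
qed

lemma kernel_diff: "gfbm_kernel \<alpha> \<gamma> t u - gfbm_kernel \<alpha> \<gamma> s u
    = (pos_powr (t - u) \<alpha> - pos_powr (s - u) \<alpha>) * \<bar>u\<bar> powr (- \<gamma> / 2)"
  by (simp add: gfbm_kernel_def algebra_simps)

lemma kernel_0: "gfbm_kernel \<alpha> \<gamma> 0 u = 0"
  by (simp add: gfbm_kernel_def)

text \<open>Near the origin the Holder bound leaves the weight
  \<open>\<bar>u\<bar> powr (- \<gamma>)\<close>; below -1 the squared linear bound leaves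
  \<open>\<bar>u\<bar> powr (2 * \<alpha> - 2 - \<gamma>)\<close>, and there
  \<open>(t - s)\<^sup>2 \<le> (t - s) powr (2 * \<alpha>)\<close> because
  \<open>t - s \<le> 1\<close> and \<open>\<alpha> \<le> 1\<close>.\<close>

lemma kernel_increment_bound:
  assumes st: "0 \<le> s" "s \<le> t" "t \<le> 1"
  shows "(gfbm_kernel \<alpha> \<gamma> t u - gfbm_kernel \<alpha> \<gamma> s u)\<^sup>2 \<le> (t - s) powr (2 * \<alpha>) * two_powers \<gamma> (\<gamma> + 2 - 2 * \<alpha>) u"
proof -
  let ?d = "pos_powr (t - u) \<alpha> - pos_powr (s - u) \<alpha>"
  note d = pos_powr_diff[OF st(1,2), of u]
  have sq: "(gfbm_kernel \<alpha> \<gamma> t u - gfbm_kernel \<alpha> \<gamma> s u)\<^sup>2 = ?d\<^sup>2 * \<bar>u\<bar> powr (- \<gamma>)"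
    unfolding kernel_diff power_mult_distrib by (simp add: power2_eq_square[of "_ powr _"] powr_add[symmetric])
  consider "1 < u" | "u < -1" | "-1 \<le> u" "u \<le> 1" by linarith
  then show ?thesis
  proof cases
    case 1
    then have "?d = 0" using st by (simp add: pos_powr_def)
    then show ?thesis unfolding sq by (simp add: two_powers_nonneg)
  next
    case 2
    have "?d\<^sup>2 \<le> ((t - s) * \<bar>u\<bar> powr (\<alpha> - 1))\<^sup>2" using d 2 by (intro power_mono) auto
    also have "\<dots> = (t - s)\<^sup>2 * \<bar>u\<bar> powr (2 * \<alpha> - 2)" 
      using 2 by (simp add: power_mult_distrib power2_eq_square[of "_ powr _"] powr_add[symmetric])
    also have "\<dots> \<le> (t - s) powr (2 * \<alpha>) * \<bar>u\<bar> powr (2 * \<alpha> - 2)"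
    proof (rule mult_right_mono)
      show "(t - s)\<^sup>2 \<le> (t - s) powr (2 * \<alpha>)"
        using st \<alpha>_le powr_mono'[of "2 * \<alpha>" 2 "t - s"] by (cases "t = s") (auto simp: powr_numeral)
    qed simp
    finally have "?d\<^sup>2 * \<bar>u\<bar> powr (- \<gamma>) \<le> (t - s) powr (2 * \<alpha>) * \<bar>u\<bar> powr (2 * \<alpha> - 2) * \<bar>u\<bar> powr (- \<gamma>)"
      by (rule mult_right_mono) simp
    also have "\<dots> = (t - s) powr (2 * \<alpha>) * two_powers \<gamma> (\<gamma> + 2 - 2 * \<alpha>) u"
      using 2 by (simp add: two_powers_def powr_add[symmetric] mult.assoc algebra_simps)
    finally show ?thesis unfolding sq .
  next
    case 3
    have "?d\<^sup>2 \<le> ((t - s) powr \<alpha>)\<^sup>2" using d by (intro power_mono) auto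
    also have "\<dots> = (t - s) powr (2 * \<alpha>)" by (simp add: power2_eq_square powr_add[symmetric])
    finally have "?d\<^sup>2 * \<bar>u\<bar> powr (- \<gamma>) \<le> (t - s) powr (2 * \<alpha>) * \<bar>u\<bar> powr (- \<gamma>)"
      by (rule mult_right_mono) simp
    then show ?thesis unfolding sq using 3 by (simp add: two_powers_def)
  qed
qed

text \<open>The two terms of the minimum have separate purposes. \<open>(1 - \<gamma>) / 4\<close>
  keeps a singularity of order \<open>1/2 + \<gamma>/2 + \<eta>\<close> integrable at the origin;
  the other term is \<open>1 - H\<close>, so that \<open>r \<le> r powr (H + \<eta>)\<close> for
  \<open>r \<le> 1\<close>.\<close>

lemma \<eta>: "0 < \<eta>" "1/2 + \<gamma>/2 + \<eta> < 1" "H + \<eta> \<le> 1" "0 < H" "H < 1"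
  using \<gamma> \<alpha> by (auto simp: \<eta>_def H_def min_def field_simps)

text \<open>The source of decorrelation: \<open>r powr \<eta>\<close> is a gain over the order
  \<open>r powr H\<close> that Cauchy-Schwarz gives. It is paid for by a stronger singularity at the
  origin, by moving surplus powers of \<open>r\<close> onto \<open>\<bar>u\<bar>\<close> in the
  direction that the region allows.\<close>

lemma kernel_product_bound:
  assumes r: "0 < r" "r \<le> 1"
  shows "\<bar>gfbm_kernel \<alpha> \<gamma> r u * gfbm_kernel \<alpha> \<gamma> 1 u\<bar>
    \<le> r powr (H + \<eta>) * two_powers (1/2 + \<gamma>/2 + \<eta>) (\<gamma> + 2 - 2 * \<alpha>) u"
proof -
  let ?d = "\<lambda>t. pos_powr (t - u) \<alpha> - pos_powr (- u) \<alpha>"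
  have d: "0 \<le> ?d t" "?d t \<le> t powr \<alpha>" "u < 0 \<Longrightarrow> ?d t \<le> t * \<bar>u\<bar> powr (\<alpha> - 1)" if "0 \<le> t" for t
    using pos_powr_diff[of 0 t u] that by auto
  have "\<bar>gfbm_kernel \<alpha> \<gamma> r u * gfbm_kernel \<alpha> \<gamma> 1 u\<bar> = ?d r * ?d 1 * (\<bar>u\<bar> powr (- \<gamma> / 2) * \<bar>u\<bar> powr (- \<gamma> / 2))"
    using d(1)[of r] d(1)[of 1] r by (simp add: gfbm_kernel_def abs_mult)
  also have "\<bar>u\<bar> powr (- \<gamma> / 2) * \<bar>u\<bar> powr (- \<gamma> / 2) = \<bar>u\<bar> powr (- \<gamma>)" by (simp add: powr_add[symmetric])
  finally have prod: "\<bar>gfbm_kernel \<alpha> \<gamma> r u * gfbm_kernel \<alpha> \<gamma> 1 u\<bar> = ?d r * ?d 1 * \<bar>u\<bar> powr (- \<gamma>)" .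
  consider "r < u" | "u = 0" | "u \<noteq> 0" "\<bar>u\<bar> \<le> r" | "-1 \<le> u" "u < -r" | "u < -1" using r by linarith
  then show ?thesis
  proof cases
    case 1
    then have "?d r = 0" using r by (simp add: pos_powr_def)
    then show ?thesis unfolding prod by (simp add: two_powers_nonneg)
  next
    case 2
    then show ?thesis by (simp add: gfbm_kernel_def two_powers_nonneg)
  next
    case 3
    have "?d r * ?d 1 \<le> r powr \<alpha> * 1" using d[of r] d[of 1] r by (intro mult_mono) auto
    \<comment> \<open>As \<open>\<alpha> = H - (1/2 - \<gamma>/2)\<close>, the surplus power of
      \<open>r\<close> is negative and may be moved to the smaller
      \<open>\<bar>u\<bar>\<close>.\<close>
    also have "r powr \<alpha> = r powr (H + \<eta>) * r powr (- (1/2 - \<gamma>/2 + \<eta>))"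
      by (simp add: powr_add[symmetric] H_def)
    also have "\<dots> \<le> r powr (H + \<eta>) * \<bar>u\<bar> powr (- (1/2 - \<gamma>/2 + \<eta>))"
      using 3 r \<eta> \<gamma> by (intro mult_left_mono powr_mono2') auto
    finally have "?d r * ?d 1 * \<bar>u\<bar> powr (- \<gamma>) \<le> r powr (H + \<eta>) * (\<bar>u\<bar> powr (- (1/2 - \<gamma>/2 + \<eta>)) * \<bar>u\<bar> powr (- \<gamma>))"
      by (simp add: mult_right_mono mult.assoc[symmetric])
    also have "\<bar>u\<bar> powr (- (1/2 - \<gamma>/2 + \<eta>)) * \<bar>u\<bar> powr (- \<gamma>) = two_powers (1/2 + \<gamma>/2 + \<eta>) (\<gamma> + 2 - 2 * \<alpha>) u"
    proof -
      have "- (1/2 - \<gamma>/2 + \<eta>) + - \<gamma> = - (1/2 + \<gamma>/2 + \<eta>)" by (simp add: field_simps)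
      moreover have "u \<in> {-1..1}" "u \<notin> {..<-1}" using 3 r by auto
      ultimately show ?thesis by (simp only: powr_add[symmetric] two_powers_def indicator_simps) simp
    qed
    finally show ?thesis unfolding prod .
  next
    case 4
    have "?d r * ?d 1 \<le> (r * \<bar>u\<bar> powr (\<alpha> - 1)) * 1" using d[of r] d[of 1] r 4 by (intro mult_mono) auto
    \<comment> \<open>The surplus exponent \<open>1 - H - \<eta>\<close> is nonnegative here, so
      \<open>r\<close> may be replaced by the larger \<open>\<bar>u\<bar>\<close>.\<close>
    also have "r * \<bar>u\<bar> powr (\<alpha> - 1) = r powr (H + \<eta>) * (r powr (1 - H - \<eta>) * \<bar>u\<bar> powr (\<alpha> - 1))"
      using r by (simp add: powr_add[symmetric] mult.assoc[symmetric])
    finally have "?d r * ?d 1 \<le> r powr (H + \<eta>) * (r powr (1 - H - \<eta>) * \<bar>u\<bar> powr (\<alpha> - 1))" by simp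
    also have "\<dots> \<le> r powr (H + \<eta>) * (\<bar>u\<bar> powr (1 - H - \<eta>) * \<bar>u\<bar> powr (\<alpha> - 1))"
      using 4 r \<eta> by (intro mult_left_mono mult_right_mono powr_mono2) auto
    finally have "?d r * ?d 1 \<le> r powr (H + \<eta>) * (\<bar>u\<bar> powr (1 - H - \<eta>) * \<bar>u\<bar> powr (\<alpha> - 1))" .
    then have "?d r * ?d 1 * \<bar>u\<bar> powr (- \<gamma>) \<le> r powr (H + \<eta>) * (\<bar>u\<bar> powr (1 - H - \<eta>) * \<bar>u\<bar> powr (\<alpha> - 1) * \<bar>u\<bar> powr (- \<gamma>))"
      by (simp add: mult_right_mono mult.assoc[symmetric])
    also have "\<bar>u\<bar> powr (1 - H - \<eta>) * \<bar>u\<bar> powr (\<alpha> - 1) * \<bar>u\<bar> powr (- \<gamma>) = two_powers (1/2 + \<gamma>/2 + \<eta>) (\<gamma> + 2 - 2 * \<alpha>) u"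
    proof -
      have "1 - H - \<eta> + (\<alpha> - 1) + - \<gamma> = - (1/2 + \<gamma>/2 + \<eta>)" by (simp add: H_def field_simps)
      moreover have "u \<in> {-1..1}" "u \<notin> {..<-1}" using 4 r by auto
      ultimately show ?thesis by (simp only: powr_add[symmetric] two_powers_def indicator_simps) simp
    qed
    finally show ?thesis unfolding prod .
  next
    case 5
    have "?d r * ?d 1 \<le> (r * \<bar>u\<bar> powr (\<alpha> - 1)) * (1 * \<bar>u\<bar> powr (\<alpha> - 1))"
      using d[of r] d[of 1] r 5 by (intro mult_mono) auto
    also have "\<dots> = r powr 1 * (\<bar>u\<bar> powr (\<alpha> - 1) * \<bar>u\<bar> powr (\<alpha> - 1))" using r by simp
    also have "\<dots> \<le> r powr (H + \<eta>) * (\<bar>u\<bar> powr (\<alpha> - 1) * \<bar>u\<bar> powr (\<alpha> - 1))"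
      using r \<eta> by (intro mult_right_mono powr_mono') auto
    finally have "?d r * ?d 1 * \<bar>u\<bar> powr (- \<gamma>) \<le> r powr (H + \<eta>) * (\<bar>u\<bar> powr (\<alpha> - 1) * \<bar>u\<bar> powr (\<alpha> - 1) * \<bar>u\<bar> powr (- \<gamma>))"
      by (simp add: mult_right_mono mult.assoc[symmetric])
    also have "\<bar>u\<bar> powr (\<alpha> - 1) * \<bar>u\<bar> powr (\<alpha> - 1) * \<bar>u\<bar> powr (- \<gamma>) = two_powers (1/2 + \<gamma>/2 + \<eta>) (\<gamma> + 2 - 2 * \<alpha>) u"
      using 5 r by (simp add: powr_add[symmetric] two_powers_def algebra_simps)
    finally show ?thesis unfolding prod .
  qed
qed

lemma kernel_scaling:
  assumes "0 < l"
  shows "gfbm_kernel \<alpha> \<gamma> (l * t) (l * u) = l powr (\<alpha> - \<gamma>/2) * gfbm_kernel \<alpha> \<gamma> t u"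
proof -
  have p: "pos_powr (l * x) \<alpha> = l powr \<alpha> * pos_powr x \<alpha>" for x
    using assms by (auto simp: pos_powr_def powr_mult zero_less_mult_iff)
  have e: "l * t - l * u = l * (t - u)" "- (l * u) = l * (- u)" by (simp_all add: algebra_simps)
  show ?thesis
  proof -
    have "\<bar>l * u\<bar> powr (- \<gamma> / 2) = l powr (- \<gamma> / 2) * \<bar>u\<bar> powr (- \<gamma> / 2)"
      using assms by (simp add: abs_mult powr_mult)
    moreover have "l powr (\<alpha> - \<gamma>/2) = l powr \<alpha> * l powr (- \<gamma> / 2)" by (simp add: powr_add[symmetric])
    ultimately show ?thesis unfolding gfbm_kernel_def e p by (simp add: algebra_simps)
  qed
qed

text \<open>The change of variable contributes one factor \<open>l\<close>, and each kernel is
  homogeneous of degree \<open>H - 1/2\<close>.\<close>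

lemma kernel_integral_scaling:
  assumes l: "0 < l"
  shows "(LINT u|lborel. gfbm_kernel \<alpha> \<gamma> (l * s) u * gfbm_kernel \<alpha> \<gamma> (l * t) u)
    = l powr (2 * H) * (LINT u|lborel. gfbm_kernel \<alpha> \<gamma> s u * gfbm_kernel \<alpha> \<gamma> t u)"
proof -
  have "(LINT u|lborel. gfbm_kernel \<alpha> \<gamma> (l * s) u * gfbm_kernel \<alpha> \<gamma> (l * t) u)
    = l * (LINT u|lborel. gfbm_kernel \<alpha> \<gamma> (l * s) (l * u) * gfbm_kernel \<alpha> \<gamma> (l * t) (l * u))"
    using l lborel_integral_real_affine[of l "\<lambda>u. gfbm_kernel \<alpha> \<gamma> (l * s) u * gfbm_kernel \<alpha> \<gamma> (l * t) u" 0] by simp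
  also have "\<dots> = l * (LINT u|lborel. (l powr (\<alpha> - \<gamma>/2) * l powr (\<alpha> - \<gamma>/2)) * (gfbm_kernel \<alpha> \<gamma> s u * gfbm_kernel \<alpha> \<gamma> t u))"
    unfolding kernel_scaling[OF l] by (simp add: ac_simps)
  also have "\<dots> = (l * (l powr (\<alpha> - \<gamma>/2) * l powr (\<alpha> - \<gamma>/2))) * (LINT u|lborel. gfbm_kernel \<alpha> \<gamma> s u * gfbm_kernel \<alpha> \<gamma> t u)"
    by simp
  also have "l * (l powr (\<alpha> - \<gamma>/2) * l powr (\<alpha> - \<gamma>/2)) = l powr (2 * H)"
    using l by (simp add: powr_mult_base powr_add[symmetric] H_def algebra_simps)
  finally show ?thesis .
qed

text \<open>Standardised values divide by this variance. The convention
  \<open>1 / sqrt 0 = 0\<close> would make the normalising constant vanish, so the integrals under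
  the root must be shown to be positive; the minorant \<open>f\<close>, supported on the unit
  interval, serves for them and for the squared kernel alike.\<close>

lemma gfbm_variance_pos:
  assumes int: "integrable lborel (\<lambda>u. gfbm_kernel \<alpha> \<gamma> 1 u * gfbm_kernel \<alpha> \<gamma> 1 u)"
  shows "0 < (gfbm_const \<alpha> \<gamma>)\<^sup>2 * (LINT u|lborel. gfbm_kernel \<alpha> \<gamma> 1 u * gfbm_kernel \<alpha> \<gamma> 1 u)"
proof -
  define f where "f v = indicator {0..1} v * ((1 - v) powr (2 * \<alpha>) * v powr (- \<gamma>))" for v :: real
  have f_le: "f v \<le> gfbm_kernel \<alpha> \<gamma> 1 v * gfbm_kernel \<alpha> \<gamma> 1 v" for v
  proof (cases "0 < v \<and> v < 1")
    case True
    then have "gfbm_kernel \<alpha> \<gamma> 1 v * gfbm_kernel \<alpha> \<gamma> 1 v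
      = ((1 - v) powr \<alpha> * (1 - v) powr \<alpha>) * (v powr (- \<gamma> / 2) * v powr (- \<gamma> / 2))"
      by (simp add: gfbm_kernel_def pos_powr_def)
    then show ?thesis using True by (simp add: f_def powr_add[symmetric])
  next
    case False
    then have "v \<notin> {0..1} \<or> v = 0 \<or> v = 1" by auto
    then show ?thesis by (auto simp: f_def)
  qed
  have f_nonneg: "0 \<le> f v" for v by (simp add: f_def)
  have f_int: "integrable lborel f"
  proof (rule Bochner_Integration.integrable_bound[OF int])
    show "f \<in> borel_measurable lborel" unfolding f_def[abs_def] by measurable
  qed (use f_le f_nonneg in \<open>auto intro!: AE_I2 intro: order_trans\<close>)
  \<comment> \<open>The interval has length 1/2, and on it
    \<open>(1 - v) powr (2 * \<alpha>) \<ge> (1/2) powr 2\<close> and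
    \<open>v powr (- \<gamma>) \<ge> 1\<close>.\<close>
  have "(1/8 :: real) = (LINT v|lborel. indicator {0<..1/2} (v::real) * (1/4))" by simp
  also have "\<dots> \<le> (LINT v|lborel. f v)"
  proof (rule integral_mono[OF integrable_mult_left f_int])
    show "integrable lborel (indicator {0<..1/2} :: real \<Rightarrow> real)"
      by (intro integrable_real_indicator emeasure_bounded_finite bounded_subset[OF bounded_closed_interval[of 0 "1/2"]]) auto
    fix v :: real
    show "indicator {0<..1/2} v * (1/4) \<le> f v"
    proof (cases "v \<in> {0<..1/2}")
      case True
      have "(1/4 :: real) = (1/2) powr 2" by (simp add: power2_eq_square)
      also have "\<dots> \<le> (1/2) powr (2 * \<alpha>)" using \<alpha>_le by (intro powr_mono') auto
      also have "\<dots> \<le> (1 - v) powr (2 * \<alpha>)" using True \<alpha> by (intro powr_mono2) auto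
      finally have 1: "1/4 \<le> (1 - v) powr (2 * \<alpha>)" .
      have "v powr 0 \<le> v powr (- \<gamma>)" using True \<gamma> by (intro powr_mono') auto
      then have "1/4 * 1 \<le> (1 - v) powr (2 * \<alpha>) * v powr (- \<gamma>)" using 1 True by (intro mult_mono) auto
      then show ?thesis using True by (simp add: f_def)
    qed (simp add: f_nonneg)
  qed
  finally have f_pos: "0 < (LINT v|lborel. f v)" by simp
  have "0 < (LINT v:{0..1}|lborel. (1 - v) powr (2 * \<alpha>) * v powr (- \<gamma>))
    + (LINT v:{0..}|lborel. ((1 + v) powr \<alpha> - v powr \<alpha>)\<^sup>2 * v powr (- \<gamma>))"
    using f_pos unfolding set_lebesgue_integral_def f_def by (intro add_pos_nonneg integral_nonneg) auto
  then have "0 < (gfbm_const \<alpha> \<gamma>)\<^sup>2" by (simp add: gfbm_const_def)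
  moreover have "0 < (LINT u|lborel. gfbm_kernel \<alpha> \<gamma> 1 u * gfbm_kernel \<alpha> \<gamma> 1 u)"
    using f_pos integral_mono[OF f_int int f_le] by simp
  ultimately show ?thesis by (rule mult_pos_pos)
qed

text \<open>These three estimates are all that is retained of the stochastic integral. The variance
  of an increment is written out in covariances, because those are what transfers from
  \<open>N\<close> to \<open>M\<close>.\<close>

lemma gfbm_moments:
  fixes N :: "'b measure" and B M X
  assumes grm: "gaussian_random_measure N lborel B" and X: "generalized_fbm N B \<alpha> \<gamma> M X"
  obtains V C where "0 < V" "0 < C"
    "\<And>t. 0 \<le> t \<Longrightarrow> (LINT \<omega>|M. (X t \<omega>)\<^sup>2) = V * t powr (2 * H)"
    "\<And>s t. 0 < s \<Longrightarrow> s \<le> t \<Longrightarrow> \<bar>LINT \<omega>|M. X s \<omega> * X t \<omega>\<bar> \<le> C * (s powr H * t powr H * (s / t) powr \<eta>)"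
    "\<And>l s t. 0 < l \<Longrightarrow> 0 \<le> s \<Longrightarrow> s \<le> t \<Longrightarrow> t \<le> 1 \<Longrightarrow>
      (LINT \<omega>|M. X (l * s) \<omega> * X (l * s) \<omega>) + (LINT \<omega>|M. X (l * t) \<omega> * X (l * t) \<omega>)
        - 2 * (LINT \<omega>|M. X (l * s) \<omega> * X (l * t) \<omega>) \<le> C * (l powr (2 * H) * (t - s) powr (2 * \<alpha>))"
proof -
  let ?k = "gfbm_kernel \<alpha> \<gamma>"
  define c where "c = (gfbm_const \<alpha> \<gamma>)\<^sup>2"
  have c0: "0 \<le> c" by (simp add: c_def)
  note int = gfbm_covariance(1)[OF grm X]
  have cov: "(LINT \<omega>|M. X s \<omega> * X t \<omega>) = c * (LINT u|lborel. ?k s u * ?k t u)" if "0 \<le> s" "0 \<le> t" for s t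
    unfolding c_def by (rule gfbm_covariance(2)[OF grm X that])
  define V where "V = c * (LINT u|lborel. ?k 1 u * ?k 1 u)"
  define F1 where "F1 = two_powers \<gamma> (\<gamma> + 2 - 2 * \<alpha>)"
  define F2 where "F2 = two_powers (1/2 + \<gamma>/2 + \<eta>) (\<gamma> + 2 - 2 * \<alpha>)"
  have q: "1 < \<gamma> + 2 - 2 * \<alpha>" using \<alpha> by linarith
  have F1: "integrable lborel F1" unfolding F1_def by (rule two_powers_integrable[OF \<gamma>(2) q])
  have F2: "integrable lborel F2" unfolding F2_def by (rule two_powers_integrable[OF \<eta>(2) q])
  have Fint0: "0 \<le> (LINT u|lborel. F1 u)" "0 \<le> (LINT u|lborel. F2 u)"
    unfolding F1_def F2_def by (simp_all add: two_powers_nonneg)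
  define C where "C = c * (LINT u|lborel. F1 u) + c * (LINT u|lborel. F2 u) + 1"
  have C: "c * (LINT u|lborel. F1 u) \<le> C" "c * (LINT u|lborel. F2 u) \<le> C" "0 < C"
    using Fint0 c0 by (auto simp: C_def intro: add_nonneg_pos)
  show thesis
  proof
    show "0 < V" unfolding V_def c_def by (intro gfbm_variance_pos int) auto
    show "0 < C" by (rule C)
    show "(LINT \<omega>|M. (X t \<omega>)\<^sup>2) = V * t powr (2 * H)" if t: "0 \<le> t" for t
    proof (cases "t = 0")
      case True
      then show ?thesis using cov[of 0 0] by (simp add: power2_eq_square kernel_0)
    next
      case False
      then show ?thesis using cov[OF t t] kernel_integral_scaling[of t 1 1] t by (simp add: power2_eq_square V_def)
    qed
    show "\<bar>LINT \<omega>|M. X s \<omega> * X t \<omega>\<bar> \<le> C * (s powr H * t powr H * (s / t) powr \<eta>)"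
      if st: "0 < s" "s \<le> t" for s t
    proof -
      define r where "r = s / t"
      have r: "0 < r" "r \<le> 1" and t: "0 < t" and s: "s = t * r" using st by (auto simp: r_def)
      have "\<bar>LINT u|lborel. ?k r u * ?k 1 u\<bar> \<le> (LINT u|lborel. \<bar>?k r u * ?k 1 u\<bar>)"
        by (rule integral_abs_bound)
      also have "\<dots> \<le> (LINT u|lborel. r powr (H + \<eta>) * F2 u)"
        unfolding F2_def using r F2 by (intro integral_mono kernel_product_bound integrable_abs int integrable_mult_right) (auto simp: F2_def)
      also have "\<dots> = r powr (H + \<eta>) * (LINT u|lborel. F2 u)" by simp
      finally have I: "\<bar>LINT u|lborel. ?k r u * ?k 1 u\<bar> \<le> r powr (H + \<eta>) * (LINT u|lborel. F2 u)" .
      have "\<bar>LINT \<omega>|M. X s \<omega> * X t \<omega>\<bar> = c * t powr (2 * H) * \<bar>LINT u|lborel. ?k r u * ?k 1 u\<bar>"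
        using cov[of s t] kernel_integral_scaling[OF t, of r 1] st c0 by (simp add: s abs_mult)
      also have "\<dots> \<le> c * t powr (2 * H) * (r powr (H + \<eta>) * (LINT u|lborel. F2 u))"
        using c0 by (intro mult_left_mono I) auto
      also have "\<dots> = (c * (LINT u|lborel. F2 u)) * (t powr (2 * H) * r powr (H + \<eta>))" by (simp add: ac_simps)
      also have "\<dots> \<le> C * (t powr (2 * H) * r powr (H + \<eta>))" by (intro mult_right_mono C) auto
      also have "t powr (2 * H) * r powr (H + \<eta>) = s powr H * t powr H * (s / t) powr \<eta>"
      proof -
        have "s powr H = t powr H * r powr H" unfolding s by (rule powr_mult)
        moreover have "t powr (2 * H) = t powr H * t powr H" by (simp add: powr_add[symmetric])
        moreover have "r powr (H + \<eta>) = r powr H * r powr \<eta>" by (rule powr_add)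
        ultimately show ?thesis unfolding r_def[symmetric] by (metis mult.assoc mult.commute)
      qed
      finally show ?thesis .
    qed
    show "(LINT \<omega>|M. X (l * s) \<omega> * X (l * s) \<omega>) + (LINT \<omega>|M. X (l * t) \<omega> * X (l * t) \<omega>)
        - 2 * (LINT \<omega>|M. X (l * s) \<omega> * X (l * t) \<omega>) \<le> C * (l powr (2 * H) * (t - s) powr (2 * \<alpha>))"
      if l: "0 < l" and st: "0 \<le> s" "s \<le> t" "t \<le> 1" for l s t
    proof -
      have t0: "0 \<le> t" using st by simp
      note i = int[OF st(1) st(1)] int[OF t0 t0] int[OF st(1) t0]
      have sq: "(?k t u - ?k s u)\<^sup>2 = ?k s u * ?k s u + ?k t u * ?k t u - 2 * (?k s u * ?k t u)" for u
        by (simp add: power2_eq_square algebra_simps)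
      have "(LINT \<omega>|M. X (l * s) \<omega> * X (l * s) \<omega>) + (LINT \<omega>|M. X (l * t) \<omega> * X (l * t) \<omega>)
        - 2 * (LINT \<omega>|M. X (l * s) \<omega> * X (l * t) \<omega>)
        = c * l powr (2 * H) * (LINT u|lborel. (?k t u - ?k s u)\<^sup>2)"
      proof -
        have I: "(LINT u|lborel. (?k t u - ?k s u)\<^sup>2)
          = (LINT u|lborel. ?k s u * ?k s u) + (LINT u|lborel. ?k t u * ?k t u) - 2 * (LINT u|lborel. ?k s u * ?k t u)"
          unfolding sq using i by simp
        have cov': "(LINT \<omega>|M. X (l * x) \<omega> * X (l * y) \<omega>) = c * (l powr (2 * H) * (LINT u|lborel. ?k x u * ?k y u))"
          if "0 \<le> x" "0 \<le> y" for x y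
          using cov[of "l * x" "l * y"] that l by (simp add: kernel_integral_scaling[OF l])
        show ?thesis
          unfolding I cov'[OF st(1) st(1)] cov'[OF t0 t0] cov'[OF st(1) t0]
          by (simp only: right_diff_distrib distrib_left mult.assoc mult.left_commute[of 2])
      qed
      also have "(LINT u|lborel. (?k t u - ?k s u)\<^sup>2) \<le> (LINT u|lborel. (t - s) powr (2 * \<alpha>) * F1 u)"
        unfolding F1_def
      proof (rule integral_mono)
        show "integrable lborel (\<lambda>u. (?k t u - ?k s u)\<^sup>2)" unfolding sq using i by simp
        show "integrable lborel (\<lambda>u. (t - s) powr (2 * \<alpha>) * two_powers \<gamma> (\<gamma> + 2 - 2 * \<alpha>) u)"
          using F1 unfolding F1_def by simp
      qed (rule kernel_increment_bound[OF st])
      also have "\<dots> = (t - s) powr (2 * \<alpha>) * (LINT u|lborel. F1 u)" by simp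
      finally have "(LINT \<omega>|M. X (l * s) \<omega> * X (l * s) \<omega>) + (LINT \<omega>|M. X (l * t) \<omega> * X (l * t) \<omega>)
        - 2 * (LINT \<omega>|M. X (l * s) \<omega> * X (l * t) \<omega>) \<le> c * l powr (2 * H) * ((t - s) powr (2 * \<alpha>) * (LINT u|lborel. F1 u))"
        using c0 by (simp add: mult_left_mono)
      also have "\<dots> = (c * (LINT u|lborel. F1 u)) * (l powr (2 * H) * (t - s) powr (2 * \<alpha>))" by (simp add: ac_simps)
      also have "\<dots> \<le> C * (l powr (2 * H) * (t - s) powr (2 * \<alpha>))" by (intro mult_right_mono C) auto
      finally show ?thesis .
    qed
  qed
qed

end

section \<open>Self-similar Gaussian processes\<close>

text \<open>Each point is the limit of its dyadic approximations \<open>d k x\<close> from below.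
  Consecutive approximations are equal or neighbours on the finer grid, so passing from level
  \<open>k0\<close> to the limit costs a geometric series for \<open>x\<close> and another for
  \<open>y\<close>; at level \<open>k0\<close> the two approximations are themselves equal or
  neighbours. This explains \<open>1 + 2 / (1 - \<theta>)\<close>.\<close>

lemma dyadic_chaining:
  fixes f :: "real \<Rightarrow> real"
  assumes cont: "continuous_on {0..1} f" and e: "0 \<le> e" and \<theta>: "0 < \<theta>" "\<theta> < 1"
    and inc: "\<And>k j. k0 \<le> k \<Longrightarrow> j < 2 ^ k \<Longrightarrow> \<bar>f (real (Suc j) / 2 ^ k) - f (real j / 2 ^ k)\<bar> \<le> e * \<theta> ^ k"
    and xy: "x \<in> {0..1}" "y \<in> {0..1}" "\<bar>x - y\<bar> \<le> 1 / 2 ^ k0"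
  shows "\<bar>f x - f y\<bar> \<le> e * \<theta> ^ k0 * (1 + 2 / (1 - \<theta>))"
proof -
  define n where "n k x = nat \<lfloor>2 ^ k * x\<rfloor>" for k :: nat and x :: real
  define d where "d k x = real (n k x) / 2 ^ k" for k x
  have n: "real (n k x) \<le> 2 ^ k * x" "2 ^ k * x < real (n k x) + 1" if "0 \<le> x" for k x
  proof -
    have "(0::int) \<le> \<lfloor>2 ^ k * x\<rfloor>" using that by simp
    then show "real (n k x) \<le> 2 ^ k * x" "2 ^ k * x < real (n k x) + 1" unfolding n_def by linarith+
  qed
  have n_le: "n k x \<le> 2 ^ k" if "x \<in> {0..1}" for k x
  proof -
    have "real (n k x) \<le> 2 ^ k * x" using n(1)[of x k] that by simp
    also have "\<dots> \<le> 2 ^ k * 1" using that by (intro mult_left_mono) auto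
    finally have "real (n k x) \<le> real (2 ^ k)" by simp
    then show ?thesis by (simp only: of_nat_le_iff)
  qed
  have d_in: "d k x \<in> {0..1}" if "x \<in> {0..1}" for k x
  proof -
    have "real (n k x) \<le> real (2 ^ k)" using n_le[OF that, of k] by (simp only: of_nat_le_iff)
    then show ?thesis by (simp add: d_def)
  qed
  have d_lim: "(\<lambda>k. d k x) \<longlonglongrightarrow> x" if x: "x \<in> {0..1}" for x
  proof (rule tendsto_sandwich[of "\<lambda>k. x - (1/2) ^ k" _ _ "\<lambda>k. x"])
    have "x - 1 / 2 ^ k \<le> d k x \<and> d k x \<le> x" for k
    proof -
      have "x = 2 ^ k * x / 2 ^ k" by simp
      moreover have "2 ^ k * x / 2 ^ k \<le> (real (n k x) + 1) / 2 ^ k" "real (n k x) / 2 ^ k \<le> 2 ^ k * x / 2 ^ k"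
        using n[of x k] x by (intro divide_right_mono; simp)+
      ultimately show ?thesis by (simp add: d_def add_divide_distrib)
    qed
    then show "\<forall>\<^sub>F k in sequentially. x - (1/2) ^ k \<le> d k x" "\<forall>\<^sub>F k in sequentially. d k x \<le> x"
      by (auto simp: power_one_over)
    have "(\<lambda>k. x - (1/2) ^ k) \<longlonglongrightarrow> x - 0" by (intro tendsto_intros LIMSEQ_power_zero) auto
    then show "(\<lambda>k. x - (1/2) ^ k) \<longlonglongrightarrow> x" by simp
  qed auto
  have step: "\<bar>f (d (Suc k) x) - f (d k x)\<bar> \<le> e * \<theta> ^ Suc k" if x: "x \<in> {0..1}" and k: "k0 \<le> k" for k x
  proof -
    have "real (n (Suc k) x) < 2 * real (n k x) + 2" "2 * real (n k x) < real (n (Suc k) x) + 1"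
      using n[of x k] n[of x "Suc k"] x by auto
    then consider "n (Suc k) x = 2 * n k x" | "n (Suc k) x = Suc (2 * n k x)" by linarith
    then show ?thesis
    proof cases
      case 1
      then have "d (Suc k) x = d k x" by (simp add: d_def)
      then show ?thesis using e \<theta> by simp
    next
      case 2
      then have "2 * n k x < 2 ^ Suc k" using n_le[OF x, of "Suc k"] by simp
      from inc[OF _ this] k 2 show ?thesis by (simp add: d_def)
    qed
  qed
  have part: "\<bar>f (d (k0 + m) x) - f (d k0 x)\<bar> \<le> e * \<theta> ^ k0 * ((1 - \<theta> ^ m) / (1 - \<theta>))" if x: "x \<in> {0..1}" for m x
  proof (induction m)
    case (Suc m)
    have "\<bar>f (d (k0 + Suc m) x) - f (d (k0 + m) x)\<bar> \<le> e * \<theta> ^ Suc (k0 + m)" using step[OF x, of "k0 + m"] by simp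
    \<comment> \<open>One factor \<open>\<theta>\<close> is given up to simplify the closed form of
      the partial sums.\<close>
    also have "\<dots> \<le> e * \<theta> ^ (k0 + m)" using e \<theta> by (intro mult_left_mono power_decreasing) auto
    also have "\<dots> = e * \<theta> ^ k0 * ((\<theta> ^ m - \<theta> ^ Suc m) / (1 - \<theta>))"
    proof -
      have "\<theta> ^ m - \<theta> ^ Suc m = \<theta> ^ m * (1 - \<theta>)" by (simp add: algebra_simps)
      then show ?thesis using \<theta> by (simp add: power_add)
    qed
    finally have "\<bar>f (d (k0 + Suc m) x) - f (d k0 x)\<bar> \<le> e * \<theta> ^ k0 * ((\<theta> ^ m - \<theta> ^ Suc m) / (1 - \<theta>)) + e * \<theta> ^ k0 * ((1 - \<theta> ^ m) / (1 - \<theta>))"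
      using Suc by linarith
    also have "\<dots> = e * \<theta> ^ k0 * ((1 - \<theta> ^ Suc m) / (1 - \<theta>))"
      by (simp add: distrib_left[symmetric] add_divide_distrib[symmetric])
    finally show ?case .
  qed simp
  have lim: "\<bar>f x - f (d k0 x)\<bar> \<le> e * \<theta> ^ k0 * (1 / (1 - \<theta>))" if x: "x \<in> {0..1}" for x
  proof (rule tendsto_upperbound[OF _ _ trivial_limit_sequentially])
    have "(\<lambda>k. f (d k x)) \<longlonglongrightarrow> f x"
      using cont x d_in d_lim[OF x] unfolding continuous_on_sequentially comp_def by auto
    then have "(\<lambda>m. f (d (k0 + m) x)) \<longlonglongrightarrow> f x" by (subst add.commute) (rule LIMSEQ_ignore_initial_segment)
    then show "(\<lambda>m. \<bar>f (d (k0 + m) x) - f (d k0 x)\<bar>) \<longlonglongrightarrow> \<bar>f x - f (d k0 x)\<bar>" by (intro tendsto_intros)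
    have "e * \<theta> ^ k0 * ((1 - \<theta> ^ m) / (1 - \<theta>)) \<le> e * \<theta> ^ k0 * (1 / (1 - \<theta>))" for m
      using e \<theta> by (intro mult_left_mono divide_right_mono) auto
    then show "\<forall>\<^sub>F m in sequentially. \<bar>f (d (k0 + m) x) - f (d k0 x)\<bar> \<le> e * \<theta> ^ k0 * (1 / (1 - \<theta>))"
      using part[OF x] order_trans by (intro always_eventually allI) blast
  qed
  have near: "\<bar>f (d k0 x) - f (d k0 y)\<bar> \<le> e * \<theta> ^ k0"
    if x: "x \<in> {0..1}" and y: "y \<in> {0..1}" and xy: "\<bar>x - y\<bar> \<le> 1 / 2 ^ k0" "n k0 x \<le> n k0 y" for x y
  proof -
    have "\<bar>2 ^ k0 * x - 2 ^ k0 * y\<bar> \<le> 1"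
    proof -
      have "\<bar>2 ^ k0 * x - 2 ^ k0 * y\<bar> = 2 ^ k0 * \<bar>x - y\<bar>" by (simp add: right_diff_distrib[symmetric] abs_mult)
      also have "\<dots> \<le> 2 ^ k0 * (1 / 2 ^ k0)" using xy by (intro mult_left_mono) auto
      finally show ?thesis by simp
    qed
    \<comment> \<open>Points at most one mesh width apart have integer parts that differ by less
      than 2, hence by at most 1.\<close>
    then have "real (n k0 y) < real (n k0 x) + 2" using n[of x k0] n[of y k0] x y by auto
    then consider "n k0 y = n k0 x" | "n k0 y = Suc (n k0 x)" using xy by linarith
    then show ?thesis
    proof cases
      case 1 then show ?thesis using e \<theta> by (simp add: d_def)
    next
      case 2
      then have "n k0 x < 2 ^ k0" using n_le[OF y, of k0] by simp
      from inc[OF _ this] 2 show ?thesis by (simp add: d_def abs_minus_commute)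
    qed
  qed
  have "\<bar>f (d k0 x) - f (d k0 y)\<bar> \<le> e * \<theta> ^ k0"
    using near[of x y] near[of y x] xy by (cases "n k0 x \<le> n k0 y") (auto simp: abs_minus_commute)
  then have "\<bar>f x - f y\<bar> \<le> e * \<theta> ^ k0 + 2 * (e * \<theta> ^ k0 * (1 / (1 - \<theta>)))"
    using lim[OF xy(1)] lim[OF xy(2)] by linarith
  then show ?thesis by (simp add: algebra_simps)
qed

text \<open>Level \<open>k\<close> of the chaining has \<open>2 ^ k\<close> increments; the doubly
  exponential tail outweighs their number.\<close>

lemma summable_dyadic_exp:
  fixes \<kappa> :: real
  assumes "0 < \<kappa>"
  shows "summable (\<lambda>k. 2 ^ k * 2 * exp (1 - 2 powr (\<kappa> * real k)))"
proof (rule summable_comparison_test_bigo)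
  show "summable (\<lambda>k. norm ((1/2::real) ^ k))" by (simp add: summable_geometric)
  show "(\<lambda>k. 2 ^ k * 2 * exp (1 - 2 powr (\<kappa> * real k))) \<in> O(\<lambda>k. (1/2) ^ k)"
    using assms by real_asymp
qed

text \<open>The properties from which the limit theorem follows. \<open>cov\<close> improves on
  Cauchy-Schwarz by the factor \<open>(s / t) powr \<eta>\<close>; \<open>incr\<close> is a
  mean-square Holder bound of exponent \<open>\<kappa>\<close> on \<open>[0, l]\<close> with the
  scale \<open>l\<close> factored out.\<close>

locale self_similar_gaussian = prob_space M for M :: "'a measure" +
  fixes X :: "real \<Rightarrow> 'a \<Rightarrow> real" and H V C \<kappa> \<eta> :: real
  assumes gauss: "centered_gaussian_process M {0..} X"
    and cont: "\<And>\<omega>. \<omega> \<in> space M \<Longrightarrow> continuous_on {0..} (\<lambda>t. X t \<omega>)"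
    and H: "0 < H" "H < 1" and V: "0 < V" and C: "0 < C" and \<kappa>: "0 < \<kappa>" and \<eta>: "0 < \<eta>"
    and var: "\<And>t. 0 \<le> t \<Longrightarrow> msq (X t) = V * t powr (2 * H)"
    and cov: "\<And>s t. 0 < s \<Longrightarrow> s \<le> t \<Longrightarrow> \<bar>cross (X s) (X t)\<bar> \<le> C * (s powr H * t powr H * (s / t) powr \<eta>)"
    and incr: "\<And>l s t. 0 < l \<Longrightarrow> 0 \<le> s \<Longrightarrow> s \<le> t \<Longrightarrow> t \<le> 1 \<Longrightarrow>
      expectation (\<lambda>\<omega>. (X (l * t) \<omega> - X (l * s) \<omega>)\<^sup>2) \<le> C * (l powr (2 * H) * (t - s) powr (2 * \<kappa>))"

definition gaussian_span :: "(real \<Rightarrow> 'a \<Rightarrow> real) \<Rightarrow> ('a \<Rightarrow> real) set" where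
  "gaussian_span X = {\<lambda>\<omega>. \<Sum>t\<in>J. a t * X t \<omega> | J a. finite J \<and> J \<subseteq> {0..}}"

lemma gaussian_spanI:
  assumes "finite J" "J \<subseteq> {0..}" "\<And>\<omega>. Z \<omega> = (\<Sum>t\<in>J. a t * X t \<omega>)"
  shows "Z \<in> gaussian_span X"
  unfolding gaussian_span_def using assms by (auto intro!: exI[of _ J] exI[of _ a])

lemma gaussian_space_span:
  assumes "prob_space M" and X: "centered_gaussian_process M {0..} X"
  shows "gaussian_space M (gaussian_span X)"
proof -
  interpret prob_space M by fact
  show ?thesis
  proof
    fix Z W :: "'a \<Rightarrow> real" and c :: real
    assume Z: "Z \<in> gaussian_span X"
    then obtain J a where J: "finite J" "J \<subseteq> {0..}" and Z_eq: "Z = (\<lambda>\<omega>. \<Sum>t\<in>J. a t * X t \<omega>)"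
      by (auto simp: gaussian_span_def)
    show "Z \<in> borel_measurable M"
      unfolding Z_eq using X J by (intro borel_measurable_sum borel_measurable_times) (auto simp: centered_gaussian_process_def)
    show "\<exists>v\<ge>0. distr M borel Z = centered_normal v"
      unfolding Z_eq using X J by (auto simp: centered_gaussian_process_def)
    show "(\<lambda>\<omega>. c * Z \<omega>) \<in> gaussian_span X"
      using J by (rule gaussian_spanI[where a = "\<lambda>t. c * a t"]) (simp add: Z_eq sum_distrib_left mult.assoc)
    assume "W \<in> gaussian_span X"
    then obtain J' a' where J': "finite J'" "J' \<subseteq> {0..}" and W_eq: "W = (\<lambda>\<omega>. \<Sum>t\<in>J'. a' t * X t \<omega>)"
      by (auto simp: gaussian_span_def)
    \<comment> \<open>Coefficients are extended by 0 to the union of the index sets, where sums can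
      be added termwise.\<close>
    have ext: "(\<Sum>t\<in>I. b t * X t \<omega>) = (\<Sum>t\<in>J \<union> J'. (if t \<in> I then b t else 0) * X t \<omega>)" if "I \<subseteq> J \<union> J'" for I b \<omega>
      using J(1) J'(1) that by (intro sum.mono_neutral_cong_left) auto
    show "(\<lambda>\<omega>. Z \<omega> + W \<omega>) \<in> gaussian_span X"
    proof (rule gaussian_spanI)
      show "finite (J \<union> J')" "J \<union> J' \<subseteq> {0..}" using J J' by auto
      show "Z \<omega> + W \<omega> = (\<Sum>t\<in>J \<union> J'. ((if t \<in> J then a t else 0) + (if t \<in> J' then a' t else 0)) * X t \<omega>)" for \<omega>
        using ext[of J a] ext[of J' a'] by (simp add: Z_eq W_eq sum.distrib[symmetric] distrib_right)
    qed
  qed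
qed

section \<open>Uniform modulus of continuity at every scale\<close>

context self_similar_gaussian
begin

sublocale gaussian_space M "gaussian_span X"
  by (rule gaussian_space_span[OF prob_space_axioms gauss])

lemma X_in_span: "0 \<le> t \<Longrightarrow> X t \<in> gaussian_span X"
  by (rule gaussian_spanI[of "{t}" _ "\<lambda>_. 1"]) auto

lemma X_measurable: "0 \<le> t \<Longrightarrow> X t \<in> borel_measurable M"
  using X_in_span measurable_G by blast

lemma increment_in_span: "0 \<le> s \<Longrightarrow> 0 \<le> t \<Longrightarrow> (\<lambda>\<omega>. X t \<omega> - X s \<omega>) \<in> gaussian_span X"
  using lincomb_in[OF X_in_span X_in_span, of t s 1 "-1"] by simp

text \<open>An increment of level \<open>k\<close> has standard deviation of order
  \<open>2 powr (- \<kappa> * k)\<close>, while its threshold decays only like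
  \<open>2 powr (- \<kappa> * k / 2)\<close>. The thresholds still form a geometric series, as
  chaining demands, and the tail exponent becomes \<open>L * 2 powr (\<kappa> * k)\<close>, strong
  enough for a union bound over all levels; \<open>sqrt (2 * C)\<close> removes every other constant
  from it.\<close>

lemma dyadic_bad_event:
  obtains K where "0 \<le> K" "\<And>l L. 0 < l \<Longrightarrow> 1 \<le> L \<Longrightarrow>
    \<exists>A\<in>events. prob A \<le> K * exp (- L) \<and> (\<forall>\<omega>\<in>space M - A. \<forall>k j. j < 2 ^ k \<longrightarrow>
      \<bar>X (l * (real (Suc j) / 2 ^ k)) \<omega> - X (l * (real j / 2 ^ k)) \<omega>\<bar> \<le> sqrt (2 * C) * l powr H * sqrt L * (2 powr (- \<kappa> / 2)) ^ k)"
proof -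
  let ?t = "\<lambda>k. 2 ^ k * 2 * exp (1 - 2 powr (\<kappa> * real k)) :: real"
  have sm: "summable ?t" by (rule summable_dyadic_exp[OF \<kappa>])
  show thesis
  proof
    show "0 \<le> suminf ?t" by (intro suminf_nonneg sm) auto
    fix l L :: real assume l: "0 < l" and L: "1 \<le> L"
    define b where "b k = sqrt (2 * C) * l powr H * sqrt L * (2 powr (- \<kappa> / 2)) ^ k" for k
    define E where "E k j = {\<omega>\<in>space M. b k \<le> \<bar>X (l * (real (Suc j) / 2 ^ k)) \<omega> - X (l * (real j / 2 ^ k)) \<omega>\<bar>}" for k j
    have nn: "0 \<le> l * (real j / 2 ^ k)" for j k using l by simp
    note span = increment_in_span[OF nn nn]
    have E[measurable]: "E k j \<in> events" for k j
    proof -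
      note [measurable] = X_measurable[OF nn[of j k]] X_measurable[OF nn[of "Suc j" k]]
      show ?thesis unfolding E_def by measurable
    qed
    have b_sq: "(b k)\<^sup>2 = 2 * (C * (l powr (2 * H) * (1 / 2 ^ k) powr (2 * \<kappa>))) * (L * 2 powr (\<kappa> * real k))" for k
    proof -
      have "(2 powr (- \<kappa> / 2)) ^ k * (2 powr (- \<kappa> / 2)) ^ k = 2 powr (- \<kappa> * real k)"
        by (simp add: powr_realpow[symmetric] powr_powr powr_add[symmetric])
      moreover have "(1 / 2 ^ k) powr (2 * \<kappa>) = 2 powr (- 2 * \<kappa> * real k)"
        by (simp add: powr_realpow[symmetric] powr_powr powr_minus_divide[symmetric] ac_simps)
      moreover have "2 powr (- \<kappa> * real k) = 2 powr (- 2 * \<kappa> * real k) * 2 powr (\<kappa> * real k)"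
        by (simp add: powr_add[symmetric])
      moreover have "(l powr H)\<^sup>2 = l powr (2 * H)" by (simp add: power2_eq_square powr_add[symmetric])
      ultimately show ?thesis
        using C L unfolding b_def power_mult_distrib by (simp add: power2_eq_square[of "_ ^ k"])
    qed
    have PE: "prob (E k j) \<le> 2 * exp (- (L * 2 powr (\<kappa> * real k)))" if j: "j < 2 ^ k" for k j
    proof -
      define v where "v = C * (l powr (2 * H) * (1 / 2 ^ k) powr (2 * \<kappa>))"
      have v: "0 < v" using C l by (simp add: v_def)
      have "real (Suc j) \<le> 2 ^ k" 
        using j of_nat_le_iff[of "Suc j" "2 ^ k", where 'a = real] by simp
      then have "expectation (\<lambda>\<omega>. (X (l * (real (Suc j) / 2 ^ k)) \<omega> - X (l * (real j / 2 ^ k)) \<omega>)\<^sup>2)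
        \<le> C * (l powr (2 * H) * (real (Suc j) / 2 ^ k - real j / 2 ^ k) powr (2 * \<kappa>))"
        by (intro incr l) (auto intro: divide_right_mono)
      also have "real (Suc j) / 2 ^ k - real j / 2 ^ k = 1 / 2 ^ k" by (simp add: diff_divide_distrib[symmetric])
      finally have "prob (E k j) \<le> 2 * exp (- (b k)\<^sup>2 / (2 * v))"
        unfolding E_def v_def[symmetric] using C L by (intro abs_tail span v) (auto simp: b_def)
      also have "- (b k)\<^sup>2 / (2 * v) = - (L * 2 powr (\<kappa> * real k))"
        unfolding b_sq v_def[symmetric] using v by simp
      finally show ?thesis by simp
    qed
    define A where "A k = (\<Union>j<2 ^ k. E k j)" for k :: nat
    have A[measurable]: "A k \<in> events" for k unfolding A_def by auto
    have PA: "prob (A k) \<le> exp (- L) * ?t k" for k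
    proof -
      have "prob (A k) \<le> (\<Sum>j<2^k. prob (E k j))" unfolding A_def by (intro finite_measure_subadditive_finite) auto
      also have "\<dots> \<le> (\<Sum>j<(2::nat)^k. 2 * exp (- (L * 2 powr (\<kappa> * real k))))" by (intro sum_mono PE) auto
      also have "\<dots> = 2 ^ k * 2 * exp (- (L * 2 powr (\<kappa> * real k)))" by simp
      also have "\<dots> \<le> 2 ^ k * 2 * exp (- L + (1 - 2 powr (\<kappa> * real k)))"
      proof -
        \<comment> \<open>From \<open>(L - 1) * (2 powr (\<kappa> * k) - 1) \<ge> 0\<close>: the
          factor \<open>exp (- L)\<close> separates from the sum over levels, which is then
          independent of \<open>l\<close> and \<open>L\<close>.\<close>
        have "1 \<le> 2 powr (\<kappa> * real k)" using \<kappa> by (intro ge_one_powr_ge_zero) auto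
        then have "1 * (2 powr (\<kappa> * real k) - 1) \<le> L * (2 powr (\<kappa> * real k) - 1)" using L by (intro mult_right_mono) auto
        then show ?thesis by (simp add: algebra_simps)
      qed
      also have "\<dots> = exp (- L) * ?t k" unfolding exp_add by (simp only: mult_ac)
      finally show ?thesis .
    qed
    have sA: "summable (\<lambda>k. prob (A k))"
      by (rule summable_comparison_test[OF _ summable_mult[OF sm, of "exp (- L)"]]) (use PA in auto)
    show "\<exists>A\<in>events. prob A \<le> suminf ?t * exp (- L) \<and> (\<forall>\<omega>\<in>space M - A. \<forall>k j. j < 2 ^ k \<longrightarrow>
      \<bar>X (l * (real (Suc j) / 2 ^ k)) \<omega> - X (l * (real j / 2 ^ k)) \<omega>\<bar> \<le> sqrt (2 * C) * l powr H * sqrt L * (2 powr (- \<kappa> / 2)) ^ k)"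
    proof (intro bexI[of _ "\<Union>k. A k"] conjI ballI allI impI)
      have "prob (\<Union>k. A k) \<le> (\<Sum>k. prob (A k))" using sA by (intro finite_measure_subadditive_countably) auto
      also have "\<dots> \<le> (\<Sum>k. exp (- L) * ?t k)" by (intro suminf_le PA sA summable_mult sm)
      also have "\<dots> = suminf ?t * exp (- L)" using suminf_mult[OF sm, of "exp (- L)"] by (simp add: mult.commute)
      finally show "prob (\<Union>k. A k) \<le> suminf ?t * exp (- L)" .
      fix \<omega> k and j :: nat assume "\<omega> \<in> space M - (\<Union>k. A k)" "j < 2 ^ k"
      then have "\<not> b k \<le> \<bar>X (l * (real (Suc j) / 2 ^ k)) \<omega> - X (l * (real j / 2 ^ k)) \<omega>\<bar>" by (auto simp: A_def E_def)
      then show "\<bar>X (l * (real (Suc j) / 2 ^ k)) \<omega> - X (l * (real j / 2 ^ k)) \<omega>\<bar> \<le> sqrt (2 * C) * l powr H * sqrt L * (2 powr (- \<kappa> / 2)) ^ k"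
        unfolding b_def by linarith
    qed auto
  qed
qed

abbreviation modulus_le :: "real \<Rightarrow> real \<Rightarrow> real \<Rightarrow> real \<Rightarrow> real \<Rightarrow> 'a \<Rightarrow> bool" where
  "modulus_le R \<delta> \<epsilon> l L \<omega> \<equiv> \<forall>s\<in>{0..R}. \<forall>t\<in>{0..R}. \<bar>s - t\<bar> \<le> \<delta> \<longrightarrow>
    \<bar>X (l * s) \<omega> - X (l * t) \<omega>\<bar> \<le> \<epsilon> * l powr H * sqrt L"

text \<open>Chaining starts at a level \<open>k0\<close> so fine that its geometric tail is below
  \<open>\<epsilon>\<close>. Neither \<open>\<delta>\<close> nor \<open>K\<close> depends on
  \<open>l\<close> or \<open>L\<close>. With \<open>L = loglog u\<close> the exceptional probability
  is of order \<open>ln (1 / u) powr (- 2)\<close>, summable along geometric times.\<close>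

lemma modulus:
  assumes R: "0 < R" and \<epsilon>: "0 < \<epsilon>"
  obtains \<delta> K where "0 < \<delta>" "0 \<le> K" "\<And>l L. 0 < l \<Longrightarrow> 1 \<le> L \<Longrightarrow>
    \<exists>A\<in>events. prob A \<le> K * exp (- L) \<and> (\<forall>\<omega>\<in>space M - A. modulus_le R \<delta> \<epsilon> l L \<omega>)"
proof -
  obtain K where K: "0 \<le> K" "\<And>l L. 0 < l \<Longrightarrow> 1 \<le> L \<Longrightarrow>
    \<exists>A\<in>events. prob A \<le> K * exp (- L) \<and> (\<forall>\<omega>\<in>space M - A. \<forall>k j. j < 2 ^ k \<longrightarrow>
      \<bar>X (l * (real (Suc j) / 2 ^ k)) \<omega> - X (l * (real j / 2 ^ k)) \<omega>\<bar> \<le> sqrt (2 * C) * l powr H * sqrt L * (2 powr (- \<kappa> / 2)) ^ k)"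
    by (rule dyadic_bad_event) blast
  define \<theta> :: real where "\<theta> = 2 powr (- \<kappa> / 2)"
  have \<theta>: "0 < \<theta>" "\<theta> < 1" using \<kappa> by (auto simp: \<theta>_def intro: powr_less_one)
  define D where "D = sqrt (2 * C) * R powr H * (1 + 2 / (1 - \<theta>))"
  have "(\<lambda>k. D * \<theta> ^ k) \<longlonglongrightarrow> D * 0" using \<theta> by (intro tendsto_intros LIMSEQ_power_zero) auto
  then have "\<forall>\<^sub>F k in sequentially. D * \<theta> ^ k < \<epsilon>" using \<epsilon> by (intro order_tendstoD(2)) auto
  then obtain k0 where k0: "D * \<theta> ^ k0 < \<epsilon>" by (auto simp: eventually_sequentially)
  show thesis
  proof
    show "0 < R / 2 ^ k0" "0 \<le> K" using R K by auto
    fix l L :: real assume l: "0 < l" and L: "1 \<le> L"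
    from K(2)[of "l * R" L] l R L obtain A where A: "A \<in> events" "prob A \<le> K * exp (- L)"
      and A_inc: "\<And>\<omega> k j. \<omega> \<in> space M - A \<Longrightarrow> j < 2 ^ k \<Longrightarrow>
        \<bar>X (l * R * (real (Suc j) / 2 ^ k)) \<omega> - X (l * R * (real j / 2 ^ k)) \<omega>\<bar> \<le> sqrt (2 * C) * (l * R) powr H * sqrt L * \<theta> ^ k"
      unfolding \<theta>_def by (auto simp: mult_pos_pos)
    show "\<exists>A\<in>events. prob A \<le> K * exp (- L) \<and> (\<forall>\<omega>\<in>space M - A. \<forall>s\<in>{0..R}. \<forall>t\<in>{0..R}. \<bar>s - t\<bar> \<le> R / 2 ^ k0 \<longrightarrow>
      \<bar>X (l * s) \<omega> - X (l * t) \<omega>\<bar> \<le> \<epsilon> * l powr H * sqrt L)"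
    proof (intro bexI[OF _ A(1)] conjI A(2) ballI impI)
      fix \<omega> s t assume \<omega>: "\<omega> \<in> space M - A" and st: "s \<in> {0..R}" "t \<in> {0..R}" "\<bar>s - t\<bar> \<le> R / 2 ^ k0"
      have lR: "0 \<le> l * R" using l R by simp
      have "\<bar>X (l * R * (s / R)) \<omega> - X (l * R * (t / R)) \<omega>\<bar>
        \<le> (sqrt (2 * C) * (l * R) powr H * sqrt L) * \<theta> ^ k0 * (1 + 2 / (1 - \<theta>))"
      proof (rule dyadic_chaining[where f = "\<lambda>x. X (l * R * x) \<omega>", OF _ _ \<theta>])
        show "continuous_on {0..1} (\<lambda>x. X (l * R * x) \<omega>)"
          using \<omega> lR by (intro continuous_on_compose2[OF cont] continuous_intros) auto
        show "s / R \<in> {0..1}" "t / R \<in> {0..1}" using st R by auto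
        have "\<bar>s / R - t / R\<bar> = \<bar>s - t\<bar> / R" using R by (simp add: diff_divide_distrib[symmetric])
        also have "\<dots> \<le> R / 2 ^ k0 / R" using st R by (intro divide_right_mono) auto
        finally show "\<bar>s / R - t / R\<bar> \<le> 1 / 2 ^ k0" using R by simp
      qed (use A_inc \<omega> C L in auto)
      also have "\<dots> = (D * \<theta> ^ k0) * (l powr H * sqrt L)"
        unfolding D_def powr_mult by (simp only: mult_ac)
      also have "\<dots> \<le> \<epsilon> * (l powr H * sqrt L)" using k0 L by (intro mult_right_mono) auto
      finally show "\<bar>X (l * s) \<omega> - X (l * t) \<omega>\<bar> \<le> \<epsilon> * l powr H * sqrt L" using R by (simp add: mult.assoc)
    qed
  qed
qed

end

section \<open>The upper bound\<close>

text \<open>With the factor 2 included, the Gaussian tail \<open>exp (- p * loglog u / 2)\<close>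
  becomes \<open>ln (1 / u) powr (- p)\<close> for \<open>u < 1\<close>.\<close>

definition loglog :: "real \<Rightarrow> real" where
  "loglog u = 2 * ln (ln (1 / u))"

lemma loglog_at_top: "filterlim loglog at_top (at_right 0)"
  unfolding loglog_def by real_asymp

lemma loglog_antimono:
  assumes "0 < u" "u \<le> w" "w < 1"
  shows "loglog w \<le> loglog u"
proof -
  have "0 < ln (1 / w)" using assms by (intro ln_gt_zero) auto
  moreover have "ln (1 / w) \<le> ln (1 / u)" using assms by (intro ln_mono) (auto simp: field_simps)
  ultimately show ?thesis by (simp add: loglog_def)
qed

lemma geometric_at_right_0:
  fixes q :: real assumes "0 < q" "q < 1"
  shows "filterlim (\<lambda>n. q ^ n) (at_right 0) sequentially"
  unfolding filterlim_at using assms by (auto intro!: LIMSEQ_power_zero always_eventually)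

lemma eventually_at_right_0_geometric:
  fixes q :: real
  assumes q: "0 < q" "q < 1" and P: "\<forall>\<^sub>F n in sequentially. \<forall>u. q ^ Suc n \<le> u \<and> u \<le> q ^ n \<longrightarrow> P u"
  shows "\<forall>\<^sub>F u in at_right 0. P u"
proof -
  from P obtain n0 where n0: "\<And>n u. n0 \<le> n \<Longrightarrow> q ^ Suc n \<le> u \<Longrightarrow> u \<le> q ^ n \<Longrightarrow> P u"
    by (auto simp: eventually_sequentially)
  have "P u" if u: "0 < u" "u < q ^ n0" for u
  proof -
    obtain m where "q ^ m < u" using real_arch_pow_inv[OF u(1) q(2)] by auto
    \<comment> \<open>The first power of \<open>q\<close> below \<open>u\<close> and its predecessor
      enclose \<open>u\<close>.\<close>
    define k where "k = (LEAST m. q ^ m < u)"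
    have k: "q ^ k < u" unfolding k_def using \<open>q ^ m < u\<close> by (rule LeastI)
    have "n0 < k"
    proof (rule ccontr)
      assume "\<not> n0 < k"
      then have "q ^ n0 \<le> q ^ k" using q by (intro power_decreasing) auto
      then show False using k u by simp
    qed
    then obtain n where n: "k = Suc n" "n0 \<le> n" by (cases k) auto
    have "\<not> q ^ n < u" using not_less_Least[of n "\<lambda>m. q ^ m < u"] n by (simp add: k_def[symmetric])
    then show ?thesis using n0[OF n(2), of u] k n by auto
  qed
  then show ?thesis unfolding eventually_at_right_field using q by (intro exI[of _ "q ^ n0"]) auto
qed

text \<open>Along \<open>q ^ n\<close> the terms are a constant multiple of
  \<open>n powr (- p)\<close>.\<close>

lemma summable_exp_loglog_geometric:
  fixes q p :: real
  assumes q: "0 < q" "q < 1" and p: "1 < p"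
  shows "summable (\<lambda>n. exp (- p * loglog (q ^ n) / 2))"
proof -
  define c where "c = ln (1 / q)"
  have c: "0 < c" unfolding c_def using q by (intro ln_gt_zero) auto
  have "exp (- p * loglog (q ^ n) / 2) = c powr (- p) * real n powr (- p)" if n: "1 \<le> n" for n
  proof -
    have "ln (1 / q ^ n) = real n * c" unfolding c_def using q by (simp add: ln_div ln_realpow)
    then have "exp (- p * loglog (q ^ n) / 2) = (real n * c) powr (- p)" using n c by (simp add: loglog_def powr_def)
    also have "\<dots> = c powr (- p) * real n powr (- p)" by (simp add: powr_mult)
    finally show ?thesis .
  qed
  then have "\<forall>\<^sub>F n in sequentially. exp (- p * loglog (q ^ n) / 2) = c powr (- p) * real n powr (- p)"
    by (auto simp: eventually_sequentially)
  moreover have "summable (\<lambda>n. c powr (- p) * real n powr (- p))"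
    using p by (intro summable_mult) (simp add: summable_real_powr_iff)
  ultimately show ?thesis by (subst summable_cong) auto
qed

lemma (in prob_space) borel_cantelli_eventually:
  assumes A: "\<And>n. A n \<in> events" and g: "summable g" and le: "\<forall>\<^sub>F n in sequentially. prob (A n) \<le> g n"
  shows "AE \<omega> in M. \<forall>\<^sub>F n in sequentially. \<omega> \<notin> A n"
proof -
  have "summable (\<lambda>n. measure M (A n))"
    by (rule summable_comparison_test_ev[OF _ g]) (use le in eventually_elim, simp)
  then have "AE \<omega> in M. \<forall>\<^sub>F n in sequentially. \<omega> \<in> space M - A n"
    by (intro borel_cantelli_AE1) (auto simp: A emeasure_eq_measure)
  then show ?thesis by eventually_elim (auto elim: eventually_mono)
qed

section \<open>Almost sure bounds along geometric times\<close>

context self_similar_gaussian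
begin

definition scale_at :: "real \<Rightarrow> real" where
  "scale_at u = u powr H * sqrt (loglog u)"

abbreviation iterate :: "real \<Rightarrow> 'a \<Rightarrow> real \<Rightarrow> real" where
  "iterate b \<omega> u \<equiv> X \<bar>X (u * b) \<omega>\<bar> \<omega>"

abbreviation normalizer :: "real \<Rightarrow> real" where
  "normalizer u \<equiv> u powr (H\<^sup>2) * loglog u powr ((H + 1) / 2)"

text \<open>The left side is the size that \<open>X\<close> reaches at times of order
  \<open>scale_at u\<close>. In the exponent of \<open>loglog u\<close>, \<open>H / 2\<close> comes
  from the time and \<open>1 / 2\<close> from the value.\<close>

lemma normalization_eq:
  assumes "0 \<le> loglog u"
  shows "scale_at u powr H * sqrt (loglog u) = normalizer u"
proof -
  have "scale_at u powr H * sqrt (loglog u) = (u powr H) powr H * ((loglog u powr (1/2)) powr H * loglog u powr (1/2))"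
    using assms by (simp add: scale_at_def powr_mult powr_half_sqrt)
  also have "\<dots> = u powr (H\<^sup>2) * loglog u powr (1/2 * H + 1/2)"
    by (simp only: powr_powr powr_add power2_eq_square)
  also have "1/2 * H + 1/2 = (H + 1) / 2" by simp
  finally show ?thesis .
qed

lemma sqrt_V_powr_sq: "(sqrt V * t powr H)\<^sup>2 = V * t powr (2 * H)"
  using V by (simp add: power_mult_distrib power2_eq_square[of "_ powr _"] powr_add[symmetric])

definition unit :: "real \<Rightarrow> 'a \<Rightarrow> real" where
  "unit t \<omega> = X t \<omega> / (sqrt V * t powr H)"

lemma unit_in_span: "0 \<le> t \<Longrightarrow> unit t \<in> gaussian_span X"
  using scale[OF X_in_span, of t "1 / (sqrt V * t powr H)"] by (simp add: unit_def[abs_def])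

lemma expectation_unit_sq:
  assumes "0 < t" shows "msq (unit t) = 1"
proof -
  have "(unit t \<omega>)\<^sup>2 = (X t \<omega>)\<^sup>2 / (V * t powr (2 * H))" for \<omega> 
    by (simp only: unit_def power_divide sqrt_V_powr_sq)
  then show ?thesis using var[of t] V assms by simp
qed

lemma expectation_unit_mult:
  assumes st: "0 < s" "s \<le> t"
  shows "\<bar>cross (unit s) (unit t)\<bar> \<le> C / V * (s / t) powr \<eta>"
proof -
  have "unit s \<omega> * unit t \<omega> = X s \<omega> * X t \<omega> / (V * (s powr H * t powr H))" for \<omega>
    using V by (simp add: unit_def)
  then have "\<bar>cross (unit s) (unit t)\<bar> = \<bar>cross (X s) (X t)\<bar> / (V * (s powr H * t powr H))"
    using V by (simp add: abs_divide abs_mult)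
  also have "\<dots> \<le> C * (s powr H * t powr H * (s / t) powr \<eta>) / (V * (s powr H * t powr H))"
    using V by (intro divide_right_mono cov st) auto
  also have "\<dots> = C / V * (s / t) powr \<eta>" using V st by simp
  finally show ?thesis .
qed

text \<open>\<open>\<delta>\<close> is fixed before the sequences are given. This order matters: the
  ratio \<open>q\<close> of the geometric times will itself be chosen from a \<open>\<delta>\<close>
  obtained here.\<close>

lemma modulus_eventually:
  assumes "0 < R" "0 < \<epsilon>"
  obtains \<delta> where "0 < \<delta>" "\<And>l L. \<forall>\<^sub>F n in sequentially. 0 < l n \<and> 1 \<le> L n \<Longrightarrow> summable (\<lambda>n. exp (- L n)) \<Longrightarrow>
    AE \<omega> in M. \<forall>\<^sub>F n::nat in sequentially. modulus_le R \<delta> \<epsilon> (l n) (L n) \<omega>"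
proof -
  obtain \<delta> K where \<delta>: "0 < \<delta>" "0 \<le> K" and bad: "\<And>l L. 0 < l \<Longrightarrow> 1 \<le> L \<Longrightarrow>
    \<exists>A\<in>events. prob A \<le> K * exp (- L) \<and> (\<forall>\<omega>\<in>space M - A. modulus_le R \<delta> \<epsilon> l L \<omega>)"
    by (rule modulus[OF assms]) blast
  show thesis
  proof (rule that[OF \<delta>(1)])
    fix l L :: "nat \<Rightarrow> real"
    assume ev: "\<forall>\<^sub>F n in sequentially. 0 < l n \<and> 1 \<le> L n" and sm: "summable (\<lambda>n. exp (- L n))"
    have "\<exists>A\<in>events. 0 < l n \<and> 1 \<le> L n \<longrightarrow> prob A \<le> K * exp (- L n) \<and>
      (\<forall>\<omega>\<in>space M - A. modulus_le R \<delta> \<epsilon> (l n) (L n) \<omega>)" for n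
      using bad[of "l n" "L n"] by (cases "0 < l n \<and> 1 \<le> L n") auto
    then obtain A where A: "\<And>n. A n \<in> events" and A_le: "\<And>n. 0 < l n \<Longrightarrow> 1 \<le> L n \<Longrightarrow> prob (A n) \<le> K * exp (- L n)"
      and A_mod: "\<And>n \<omega>. 0 < l n \<Longrightarrow> 1 \<le> L n \<Longrightarrow> \<omega> \<in> space M \<Longrightarrow> \<omega> \<notin> A n \<Longrightarrow> modulus_le R \<delta> \<epsilon> (l n) (L n) \<omega>" by (metis DiffI)
    have "AE \<omega> in M. \<forall>\<^sub>F n in sequentially. \<omega> \<notin> A n"
    proof (rule borel_cantelli_eventually[OF A])
      show "summable (\<lambda>n. K * exp (- L n))" using sm by (rule summable_mult)
      show "\<forall>\<^sub>F n in sequentially. prob (A n) \<le> K * exp (- L n)" using ev by eventually_elim (auto intro: A_le)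
    qed
    with AE_space show "AE \<omega> in M. \<forall>\<^sub>F n in sequentially. modulus_le R \<delta> \<epsilon> (l n) (L n) \<omega>"
    proof eventually_elim
      case (elim \<omega>)
      show ?case using elim(2) ev by eventually_elim (use A_mod elim(1) in blast)
    qed
  qed
qed

lemma scale_ratio_tendsto_0:
  assumes "0 < b" "0 < r"
  shows "((\<lambda>u. u * b / (scale_at u * r)) \<longlongrightarrow> 0) (at_right 0)"
  unfolding scale_at_def loglog_def using assms H by real_asymp

text \<open>The excluded event pushes the standardised pair out of the disc of squared radius
  \<open>1 + \<delta>\<close>. Its correlation tends to 0 with the ratio of the two times, so the
  tail exponent stays above 1 and Borel-Cantelli applies. A negative \<open>a\<close> imposes no
  constraint on the inner value, hence the maximum with 0.\<close>

lemma joint_eventually: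
  assumes b: "0 < b" and r: "0 < r" and d: "0 \<le> d" and \<delta>: "0 < \<delta>"
    and ad: "1 + \<delta> \<le> (max 0 a / (sqrt V * b powr H))\<^sup>2 + (d / (sqrt V * r powr H))\<^sup>2"
    and q: "0 < q" "q < 1"
  shows "AE \<omega> in M. \<forall>\<^sub>F n in sequentially. \<not> (a * scale_at (q ^ n) \<le> \<bar>X (q ^ n * b) \<omega>\<bar> \<and>
      d * (scale_at (q ^ n) powr H * sqrt (loglog (q ^ n))) \<le> \<bar>X (scale_at (q ^ n) * r) \<omega>\<bar>)"
proof -
  let ?u = "\<lambda>n. q ^ n" and ?T = "\<lambda>n. scale_at (q ^ n)" and ?L = "\<lambda>n. loglog (q ^ n)"
  define x0 where "x0 = sqrt V * b powr H"
  define a' where "a' = max 0 a / x0"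
  define d' where "d' = d / (sqrt V * r powr H)"
  have x0: "0 < x0" using V b by (simp add: x0_def)
  have rV: "0 < sqrt V * r powr H" using V r by simp
  \<comment> \<open>Makes \<open>(1 + \<delta>) / (1 + \<rho>) = 1 + \<delta> / 2\<close>: half of
    the excess over the unit disc absorbs the correlation.\<close>
  define \<rho> where "\<rho> = (\<delta> / 2) / (1 + \<delta> / 2)"
  have \<rho>: "0 < \<rho>" using \<delta> by (simp add: \<rho>_def)
  have \<rho>_eq: "(1 + \<delta>) / (1 + \<rho>) = 1 + \<delta> / 2"
    using \<delta> by (simp add: \<rho>_def field_simps)
  note lim_u = geometric_at_right_0[OF q]
  have ev_L: "\<forall>\<^sub>F n in sequentially. 1 \<le> ?L n"
    using filterlim_compose[OF loglog_at_top lim_u] by (simp add: filterlim_at_top)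
  have ratio: "(\<lambda>n. ?u n * b / (?T n * r)) \<longlonglongrightarrow> 0"
    using filterlim_compose[OF scale_ratio_tendsto_0[OF b r] lim_u] .
  have "(\<lambda>n. C / V * (?u n * b / (?T n * r)) powr \<eta>) \<longlonglongrightarrow> C / V * (0 powr \<eta>)"
  proof (intro tendsto_mult tendsto_const tendsto_powr' ratio)
    have "\<forall>\<^sub>F n in sequentially. 0 \<le> ?u n * b / (?T n * r)"
      using ev_L by eventually_elim (use q b r in \<open>auto simp: scale_at_def\<close>)
    then show "0 \<noteq> (0::real) \<or> 0 < \<eta> \<and> (\<forall>\<^sub>F n in sequentially. 0 \<le> ?u n * b / (?T n * r))" using \<eta> by simp
  qed
  then have ev_\<rho>: "\<forall>\<^sub>F n in sequentially. C / V * (?u n * b / (?T n * r)) powr \<eta> < \<rho>"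
    using \<rho> by (intro order_tendstoD(2)) auto
  have ev_1: "\<forall>\<^sub>F n in sequentially. ?u n * b / (?T n * r) < 1" using ratio by (rule order_tendstoD(2)) simp
  \<comment> \<open>For small \<open>n\<close> the iterated logarithm, and with it
    \<open>?T n\<close>, may be negative, which puts the time outside the index set of the process.
    The empty set is used there to keep \<open>S n\<close> measurable.\<close>
  define S where "S n = (if 0 \<le> ?T n then {\<omega>\<in>space M. a' * sqrt (?L n) \<le> \<bar>unit (?u n * b) \<omega>\<bar> \<and> d' * sqrt (?L n) \<le> \<bar>unit (?T n * r) \<omega>\<bar>} else {})" for n
  have S: "S n \<in> events" for n
  proof (cases "0 \<le> ?T n")
    case True
    then have [measurable]: "unit (?u n * b) \<in> borel_measurable M" "unit (?T n * r) \<in> borel_measurable M"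
      using q b r by (auto intro!: measurable_G unit_in_span)
    have "S n = {\<omega>\<in>space M. a' * sqrt (?L n) \<le> \<bar>unit (?u n * b) \<omega>\<bar> \<and> d' * sqrt (?L n) \<le> \<bar>unit (?T n * r) \<omega>\<bar>}"
      using True by (simp add: S_def)
    then show ?thesis by simp
  qed (simp add: S_def)
  have "AE \<omega> in M. \<forall>\<^sub>F n in sequentially. \<omega> \<notin> S n"
  proof (rule borel_cantelli_eventually[OF S])
    show "summable (\<lambda>n. 4 * exp (- (1 + \<delta>/2) * ?L n / 2))"
      using q \<delta> by (intro summable_mult summable_exp_loglog_geometric) auto
    show "\<forall>\<^sub>F n in sequentially. prob (S n) \<le> 4 * exp (- (1 + \<delta>/2) * ?L n / 2)"
      using ev_L ev_\<rho> ev_1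
    proof eventually_elim
      case (elim n)
      have T: "0 < ?T n" using elim q by (simp add: scale_at_def)
      have u: "0 < ?u n * b" "?u n * b \<le> ?T n * r" "0 < ?T n * r"
        using q b T r elim(3) by (auto simp: divide_less_eq)
      have "prob (S n) \<le> 4 * exp (- (1 + \<delta>) * (sqrt (?L n))\<^sup>2 / (2 * (1 + \<rho>)))"
        unfolding S_def using T
      proof (simp only: less_imp_le if_True, intro joint_abs_tail)
        show "\<bar>cross (unit (?u n * b)) (unit (?T n * r))\<bar> \<le> \<rho>"
          using expectation_unit_mult[OF u(1,2)] elim(2) by linarith
      qed (use u ad d \<delta> x0 rV elim(1) in \<open>auto simp: a'_def d'_def x0_def intro!: unit_in_span expectation_unit_sq\<close>)
      also have "- (1 + \<delta>) * (sqrt (?L n))\<^sup>2 / (2 * (1 + \<rho>)) = - ((1 + \<delta>) / (1 + \<rho>)) * ?L n / 2"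
      proof -
        have "- x * y / (2 * z) = - (x / z) * y / 2" for x y z :: real by simp
        moreover have "(sqrt (?L n))\<^sup>2 = ?L n" using elim(1) by simp
        ultimately show ?thesis by (simp only:)
      qed
      finally show ?case unfolding \<rho>_eq .
    qed
  qed
  then show ?thesis
    using AE_space
  proof eventually_elim
    case (elim \<omega>)
    show ?case using elim(1) ev_L
    proof eventually_elim
      case (elim n)
      have T: "0 < ?T n" using elim q by (simp add: scale_at_def)
      show ?case
      proof
        assume A: "a * ?T n \<le> \<bar>X (?u n * b) \<omega>\<bar> \<and> d * (?T n powr H * sqrt (?L n)) \<le> \<bar>X (?T n * r) \<omega>\<bar>"
        have "a' * sqrt (?L n) * (sqrt V * (?u n * b) powr H) = max 0 a * ?T n"
          using x0 V b q by (simp add: a'_def x0_def scale_at_def powr_mult)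
        also have "\<dots> \<le> \<bar>X (?u n * b) \<omega>\<bar>" using A by (simp add: max_def)
        finally have 1: "a' * sqrt (?L n) \<le> \<bar>unit (?u n * b) \<omega>\<bar>"
          using V b q by (simp add: unit_def abs_mult pos_le_divide_eq)
        have "d' * sqrt (?L n) * (sqrt V * (?T n * r) powr H) = d * (?T n powr H * sqrt (?L n))"
          using rV V r T by (simp add: d'_def powr_mult)
        also have "\<dots> \<le> \<bar>X (?T n * r) \<omega>\<bar>" using A by simp
        finally have 2: "d' * sqrt (?L n) \<le> \<bar>unit (?T n * r) \<omega>\<bar>"
          using V r T by (simp add: unit_def abs_mult pos_le_divide_eq)
        show False using 1 2 elim(1) T \<open>\<omega> \<in> space M\<close> by (simp add: S_def)
      qed
    qed
  qed
qed

text \<open>A crude one-coordinate bound that confines the inner value to a bounded multiple of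
  \<open>scale_at\<close>, so that finitely many grid points \<open>r\<close> suffice. The slack 1
  makes the standardised level exceed 1.\<close>

lemma single_eventually:
  assumes b: "0 < b" and q: "0 < q" "q < 1"
  shows "AE \<omega> in M. \<forall>\<^sub>F n in sequentially. \<bar>X (q ^ n * b) \<omega>\<bar> < (sqrt V * b powr H + 1) * scale_at (q ^ n)"
proof -
  let ?u = "\<lambda>n. q ^ n" and ?T = "\<lambda>n. scale_at (q ^ n)" and ?L = "\<lambda>n. loglog (q ^ n)"
  define x0 where "x0 = sqrt V * b powr H"
  define a where "a = (x0 + 1) / x0"
  have x0: "0 < x0" using V b by (simp add: x0_def)
  have a: "1 < a" using x0 by (simp add: a_def)
  have ub: "0 < ?u n * b" for n using q b by simp
  have ev_L: "\<forall>\<^sub>F n in sequentially. 1 \<le> ?L n"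
    using filterlim_compose[OF loglog_at_top geometric_at_right_0[OF q]] by (simp add: filterlim_at_top)
  define S where "S n = {\<omega>\<in>space M. a * sqrt (?L n) \<le> \<bar>unit (?u n * b) \<omega>\<bar>}" for n
  have [measurable]: "unit (?u n * b) \<in> borel_measurable M" for n
    using ub[of n] by (auto intro!: measurable_G unit_in_span)
  have "AE \<omega> in M. \<forall>\<^sub>F n in sequentially. \<omega> \<notin> S n"
  proof (rule borel_cantelli_eventually)
    show "S n \<in> events" for n unfolding S_def by measurable
    have "1 < a\<^sup>2" using a by (simp add: one_less_power)
    then show "summable (\<lambda>n. 2 * exp (- a\<^sup>2 * ?L n / 2))"
      using q by (intro summable_mult summable_exp_loglog_geometric) auto
    show "\<forall>\<^sub>F n in sequentially. prob (S n) \<le> 2 * exp (- a\<^sup>2 * ?L n / 2)"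
      using ev_L
    proof eventually_elim
      case (elim n)
      have "prob (S n) \<le> 2 * exp (- (a * sqrt (?L n))\<^sup>2 / (2 * 1))"
        unfolding S_def using a elim ub[of n] expectation_unit_sq[OF ub[of n]]
        by (intro abs_tail unit_in_span) auto
      also have "(a * sqrt (?L n))\<^sup>2 = a\<^sup>2 * ?L n" using elim by (simp add: power_mult_distrib)
      finally show ?case by simp
    qed
  qed
  then show ?thesis
    using AE_space
  proof eventually_elim
    case (elim \<omega>)
    show ?case using elim(1) ev_L
    proof eventually_elim
      case (elim n)
      have "\<bar>unit (?u n * b) \<omega>\<bar> < a * sqrt (?L n)" using elim(1) \<open>\<omega> \<in> space M\<close> by (auto simp: S_def)
      then have "\<bar>X (?u n * b) \<omega>\<bar> < a * sqrt (?L n) * (sqrt V * (?u n * b) powr H)"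
        using V b q by (simp add: unit_def abs_mult pos_divide_less_eq)
      also have "\<dots> = (x0 + 1) * ?T n" using x0 V b q by (simp add: a_def x0_def scale_at_def powr_mult)
      finally show ?case by (simp add: x0_def)
    qed
  qed
qed


text \<open>The random time divided by \<open>T\<close> is rounded to a grid point \<open>r\<close>.
  An inner value of at least \<open>(r - e) * T\<close> together with an outer value beyond
  \<open>\<sigma> + \<epsilon>'\<close> at the deterministic time \<open>T * r\<close> is excluded
  eventually, simultaneously for the finitely many \<open>r\<close>. One modulus passes from
  \<open>T * r\<close> to the random time, another from the geometric time \<open>q ^ n\<close> to
  \<open>u\<close>.\<close>

theorem iterated_upper:
  assumes b: "0 < b" and \<epsilon>: "0 < \<epsilon>"
    and \<sigma>: "\<And>r. 0 \<le> r \<Longrightarrow> r \<le> sqrt V * b powr H \<Longrightarrow>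
      sqrt V * r powr H * sqrt (1 - r\<^sup>2 / (V * b powr (2 * H))) \<le> \<sigma>"
  shows "AE \<omega> in M. \<forall>\<^sub>F u in at_right 0.
    \<bar>iterate b \<omega> u\<bar> \<le> (\<sigma> + \<epsilon>) * normalizer u"
proof -
  define x0 where "x0 = sqrt V * b powr H"
  have x0: "0 < x0" using V b by (simp add: x0_def)
  have x0_sq: "x0\<^sup>2 = V * b powr (2 * H)"
    unfolding x0_def by (rule sqrt_V_powr_sq)
  have \<sigma>0: "0 \<le> \<sigma>" using \<sigma>[of 0] x0 by (simp add: x0_def)
  \<comment> \<open>Calibrated for \<open>(\<sigma> + 2 * \<epsilon>') * (1 + \<epsilon>') \<le>
    \<sigma> + \<epsilon>\<close>: two additive errors in the value and one multiplicative error in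
    the normalisation.\<close>
  define \<epsilon>' where "\<epsilon>' = min 1 (\<epsilon> / (\<sigma> + 4))"
  have \<epsilon>': "0 < \<epsilon>'" "\<epsilon>' \<le> 1" using \<epsilon> \<sigma>0 by (auto simp: \<epsilon>'_def)
  have "\<epsilon>' * (\<sigma> + 4) \<le> \<epsilon>"
  proof -
    have "\<epsilon>' \<le> \<epsilon> / (\<sigma> + 4)" by (simp add: \<epsilon>'_def)
    then show ?thesis using \<sigma>0 by (simp add: pos_le_divide_eq)
  qed
  moreover have "\<epsilon>' * (2 * \<epsilon>') \<le> \<epsilon>' * 2" using \<epsilon>' by (intro mult_left_mono) auto
  ultimately have fin: "(\<sigma> + 2 * \<epsilon>') * (1 + \<epsilon>') \<le> \<sigma> + \<epsilon>" by (simp add: algebra_simps)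
  \<comment> \<open>The rescaled inner value is below \<open>x0 + 1\<close>, and rounding or moving
    from \<open>q ^ n\<close> to \<open>u\<close> adds at most \<open>e \<le> 1\<close>.\<close>
  define R where "R = x0 + 2"
  have R: "0 < R" using x0 by (simp add: R_def)
  \<comment> \<open>Raising \<open>\<sigma>\<close> to \<open>\<sigma> + \<epsilon>'\<close> gains
    at least \<open>2 * \<delta>0\<close> in squared radius for every \<open>r \<le> R\<close>; one
    half pays for replacing \<open>r\<close> by \<open>r - e\<close>, the other is the margin
    outside the disc.\<close>
  define \<delta>0 where "\<delta>0 = \<epsilon>'\<^sup>2 / (V * R powr (2 * H)) / 2"
  have \<delta>0: "0 < \<delta>0" using \<epsilon>' V R by (simp add: \<delta>0_def)
  obtain \<delta>1 where \<delta>1: "0 < \<delta>1" and mod1: "\<And>l L. \<forall>\<^sub>F n in sequentially. 0 < l n \<and> 1 \<le> L n \<Longrightarrow> summable (\<lambda>n. exp (- L n)) \<Longrightarrow>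
    AE \<omega> in M. \<forall>\<^sub>F n::nat in sequentially. modulus_le R \<delta>1 \<epsilon>' (l n) (L n) \<omega>"
    by (rule modulus_eventually[OF R \<epsilon>'(1)]) blast
  \<comment> \<open>\<open>\<delta>1 / 2\<close> because the random time is within
    \<open>2 * e\<close> of the grid point in units of \<open>T\<close>; the last term bounds the
    loss \<open>2 * e * r / x0\<^sup>2\<close> by \<open>\<delta>0\<close>.\<close>
  define e where "e = min 1 (min (\<delta>1 / 2) (\<delta>0 * x0\<^sup>2 / (2 * R)))"
  have "0 < \<delta>0 * x0\<^sup>2 / (2 * R)" using \<delta>0 x0 R by simp
  then have e: "0 < e" "e \<le> 1" "e \<le> \<delta>1 / 2" using \<delta>1 by (simp_all add: e_def)
  have "e \<le> \<delta>0 * x0\<^sup>2 / (2 * R)" by (simp add: e_def)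
  then have eR: "2 * e * R / x0\<^sup>2 \<le> \<delta>0" using R x0 by (simp add: field_simps)
  obtain \<delta>2 where \<delta>2: "0 < \<delta>2" and mod2: "\<And>l L. \<forall>\<^sub>F n in sequentially. 0 < l n \<and> 1 \<le> L n \<Longrightarrow> summable (\<lambda>n. exp (- L n)) \<Longrightarrow>
    AE \<omega> in M. \<forall>\<^sub>F n::nat in sequentially. modulus_le b \<delta>2 e (l n) (L n) \<omega>"
    by (rule modulus_eventually[OF b e(1)]) blast
  \<comment> \<open>The first bound makes the normalisation vary by at most the factor
    \<open>1 + \<epsilon>'\<close> between consecutive geometric times; the second keeps
    \<open>u * b\<close> within reach of the modulus around \<open>q ^ n * b\<close>.\<close>
  define q where "q = max (1 / (1 + \<epsilon>')) (1 - \<delta>2 / b)"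
  have "0 < 1 / (1 + \<epsilon>')" "1 / (1 + \<epsilon>') < 1" using \<epsilon>' by auto
  then have q: "0 < q" "q < 1" using \<delta>2 b by (auto simp: q_def less_max_iff_disj)
  have q_b: "b * (1 - q) \<le> \<delta>2"
  proof -
    have "1 - q \<le> \<delta>2 / b" by (simp add: q_def)
    then show ?thesis using b by (simp add: pos_le_divide_eq mult.commute)
  qed
  have q_\<epsilon>: "1 \<le> (1 + \<epsilon>') * q powr (H\<^sup>2)"
  proof -
    have "1 / (1 + \<epsilon>') \<le> q powr 1" using q by (simp add: q_def)
    also have "q powr 1 \<le> q powr (H\<^sup>2)" using q H by (intro powr_mono') (auto simp: power_le_one)
    finally show ?thesis using \<epsilon>' by (simp add: divide_le_eq mult.commute)
  qed
  let ?T = "\<lambda>n. scale_at (q ^ n)" and ?L = "\<lambda>n. loglog (q ^ n)"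
  have ev_L: "\<forall>\<^sub>F n in sequentially. 1 \<le> ?L n"
    using filterlim_compose[OF loglog_at_top geometric_at_right_0[OF q]] by (simp add: filterlim_at_top)
  have sm: "summable (\<lambda>n. exp (- ?L n))"
    using summable_exp_loglog_geometric[OF q, of 2] by simp
  define I where "I = {i::nat. 1 \<le> i \<and> real i * e \<le> R}"
  have "I \<subseteq> {..nat \<lceil>R / e\<rceil>}"
  proof
    fix i assume "i \<in> I"
    then have "real i \<le> R / e" using e by (simp add: I_def pos_le_divide_eq)
    then have "nat \<lceil>real i\<rceil> \<le> nat \<lceil>R / e\<rceil>" by (intro nat_mono ceiling_mono)
    then show "i \<in> {..nat \<lceil>R / e\<rceil>}" by simp
  qed
  then have I: "finite I" by (rule finite_subset) simp
  \<comment> \<open>The definition of \<open>\<sigma>\<close> says that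
    \<open>(r / x0, \<sigma> / (sqrt V * r powr H))\<close> never lies strictly inside the unit
    circle; for \<open>r > x0\<close> the first coordinate alone is beyond it.\<close>
  have ad: "1 + \<delta>0 \<le> (max 0 (r - e) / (sqrt V * b powr H))\<^sup>2 + ((\<sigma> + \<epsilon>') / (sqrt V * r powr H))\<^sup>2"
    if r: "0 < r" "r \<le> R" for r
  proof -
    have "r\<^sup>2 - 2 * e * r \<le> (max 0 (r - e))\<^sup>2"
    proof (cases "e \<le> r")
      case True
      then show ?thesis by (simp add: max_def power2_eq_square algebra_simps)
    next
      case False
      then have "r * r \<le> r * (2 * e)" using r by (intro mult_left_mono) auto
      then show ?thesis using False r by (simp add: max_def power2_eq_square mult.commute mult.left_commute)
    qed
    then have "(r\<^sup>2 - 2 * e * r) / x0\<^sup>2 \<le> (max 0 (r - e) / x0)\<^sup>2"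
      unfolding power_divide by (intro divide_right_mono) auto
    moreover have "2 * e * r / x0\<^sup>2 \<le> \<delta>0"
      using eR r e by (intro order_trans[OF divide_right_mono eR] mult_left_mono) auto
    ultimately have 1: "r\<^sup>2 / x0\<^sup>2 - \<delta>0 \<le> (max 0 (r - e) / x0)\<^sup>2" by (simp add: diff_divide_distrib)
    have vr: "(sqrt V * r powr H)\<^sup>2 = V * r powr (2 * H)" "0 < sqrt V * r powr H"
      using V r by (simp_all add: sqrt_V_powr_sq)
    have "1 - r\<^sup>2 / x0\<^sup>2 \<le> (\<sigma> / (sqrt V * r powr H))\<^sup>2"
    proof (cases "r \<le> x0")
      case True
      then have rx: "0 \<le> 1 - r\<^sup>2 / x0\<^sup>2" using r by (simp add: power_mono)
      have "sqrt V * r powr H * sqrt (1 - r\<^sup>2 / x0\<^sup>2) \<le> \<sigma>"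
        using \<sigma>[of r] r True by (simp add: x0_def[symmetric] x0_sq)
      then have "sqrt (1 - r\<^sup>2 / x0\<^sup>2) \<le> \<sigma> / (sqrt V * r powr H)" using vr by (simp add: pos_le_divide_eq mult.commute)
      then have "(sqrt (1 - r\<^sup>2 / x0\<^sup>2))\<^sup>2 \<le> (\<sigma> / (sqrt V * r powr H))\<^sup>2" using rx by (intro power_mono) auto
      then show ?thesis using rx by simp
    next
      case False
      then have "x0\<^sup>2 \<le> r\<^sup>2" using x0 by (intro power_mono) auto
      then have "1 - r\<^sup>2 / x0\<^sup>2 \<le> 0" using x0 by (simp add: le_divide_eq)
      then show ?thesis by (rule order_trans) simp
    qed
    moreover have "2 * \<delta>0 \<le> (\<epsilon>' / (sqrt V * r powr H))\<^sup>2"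
      unfolding power_divide vr \<delta>0_def using V r \<epsilon>' R H
      by (simp, intro divide_left_mono mult_left_mono powr_mono2 mult_pos_pos) auto
    moreover have "(\<sigma> / (sqrt V * r powr H))\<^sup>2 + (\<epsilon>' / (sqrt V * r powr H))\<^sup>2 \<le> ((\<sigma> + \<epsilon>') / (sqrt V * r powr H))\<^sup>2"
      unfolding power_divide add_divide_distrib[symmetric] using \<sigma>0 \<epsilon>' by (intro divide_right_mono) (auto simp: power2_sum)
    ultimately show ?thesis using 1 unfolding x0_def[symmetric] by linarith
  qed
  have "AE \<omega> in M. \<forall>i\<in>I. \<forall>\<^sub>F n in sequentially. \<not> ((real i * e - e) * ?T n \<le> \<bar>X (q ^ n * b) \<omega>\<bar> \<and>
      (\<sigma> + \<epsilon>') * (?T n powr H * sqrt (?L n)) \<le> \<bar>X (?T n * (real i * e)) \<omega>\<bar>)"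
    using \<sigma>0 \<epsilon>' e by (intro AE_finite_allI I joint_eventually[OF b _ _ \<delta>0 ad q]) (auto simp: I_def)
  moreover have "AE \<omega> in M. \<forall>\<^sub>F n in sequentially. \<bar>X (q ^ n * b) \<omega>\<bar> < (x0 + 1) * ?T n"
    unfolding x0_def by (rule single_eventually[OF b q])
  moreover have "AE \<omega> in M. \<forall>\<^sub>F n in sequentially. modulus_le b \<delta>2 e (q ^ n) (?L n) \<omega>"
    using ev_L by (intro mod2 sm) (use q in \<open>auto elim: eventually_mono\<close>)
  moreover have "AE \<omega> in M. \<forall>\<^sub>F n in sequentially. modulus_le R \<delta>1 \<epsilon>' (?T n) (?L n) \<omega>"
    using ev_L by (intro mod1 sm) (use q in \<open>auto elim!: eventually_mono simp: scale_at_def\<close>)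
  ultimately show ?thesis
  proof eventually_elim
    case (elim \<omega>)
    have "\<forall>\<^sub>F n in sequentially. \<forall>i\<in>I. \<not> ((real i * e - e) * ?T n \<le> \<bar>X (q ^ n * b) \<omega>\<bar> \<and>
      (\<sigma> + \<epsilon>') * (?T n powr H * sqrt (?L n)) \<le> \<bar>X (?T n * (real i * e)) \<omega>\<bar>)"
      using elim(1) I by (simp add: eventually_ball_finite_distrib)
    moreover have "\<forall>\<^sub>F n in sequentially. (1::nat) \<le> n" by (rule eventually_ge_at_top)
    ultimately have "\<forall>\<^sub>F n in sequentially. \<forall>u. q ^ Suc n \<le> u \<and> u \<le> q ^ n \<longrightarrow>
      \<bar>iterate b \<omega> u\<bar> \<le> (\<sigma> + \<epsilon>) * normalizer u"
      using elim(2-4) ev_L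
    proof eventually_elim
      case (elim n)
      define w where "w = q ^ n"
      define T where "T = ?T n"
      define L where "L = ?L n"
      have w: "0 < w" using q by (simp add: w_def)
      have w1: "w < 1" using q elim(2) by (simp add: w_def power_Suc_less_one power_less_one_iff)
      have L: "1 \<le> L" using elim(6) by (simp add: L_def)
      have T: "0 < T" 
        using w L q unfolding T_def L_def w_def scale_at_def by (intro mult_pos_pos) auto
      have T_eq: "T = w powr H * sqrt L" by (simp add: T_def L_def w_def scale_at_def)
      show ?case
      proof (intro allI impI)
        fix u assume "q ^ Suc n \<le> u \<and> u \<le> q ^ n"
        then have u: "q * w \<le> u" "u \<le> w" by (auto simp: w_def)
        have u0: "0 < u" using q w u by (meson less_le_trans mult_pos_pos)
        define x where "x = \<bar>X (w * b) \<omega>\<bar> / T"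
        define y where "y = \<bar>X (u * b) \<omega>\<bar> / T"
        have x: "0 \<le> x" "x < x0 + 1" using T elim(3) by (auto simp: x_def pos_divide_less_eq T_def w_def)
        have "\<bar>X (w * (u * b / w)) \<omega> - X (w * b) \<omega>\<bar> \<le> e * w powr H * sqrt L"
        proof -
          have 1: "u * b / w \<in> {0..b}" using u u0 w b by (auto simp: divide_le_eq)
          have "b - u * b / w = b * (1 - u / w)" by (simp add: algebra_simps)
          also have "\<dots> \<le> b * (1 - q)" using u w b by (intro mult_left_mono) (auto simp: le_divide_eq)
          also have "\<dots> \<le> \<delta>2" by (rule q_b)
          finally have "\<bar>u * b / w - b\<bar> \<le> \<delta>2" using 1 by auto
          then show ?thesis unfolding w_def L_def
            by (intro elim(4)[rule_format]) (use 1 b in \<open>auto simp: w_def[symmetric]\<close>)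
        qed
        then have "\<bar>X (u * b) \<omega> - X (w * b) \<omega>\<bar> \<le> e * T" using w by (simp add: T_eq mult.assoc)
        then have "\<bar>\<bar>X (u * b) \<omega>\<bar> - \<bar>X (w * b) \<omega>\<bar>\<bar> \<le> e * T" by linarith
        then have yx: "\<bar>y - x\<bar> \<le> e"
          using T by (simp add: x_def y_def diff_divide_distrib[symmetric] abs_divide pos_divide_le_eq)
        \<comment> \<open>The successor gives \<open>r - e \<le> x < r\<close> and
          \<open>i \<ge> 1\<close>, so the grid point is positive even for
          \<open>x = 0\<close>.\<close>
        define i where "i = Suc (nat \<lfloor>x / e\<rfloor>)"
        define r where "r = real i * e"
        have "real i - 1 \<le> x / e" "x / e < real i" unfolding i_def using x e by (auto simp: of_nat_nat) linarith+
        then have r: "r - e \<le> x" "x < r" using e by (auto simp: r_def field_simps)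
        have rR: "0 \<le> r" "r \<le> R" using r x e by (auto simp: R_def)
        have iI: "i \<in> I" using rR unfolding I_def r_def by (simp add: i_def)
        have yR: "0 \<le> y" "y \<le> R" using T yx x e by (auto simp: y_def R_def)
        have "(r - e) * T \<le> \<bar>X (w * b) \<omega>\<bar>" using r T by (simp add: x_def pos_le_divide_eq)
        then have Xr: "\<bar>X (T * r) \<omega>\<bar> < (\<sigma> + \<epsilon>') * (T powr H * sqrt L)"
          using elim(1) iI unfolding w_def[symmetric] T_def L_def r_def by fastforce
        have "\<bar>X (T * y) \<omega> - X (T * r) \<omega>\<bar> \<le> \<epsilon>' * T powr H * sqrt L"
          using elim(5) yR rR yx r e unfolding T_def[symmetric] L_def[symmetric] by auto
        moreover have "T * y = \<bar>X (u * b) \<omega>\<bar>" using T by (simp add: y_def)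
        ultimately have "\<bar>iterate b \<omega> u\<bar> \<le> (\<sigma> + 2 * \<epsilon>') * (T powr H * sqrt L)"
          using Xr by (simp add: algebra_simps)
        also have "T powr H * sqrt L = w powr (H\<^sup>2) * L powr ((H + 1) / 2)"
          using normalization_eq[of "q ^ n"] L by (simp add: T_def L_def w_def)
        also have "(\<sigma> + 2 * \<epsilon>') * (w powr (H\<^sup>2) * L powr ((H + 1) / 2))
          \<le> (\<sigma> + 2 * \<epsilon>') * (((1 + \<epsilon>') * u powr (H\<^sup>2)) * loglog u powr ((H + 1) / 2))"
        proof -
          have "w powr (H\<^sup>2) \<le> ((1 + \<epsilon>') * q powr (H\<^sup>2)) * w powr (H\<^sup>2)" using mult_right_mono[OF q_\<epsilon>, of "w powr (H\<^sup>2)"] by simp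
          also have "\<dots> = (1 + \<epsilon>') * (q * w) powr (H\<^sup>2)" by (simp add: powr_mult)
          also have "\<dots> \<le> (1 + \<epsilon>') * u powr (H\<^sup>2)" using u q w \<epsilon>' by (intro mult_left_mono powr_mono2) auto
          finally have "w powr (H\<^sup>2) \<le> (1 + \<epsilon>') * u powr (H\<^sup>2)" .
          moreover have "L \<le> loglog u" using loglog_antimono[OF u0 u(2) w1] by (simp add: L_def w_def)
          then have "L powr ((H + 1) / 2) \<le> loglog u powr ((H + 1) / 2)" using L H by (intro powr_mono2) auto
          ultimately show ?thesis using \<sigma>0 \<epsilon>' by (intro mult_left_mono mult_mono) auto
        qed
        also have "\<dots> = ((\<sigma> + 2 * \<epsilon>') * (1 + \<epsilon>')) * normalizer u" by (simp only: mult_ac)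
        also have "\<dots> \<le> (\<sigma> + \<epsilon>) * normalizer u"
          by (intro mult_right_mono fin) auto
        finally show "\<bar>iterate b \<omega> u\<bar> \<le> (\<sigma> + \<epsilon>) * normalizer u" .
      qed
    qed
    then show ?case by (rule eventually_at_right_0_geometric[OF q])
  qed
qed

end

section \<open>The lower bound\<close>

text \<open>Each tail union contains events of probability arbitrarily close to 1. This replaces a
  second Borel-Cantelli lemma, which would call for independent blocks.\<close>

lemma (in prob_space) AE_frequently_of_prob_tendsto_1:
  assumes A: "\<And>n. A n \<in> events" and lim: "(\<lambda>n. prob (A n)) \<longlonglongrightarrow> 1"
  shows "AE \<omega> in M. \<exists>\<^sub>F n in sequentially. \<omega> \<in> A n"
proof -
  have "AE \<omega> in M. \<omega> \<in> (\<Union>n\<in>{N..}. A n)" for N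
  proof (rule AE_prob_1)
    have "1 \<le> prob (\<Union>n\<in>{N..}. A n)"
    proof (rule tendsto_upperbound[OF lim _ trivial_limit_sequentially])
      show "\<forall>\<^sub>F n in sequentially. prob (A n) \<le> prob (\<Union>n\<in>{N..}. A n)"
        using eventually_ge_at_top[of N] by eventually_elim (auto intro!: finite_measure_mono A)
    qed
    then show "prob (\<Union>n\<in>{N..}. A n) = 1" using prob_le_1[of "\<Union>n\<in>{N..}. A n"] by linarith
  qed
  then have "AE \<omega> in M. \<forall>N. \<omega> \<in> (\<Union>n\<in>{N..}. A n)" by (simp add: AE_all_countable)
  then show ?thesis by eventually_elim (auto simp: frequently_sequentially)
qed

text \<open>
  Since \<open>H * (2 - H) < 1\<close>, all the times \<open>block_time H \<delta> m j\<close> with \<open>j < m\<close> are far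
  below all their \<open>H\<close>-th powers, so no coarse scale of a block meets a fine one.
\<close>

definition block_log :: "real \<Rightarrow> real \<Rightarrow> nat \<Rightarrow> nat \<Rightarrow> real" where
  "block_log H \<delta> m j = real m powr (1 + \<delta>) + (1 - H) * real j * real m powr \<delta>"

definition block_time :: "real \<Rightarrow> real \<Rightarrow> nat \<Rightarrow> nat \<Rightarrow> real" where
  "block_time H \<delta> m j = exp (- block_log H \<delta> m j)"

lemma block_log_bounds:
  assumes "0 < H" "H < 1" "0 < \<delta>" "2 \<le> m" "j < m"
  shows "real m powr (1 + \<delta>) \<le> block_log H \<delta> m j" "block_log H \<delta> m j \<le> (2 - H) * real m powr (1 + \<delta>)"
    "real m \<le> block_log H \<delta> m j"
proof -
  show 1: "real m powr (1 + \<delta>) \<le> block_log H \<delta> m j" using assms by (simp add: block_log_def)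
  have "real m powr 1 \<le> real m powr (1 + \<delta>)" using assms by (intro powr_mono) auto
  then show "real m \<le> block_log H \<delta> m j" using 1 assms by simp
  have "real j * real m powr \<delta> \<le> real m * real m powr \<delta>" using assms by (intro mult_right_mono) auto
  also have "\<dots> = real m powr (1 + \<delta>)" using assms by (simp add: powr_add)
  finally have "(1 - H) * (real j * real m powr \<delta>) \<le> (1 - H) * real m powr (1 + \<delta>)"
    using assms by (intro mult_left_mono) auto
  then show "block_log H \<delta> m j \<le> (2 - H) * real m powr (1 + \<delta>)"
    by (simp add: block_log_def algebra_simps)
qed

lemma loglog_block_time: "loglog (block_time H \<delta> m j) = 2 * ln (block_log H \<delta> m j)"
  by (simp add: loglog_def block_time_def exp_minus inverse_eq_divide)

text \<open>Within a block \<open>ln (1 / u)\<close> varies by a factor of at most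
  \<open>2 - H < 2\<close>, hence \<open>loglog\<close> by at most \<open>2 * ln 2\<close>. One
  level \<open>\<beta>\<close> can therefore serve all times of the block.\<close>

lemma loglog_block_time_bounds:
  assumes "0 < H" "H < 1" "0 < \<delta>" "2 \<le> m" "j < m"
  shows "2 * ((1 + \<delta>) * ln (real m)) \<le> loglog (block_time H \<delta> m j)"
    "loglog (block_time H \<delta> m j) \<le> 2 * ((1 + \<delta>) * ln (real m)) + 2 * ln 2"
proof -
  note b = block_log_bounds[OF assms]
  have p: "0 < real m powr (1 + \<delta>)" using assms by simp
  have ln_p: "ln (real m powr (1 + \<delta>)) = (1 + \<delta>) * ln (real m)" using assms by (simp add: ln_powr)
  have "ln (real m powr (1 + \<delta>)) \<le> ln (block_log H \<delta> m j)" using b p by (intro ln_mono) auto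
  then show "2 * ((1 + \<delta>) * ln (real m)) \<le> loglog (block_time H \<delta> m j)"
    unfolding loglog_block_time ln_p by linarith
  have "block_log H \<delta> m j \<le> 2 * real m powr (1 + \<delta>)"
    using b(2) assms p by (elim order_trans) (auto intro: mult_right_mono)
  then have "ln (block_log H \<delta> m j) \<le> ln (2 * real m powr (1 + \<delta>))"
    using b p by (intro ln_mono) auto
  then show "loglog (block_time H \<delta> m j) \<le> 2 * ((1 + \<delta>) * ln (real m)) + 2 * ln 2"
    unfolding loglog_block_time ln_p[symmetric] using p by (simp add: ln_mult)
qed

section \<open>Consequences of a hit, and correlations inside a block\<close>

context self_similar_gaussian
begin

lemma unit_covariance_le:
  assumes "0 < s" "0 < t" "s \<le> \<xi> * t" "\<xi> \<le> 1"
  shows "\<bar>cross (unit s) (unit t)\<bar> \<le> C / V * \<xi> powr \<eta>"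
proof -
  have "\<xi> * t \<le> 1 * t" using assms by (intro mult_right_mono) auto
  then have "s \<le> t" using assms(3) by linarith
  then have "\<bar>cross (unit s) (unit t)\<bar> \<le> C / V * (s / t) powr \<eta>"
    by (intro expectation_unit_mult assms)
  also have "\<dots> \<le> C / V * \<xi> powr \<eta>"
    using assms C V \<eta> by (intro mult_left_mono powr_mono2) (auto simp: divide_le_eq)
  finally show ?thesis .
qed

text \<open>The pathwise meaning of a hit: it places the inner value near
  \<open>scale_at u * r\<close> and the value at that deterministic time near its target, and the
  modulus exchanges the deterministic time for the random one. The level \<open>\<beta>\<close>,
  common to a block, is slightly below \<open>sqrt (loglog u)\<close>.\<close>

lemma near_point:
  assumes b: "0 < b" and r: "0 < r" and u: "0 < u" and L: "0 < loglog u"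
    and x0: "x0 = sqrt V * b powr H"
    and P: "\<bar>unit (u * b) \<omega> - r / x0 * \<beta>\<bar> \<le> e * \<beta>" and Q: "\<bar>unit (scale_at u * r) \<omega> - a * \<beta>\<bar> \<le> e * \<beta>"
    and \<beta>: "(1 - e') * sqrt (loglog u) \<le> \<beta>" "\<beta> \<le> sqrt (loglog u)" and e: "0 \<le> e" "e \<le> e'" "e' \<le> 1"
    and a: "r / x0 \<le> 1" "\<bar>a\<bar> \<le> 1"
    and small: "2 * e' * x0 \<le> \<delta>" "\<delta> \<le> 1" "2 * e' * (sqrt V * r powr H) \<le> \<epsilon>"
    and mod: "modulus_le (r+1) \<delta> \<epsilon> (scale_at u) (loglog u) \<omega>"
  shows "\<bar>iterate b \<omega> u - a * (sqrt V * r powr H) * normalizer u\<bar>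
    \<le> 2 * \<epsilon> * normalizer u"
proof -
  define T where "T = scale_at u"
  define l where "l = sqrt (loglog u)"
  define n where "n = T powr H * l"
  have l: "0 < l" using L by (simp add: l_def)
  have T: "0 < T" using l u by (simp add: T_def scale_at_def l_def)
  have T_eq: "T = u powr H * l" by (simp add: T_def scale_at_def l_def)
  have x0p: "0 < x0" using x0 V b by simp
  \<comment> \<open>One \<open>e' * l\<close> comes from the width of the hit, the other from
    replacing the level \<open>\<beta>\<close> by \<open>l\<close>.\<close>
  have close: "\<bar>y - c * l\<bar> \<le> 2 * e' * l" if y: "\<bar>y - c * \<beta>\<bar> \<le> e * \<beta>" and c: "\<bar>c\<bar> \<le> 1" for y c
  proof -
    have "\<bar>c * \<beta> - c * l\<bar> = \<bar>c\<bar> * \<bar>\<beta> - l\<bar>" by (simp add: abs_mult right_diff_distrib[symmetric])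
    also have "\<dots> \<le> 1 * \<bar>\<beta> - l\<bar>" using c by (intro mult_right_mono) auto
    also have "\<dots> \<le> e' * l" using \<beta> by (simp add: l_def algebra_simps)
    finally have "\<bar>c * \<beta> - c * l\<bar> \<le> e' * l" .
    moreover have "e * \<beta> \<le> e' * l"
      using e \<beta> l by (intro mult_mono) (auto simp: l_def intro: order_trans[OF _ \<beta>(1)])
    ultimately show ?thesis using y by linarith
  qed
  define x where "x = X (u * b) \<omega> / T"
  have Xu: "X (u * b) \<omega> = unit (u * b) \<omega> * (x0 * u powr H)"
    using V b u by (simp add: unit_def x0 powr_mult)
  have "x - r = (unit (u * b) \<omega> - r / x0 * l) * (x0 / l)"
    using l u x0p unfolding x_def Xu T_eq by (simp add: field_simps)
  then have "\<bar>x - r\<bar> = \<bar>unit (u * b) \<omega> - r / x0 * l\<bar> * (x0 / l)"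
    using x0p l by (simp add: abs_mult)
  also have "\<dots> \<le> (2 * e' * l) * (x0 / l)"
    using a r x0p l by (intro mult_right_mono close P) auto
  also have "\<dots> \<le> \<delta>" using l small by simp
  finally have xr: "\<bar>\<bar>x\<bar> - r\<bar> \<le> \<delta>" using r by linarith
  then have x_in: "\<bar>x\<bar> \<in> {0..r+1}" using small by auto
  have "\<bar>X (T * \<bar>x\<bar>) \<omega> - X (T * r) \<omega>\<bar> \<le> \<epsilon> * T powr H * l"
    unfolding T_def l_def using x_in xr r by (intro mod[rule_format]) auto
  moreover have "T * \<bar>x\<bar> = \<bar>X (u * b) \<omega>\<bar>" using T by (simp add: x_def abs_divide)
  ultimately have 1: "\<bar>iterate b \<omega> u - X (T * r) \<omega>\<bar> \<le> \<epsilon> * n" by (simp add: n_def mult.assoc)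
  let ?v = "sqrt V * r powr H"
  have v: "0 < ?v" using V r by simp
  have "X (T * r) \<omega> = unit (T * r) \<omega> * (?v * T powr H)"
    using V r T by (simp add: unit_def powr_mult)
  then have "X (T * r) \<omega> - a * ?v * n = (unit (T * r) \<omega> - a * l) * (?v * T powr H)"
    by (simp add: n_def algebra_simps)
  then have "\<bar>X (T * r) \<omega> - a * ?v * n\<bar> = \<bar>unit (T * r) \<omega> - a * l\<bar> * (?v * T powr H)"
    using v V r T by (simp add: abs_mult)
  also have "\<dots> \<le> (2 * e' * l) * (?v * T powr H)"
    using a v unfolding T_def by (intro mult_right_mono close Q) auto
  also have "\<dots> = (2 * e' * ?v) * n" by (simp add: n_def)
  also have "\<dots> \<le> \<epsilon> * n" using small l by (intro mult_right_mono) (auto simp: n_def)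
  finally have "\<bar>iterate b \<omega> u - a * ?v * n\<bar> \<le> 2 * \<epsilon> * n" using 1 by linarith
  moreover have "n = normalizer u"
    using normalization_eq[of u] L by (simp add: n_def T_def l_def)
  ultimately show ?thesis by simp
qed

text \<open>Fine times differ by factors of at least \<open>exp ((1 - H) * m powr \<delta>)\<close>,
  and coarse times by the \<open>H\<close>-th power of this up to a factor 2 from the iterated
  logarithms. On the logarithmic scale a fine and a coarse time are at least
  \<open>(1 - H)\<^sup>2 * m powr (1 + \<delta>)\<close> apart, up to the constants \<open>b\<close>
  and \<open>r\<close>. The rate \<open>H * (1 - H)\<^sup>2\<close> is below all three, and
  \<open>2 + b / r\<close> collects the prefactors.\<close>

lemma block_covariance_le:
  assumes b: "0 < b" and r: "0 < r" and \<delta>: "0 < \<delta>" and m: "2 \<le> m" "1 \<le> ln (real m)"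
  defines "u \<equiv> block_time H \<delta> m" and "\<xi> \<equiv> (2 + b / r) * exp (- (H * (1 - H)\<^sup>2 * real m powr \<delta>))"
  assumes \<xi>: "\<xi> \<le> 1" and ij: "i < m" "j < m"
  shows "\<bar>cross (unit (u i * b)) (unit (scale_at (u j) * r))\<bar> \<le> C / V * \<xi> powr \<eta>"
    "i \<noteq> j \<Longrightarrow> \<bar>cross (unit (u i * b)) (unit (u j * b))\<bar> \<le> C / V * \<xi> powr \<eta>"
    "i \<noteq> j \<Longrightarrow> \<bar>cross (unit (scale_at (u i) * r)) (unit (scale_at (u j) * r))\<bar> \<le> C / V * \<xi> powr \<eta>"
proof -
  let ?A = "block_log H \<delta> m"
  let ?md = "real m powr \<delta>"
  let ?c = "H * (1 - H)\<^sup>2"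
  note Ab = block_log_bounds[OF H \<delta> m(1)]
  note Lb = loglog_block_time_bounds[OF H \<delta> m(1)]
  have u0: "0 < u k" for k by (simp add: u_def block_time_def)
  have mln: "ln 2 \<le> (1 + \<delta>) * ln (real m)" "1 \<le> (1 + \<delta>) * ln (real m)"
  proof -
    have "1 * 1 \<le> (1 + \<delta>) * ln (real m)" using \<delta> m by (intro mult_mono) auto
    then show "1 \<le> (1 + \<delta>) * ln (real m)" by simp
    then show "ln 2 \<le> (1 + \<delta>) * ln (real m)" using ln_2_less_1 by linarith
  qed
  have L1: "2 \<le> loglog (u k)" if "k < m" for k using Lb(1)[OF that] mln unfolding u_def by linarith
  \<comment> \<open>The factor 4 is generous; its square root is the 2 in
    \<open>\<xi>\<close>.\<close>
  have L_le: "loglog (u k) \<le> 4 * loglog (u k')" if "k < m" "k' < m" for k k'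
    using Lb(2)[OF that(1)] Lb(1)[OF that(2)] mln unfolding u_def by linarith
  have T0: "0 < scale_at (u k)" if "k < m" for k
    using L1[OF that] u0[of k] unfolding scale_at_def by (intro mult_pos_pos) auto
  have md: "0 \<le> ?md" by simp
  have c_le: "?c \<le> 1 - H" "?c \<le> H * (1 - H)" "?c \<le> (1 - H)\<^sup>2"
  proof -
    have 1: "(1 - H)\<^sup>2 \<le> (1 - H) * 1" unfolding power2_eq_square using H by (intro mult_left_mono) auto
    then show "?c \<le> H * (1 - H)" using H by (intro mult_left_mono) auto
    show "?c \<le> (1 - H)\<^sup>2" using H by (intro mult_left_le_one_le) auto
    also have "\<dots> \<le> 1 - H" using 1 by simp
    finally show "?c \<le> 1 - H" .
  qed
  have exp_le: "exp (- (d * ?md)) \<le> exp (- (?c * ?md))" if "?c \<le> d" for d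
    using that by (auto intro: mult_right_mono)
  have \<xi>0: "2 * exp (- (?c * ?md)) \<le> \<xi>" "b / r * exp (- (?c * ?md)) \<le> \<xi>"
    using b r by (auto simp: \<xi>_def distrib_right)
  have u_ratio: "u k' \<le> exp (- ((1 - H) * ?md)) * u k" if "k < k'" for k k'
  proof -
    have "(1 - H) * ?md * 1 \<le> (1 - H) * ?md * (real k' - real k)"
      using that H by (intro mult_left_mono) auto
    then have "?A k + (1 - H) * ?md \<le> ?A k'" by (simp add: block_log_def algebra_simps)
    then show ?thesis by (simp add: u_def block_time_def exp_add[symmetric])
  qed
  have PP: "\<bar>cross (unit (u k' * b)) (unit (u k * b))\<bar> \<le> C / V * \<xi> powr \<eta>" if "k < k'" for k k'
  proof (rule unit_covariance_le)
    have "exp (- ((1 - H) * ?md)) \<le> exp (- (?c * ?md))" by (rule exp_le[OF c_le(1)])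
    also have "\<dots> \<le> 2 * exp (- (?c * ?md))" by simp
    finally have "exp (- ((1 - H) * ?md)) \<le> \<xi>" using \<xi>0(1) by linarith
    then have "u k' \<le> \<xi> * u k" using u_ratio[OF that] u0[of k] by (meson less_imp_le mult_right_mono order_trans)
    then show "u k' * b \<le> \<xi> * (u k * b)" using b by (simp add: mult_right_mono mult.assoc[symmetric])
  qed (use u0 b \<xi> in auto)
  have QQ: "\<bar>cross (unit (scale_at (u k') * r)) (unit (scale_at (u k) * r))\<bar> \<le> C / V * \<xi> powr \<eta>"
    if "k < k'" "k' < m" for k k'
  proof (rule unit_covariance_le)
    have k: "k < m" using that by simp
    have "u k' powr H \<le> (exp (- ((1 - H) * ?md)) * u k) powr H"
      using u_ratio[OF that(1)] u0 H by (intro powr_mono2) (auto intro: less_imp_le)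
    also have "\<dots> = exp (- ((H * (1 - H)) * ?md)) * u k powr H"
      by (simp add: powr_mult powr_def[of "exp _"] mult.assoc)
    finally have 1: "u k' powr H \<le> exp (- ((H * (1 - H)) * ?md)) * u k powr H" .
    have "sqrt (loglog (u k')) \<le> sqrt (4 * loglog (u k))" using L_le[OF that(2) k] by simp
    also have "\<dots> = 2 * sqrt (loglog (u k))" by (simp add: real_sqrt_mult)
    finally have 2: "sqrt (loglog (u k')) \<le> 2 * sqrt (loglog (u k))" .
    have "scale_at (u k') \<le> (exp (- ((H * (1 - H)) * ?md)) * u k powr H) * (2 * sqrt (loglog (u k)))"
      unfolding scale_at_def using 1 2 L1[OF that(2)] by (intro mult_mono) auto
    also have "\<dots> = 2 * exp (- ((H * (1 - H)) * ?md)) * scale_at (u k)" by (simp add: scale_at_def)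
    also have "\<dots> \<le> \<xi> * scale_at (u k)"
    proof (rule mult_right_mono)
      show "2 * exp (- (H * (1 - H) * ?md)) \<le> \<xi>" using \<xi>0(1) exp_le[OF c_le(2)] by linarith
    qed (use T0[OF k] in simp)
    finally show "scale_at (u k') * r \<le> \<xi> * (scale_at (u k) * r)" using r by (simp add: mult_right_mono mult.assoc[symmetric])
  qed (use T0 that r \<xi> in auto)
  have sym: "cross f g = cross g f" for f g :: "'a \<Rightarrow> real"
    by (simp add: mult.commute)
  show "\<bar>cross (unit (u i * b)) (unit (u j * b))\<bar> \<le> C / V * \<xi> powr \<eta>" if "i \<noteq> j"
    using PP[of i j] PP[of j i] that sym[of "unit (u i * b)"] by (cases "i < j") auto
  show "\<bar>cross (unit (scale_at (u i) * r)) (unit (scale_at (u j) * r))\<bar> \<le> C / V * \<xi> powr \<eta>" if "i \<noteq> j"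
    using QQ[of i j] QQ[of j i] ij that sym[of "unit (scale_at (u i) * r)"] by (cases "i < j") auto
  show "\<bar>cross (unit (u i * b)) (unit (scale_at (u j) * r))\<bar> \<le> C / V * \<xi> powr \<eta>"
  proof (rule unit_covariance_le)
    let ?T = "real m powr (1 + \<delta>)"
    have "?md \<le> ?T" using m by (intro powr_mono) auto
    then have "(1 - H)\<^sup>2 * ?md \<le> (1 - H)\<^sup>2 * ?T" by (intro mult_left_mono) auto
    moreover have "H * ?A j \<le> H * ((2 - H) * ?T)" using Ab(2)[OF ij(2)] H by (intro mult_left_mono) auto
    \<comment> \<open>The strict gap \<open>H * (2 - H) = 1 - (1 - H)\<^sup>2\<close> that separates
      fine from coarse times; it is also why the logarithms of a block range over
      \<open>[1, 2 - H]\<close> in units of \<open>?T\<close>.\<close>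
    moreover have "(1 - H)\<^sup>2 * ?T + H * ((2 - H) * ?T) = ?T" by (simp add: power2_eq_square algebra_simps)
    ultimately have "(1 - H)\<^sup>2 * ?md + H * ?A j \<le> ?A i" using Ab(1)[OF ij(1)] by linarith
    then have "u i \<le> exp (- ((1 - H)\<^sup>2 * ?md)) * u j powr H"
      by (simp add: u_def block_time_def powr_def exp_add[symmetric] mult.commute)
    also have "\<dots> \<le> exp (- (?c * ?md)) * scale_at (u j)"
      unfolding scale_at_def using L1[OF ij(2)] exp_le[OF c_le(3)]
      by (intro mult_mono) (auto intro: mult_left_mono[of 1 _ "_ powr _", simplified])
    finally have "u i * b \<le> (b / r * exp (- (?c * ?md))) * (scale_at (u j) * r)"
      using b r by (simp add: mult.commute mult.left_commute mult_left_mono)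
    also have "\<dots> \<le> \<xi> * (scale_at (u j) * r)"
      using \<xi>0(2) T0[OF ij(2)] r by (intro mult_right_mono) auto
    finally show "u i * b \<le> \<xi> * (scale_at (u j) * r)" .
  qed (use u0 b T0 ij r \<xi> in auto)
qed

end

text \<open>\<open>B m\<close> is the squared level. Since
  \<open>exp (B m / 2) = m powr (1 - \<delta>)\<close>, the diagonal term is
  \<open>m powr (- \<mu>)\<close> up to a factor tending to 1, and the correlations are harmless as
  soon as \<open>B m * \<rho> m\<close> tends to 0.\<close>

lemma block_prob_bound_tendsto_1:
  fixes \<delta> \<epsilon> :: real and \<rho> :: "nat \<Rightarrow> real"
  assumes \<delta>: "0 < \<delta>" "\<delta> < 1" and \<epsilon>: "0 < \<epsilon>" "\<epsilon> \<le> \<delta> / 4"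
    and x: "(\<lambda>m. (2 * (1 - \<delta>) * ln (real m)) * \<rho> m) \<longlonglongrightarrow> 0"
  defines "B \<equiv> \<lambda>m::nat. 2 * (1 - \<delta>) * ln (real m)"
  defines "A \<equiv> \<lambda>m. exp (- B m * \<rho> m) - 4 * exp (B m * (2 * \<rho> m - \<epsilon>\<^sup>2 / 2))"
  shows "A \<longlonglongrightarrow> 1"
    "(\<lambda>m. (A m)\<^sup>2 / (exp (6 * B m * \<rho> m) + exp (B m * (1/2 + 2 * \<epsilon> + \<rho> m)) / real m)) \<longlonglongrightarrow> 1"
proof -
  have x: "(\<lambda>m. B m * \<rho> m) \<longlonglongrightarrow> 0" using x by (simp add: B_def)
  have lim: "(\<lambda>m. exp (- (B m * \<epsilon>\<^sup>2 / 2))) \<longlonglongrightarrow> 0"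
    unfolding B_def using \<delta> \<epsilon> by real_asymp
  have e1: "exp (B m * (2 * \<rho> m - \<epsilon>\<^sup>2 / 2)) = exp (2 * (B m * \<rho> m)) * exp (- (B m * \<epsilon>\<^sup>2 / 2))" for m
    by (simp add: exp_add[symmetric] algebra_simps)
  have "(\<lambda>m. exp (- (B m * \<rho> m)) - 4 * (exp (2 * (B m * \<rho> m)) * exp (- (B m * \<epsilon>\<^sup>2 / 2)))) \<longlonglongrightarrow> exp (- 0) - 4 * (exp (2 * 0) * 0)"
    by (intro tendsto_intros x lim)
  then show A: "A \<longlonglongrightarrow> 1" unfolding A_def e1 by simp
  \<comment> \<open>Positive because \<open>4 * \<epsilon> \<le> \<delta>\<close> gives \<open>(1 -
    \<delta>) * (1 + 4 * \<epsilon>) \<le> 1 - \<delta>\<^sup>2\<close>.\<close>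
  define \<mu> where "\<mu> = 1 - (1 - \<delta>) * (1 + 4 * \<epsilon>)"
  have "(1 - \<delta>) * (1 + 4 * \<epsilon>) \<le> (1 - \<delta>) * (1 + \<delta>)" using \<delta> \<epsilon> by (intro mult_left_mono) auto
  also have "\<dots> = 1 - \<delta>\<^sup>2" by (simp add: power2_eq_square algebra_simps)
  finally have \<mu>: "0 < \<mu>" using \<delta> by (simp add: \<mu>_def) (smt (verit) zero_less_power)
  have "(\<lambda>m. exp (B m * \<rho> m) * real m powr (- \<mu>)) \<longlonglongrightarrow> exp 0 * 0"
    using \<mu> by (intro tendsto_intros x) real_asymp
  moreover have "\<forall>\<^sub>F m in sequentially. exp (B m * \<rho> m) * real m powr (- \<mu>) = exp (B m * (1/2 + 2 * \<epsilon> + \<rho> m)) / real m"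
    using eventually_gt_at_top[of 0]
  proof eventually_elim
    case (elim m)
    have "exp (B m * (1/2 + 2 * \<epsilon> + \<rho> m)) / real m = exp (B m * (1/2 + 2 * \<epsilon> + \<rho> m)) / exp (ln (real m))" using elim by simp
    also have "\<dots> = exp (B m * \<rho> m + (- \<mu>) * ln (real m))"
      unfolding exp_diff[symmetric] by (simp add: B_def \<mu>_def algebra_simps)
    also have "\<dots> = exp (B m * \<rho> m) * real m powr (- \<mu>)" using elim by (simp only: exp_add) (simp add: powr_def)
    finally show ?case by simp
  qed
  ultimately have "(\<lambda>m. exp (B m * (1/2 + 2 * \<epsilon> + \<rho> m)) / real m) \<longlonglongrightarrow> 0"
    by (subst tendsto_cong[symmetric]) auto
  moreover have "(\<lambda>m. exp (6 * (B m * \<rho> m))) \<longlonglongrightarrow> exp (6 * 0)" by (intro tendsto_intros x)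
  ultimately have "(\<lambda>m. (A m)\<^sup>2 / (exp (6 * (B m * \<rho> m)) + exp (B m * (1/2 + 2 * \<epsilon> + \<rho> m)) / real m)) \<longlonglongrightarrow> 1\<^sup>2 / (exp (6 * 0) + 0)"
    by (intro tendsto_divide tendsto_power A tendsto_add) auto
  then show "(\<lambda>m. (A m)\<^sup>2 / (exp (6 * B m * \<rho> m) + exp (B m * (1/2 + 2 * \<epsilon> + \<rho> m)) / real m)) \<longlonglongrightarrow> 1"
    by (simp add: mult.assoc)
qed

section \<open>Recurrence of hits\<close>

context self_similar_gaussian
begin

text \<open>\<open>(r / x0, a)\<close> lies on the unit circle and is the direction for the second
  moment bound. A hit at one of the \<open>m\<close> times of a block, outside the exceptional sets
  of the modulus, puts the normalised iterate within \<open>\<epsilon>\<close> of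
  \<open>a * (sqrt V * r powr H)\<close>.\<close>

theorem iterated_lower:
  assumes b: "0 < b" and r: "0 < r" "r < sqrt V * b powr H"
    and a: "a\<^sup>2 = 1 - r\<^sup>2 / (V * b powr (2 * H))" and \<epsilon>: "0 < \<epsilon>"
  shows "AE \<omega> in M. \<exists>\<^sub>F u in at_right 0.
    \<bar>iterate b \<omega> u - a * (sqrt V * r powr H) * normalizer u\<bar>
      \<le> \<epsilon> * normalizer u"
proof -
  define x0 where "x0 = sqrt V * b powr H"
  have x0: "0 < x0" using V b by (simp add: x0_def)
  have x0_sq: "x0\<^sup>2 = V * b powr (2 * H)"
    unfolding x0_def by (rule sqrt_V_powr_sq)
  have a1: "r / x0 \<le> 1" "(r / x0)\<^sup>2 + a\<^sup>2 = 1"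
    using r x0 by (simp_all add: x0_def[symmetric] a x0_sq[symmetric] power_divide)
  then have "a\<^sup>2 \<le> 1" using zero_le_power2[of "r / x0"] by linarith
  then have a2: "\<bar>a\<bar> \<le> 1" by (simp add: abs_square_le_1)
  define v where "v = sqrt V * r powr H"
  have v: "0 < v" using V r by (simp add: v_def)
  have R: "0 < r + 1" and \<epsilon>2: "0 < \<epsilon> / 2" using r \<epsilon> by auto
  obtain \<delta>1 K where \<delta>1: "0 < \<delta>1" "0 \<le> K" and mod: "\<And>l L. 0 < l \<Longrightarrow> 1 \<le> L \<Longrightarrow>
    \<exists>A\<in>events. prob A \<le> K * exp (- L) \<and> (\<forall>\<omega>\<in>space M - A. modulus_le (r+1) \<delta>1 (\<epsilon> / 2) l L \<omega>)"
    by (rule modulus[OF R \<epsilon>2]) blast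
  \<comment> \<open>The exceptional set is turned into a function of scale and level, so that those
    of all \<open>m\<close> scales of a block can be removed together.\<close>
  define bad where "bad l L A \<longleftrightarrow> A \<in> events \<and> prob A \<le> K * exp (- L) \<and>
    (\<forall>\<omega>\<in>space M - A. modulus_le (r+1) \<delta>1 (\<epsilon> / 2) l L \<omega>)" for l L A
  define Bad where "Bad l L = (SOME A. bad l L A)" for l L
  have bad: "bad l L (Bad l L)" if "0 < l" "1 \<le> L" for l L
    unfolding Bad_def by (rule someI_ex) (use mod[OF that] in \<open>auto simp: bad_def\<close>)
  have Bad: "Bad l L \<in> events" "prob (Bad l L) \<le> K * exp (- L)"
    "\<omega> \<in> space M - Bad l L \<Longrightarrow> modulus_le (r+1) \<delta>1 (\<epsilon> / 2) l L \<omega>"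
    if "0 < l" "1 \<le> L" for l L \<omega>
    using bad[OF that] by (simp_all add: bad_def)
  define \<delta>2 where "\<delta>2 = min \<delta>1 1"
  define e where "e = min (1/2) (min (\<delta>2 / (2 * x0)) (\<epsilon> / (4 * v)))"
  have "0 < \<delta>2 / (2 * x0)" "0 < \<epsilon> / (4 * v)" using \<delta>1 x0 \<epsilon> v by (auto simp: \<delta>2_def)
  then have e: "0 < e" "e \<le> 1/2" "e \<le> \<delta>2 / (2 * x0)" "e \<le> \<epsilon> / (4 * v)" by (auto simp: e_def)
  have small: "2 * e * x0 \<le> \<delta>2" "\<delta>2 \<le> 1" "2 * e * v \<le> \<epsilon> / 2"
    using e x0 v by (auto simp: \<delta>2_def pos_le_divide_eq mult_ac)
  \<comment> \<open>Gives \<open>(1 - e)\<^sup>2 * (1 + \<delta>) < 1 - \<delta>\<close>. Hence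
    \<open>B m\<close>, about \<open>2 * (1 - \<delta>) * ln m\<close>, eventually exceeds
    \<open>(1 - e)\<^sup>2 * L m j\<close>, where \<open>L m j\<close> is about
    \<open>2 * (1 + \<delta>) * ln m\<close>.\<close>
  define \<delta> where "\<delta> = e / 4"
  have \<delta>: "0 < \<delta>" "\<delta> < 1" using e by (auto simp: \<delta>_def)
  define \<epsilon>1 where "\<epsilon>1 = \<delta> / 4"
  have \<epsilon>1: "0 < \<epsilon>1" "\<epsilon>1 \<le> \<delta> / 4" "\<epsilon>1 \<le> 1" "\<epsilon>1 \<le> e" using \<delta> e by (auto simp: \<epsilon>1_def \<delta>_def)
  define u where "u m j = block_time H \<delta> m j" for m j
  define L where "L m j = loglog (u m j)" for m j
  define T where "T m j = scale_at (u m j)" for m j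
  define \<xi> where "\<xi> m = (2 + b / r) * exp (- (H * (1 - H)\<^sup>2 * real m powr \<delta>))" for m :: nat
  define \<rho> where "\<rho> m = C / V * \<xi> m powr \<eta>" for m
  define B where "B m = 2 * (1 - \<delta>) * ln (real m)" for m :: nat
  define A where "A m = exp (- B m * \<rho> m) - 4 * exp (B m * (2 * \<rho> m - \<epsilon>1\<^sup>2 / 2))" for m
  define lb where "lb m = (A m)\<^sup>2 / (exp (6 * B m * \<rho> m) + exp (B m * (1/2 + 2 * \<epsilon>1 + \<rho> m)) / real m)" for m
  have x: "(\<lambda>m. (2 * (1 - \<delta>) * ln (real m)) * \<rho> m) \<longlonglongrightarrow> 0"
  proof -
    have c: "0 < H * (1 - H)\<^sup>2" using H by simp
    have D: "0 < 2 + b / r" using b r by (simp add: add_pos_pos)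
    have "(\<lambda>m::nat. (2 * (1 - \<delta>) * ln (real m)) * (C / V * ((2 + b / r) powr \<eta> * exp (- (H * (1 - H)\<^sup>2 * \<eta> * real m powr \<delta>))))) \<longlonglongrightarrow> 0"
    proof -
      define c' k where "c' = H * (1 - H)\<^sup>2 * \<eta>" and "k = C / V * (2 + b / r) powr \<eta>"
      have "0 < c'" using c \<eta> by (simp add: c'_def)
      then have "(\<lambda>m::nat. (2 * (1 - \<delta>) * k) * (ln (real m) * exp (- (c' * real m powr \<delta>)))) \<longlonglongrightarrow> (2 * (1 - \<delta>) * k) * 0"
        using \<delta> by (intro tendsto_mult tendsto_const) real_asymp
      then show ?thesis unfolding c'_def k_def by (simp add: mult_ac)
    qed
    moreover have "\<xi> m powr \<eta> = (2 + b / r) powr \<eta> * exp (- (H * (1 - H)\<^sup>2 * \<eta> * real m powr \<delta>))" for m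
      unfolding \<xi>_def powr_mult by (simp add: powr_def[of "exp _"] mult_ac)
    ultimately show ?thesis by (simp add: \<rho>_def)
  qed
  note lims = block_prob_bound_tendsto_1[OF \<delta> \<epsilon>1(1,2) x, folded B_def, folded A_def, folded lb_def]
  define good where "good m \<longleftrightarrow> 2 \<le> m \<and> 1 \<le> ln (real m) \<and> \<xi> m \<le> 1 \<and> 0 < A m
    \<and> (1 - e)\<^sup>2 * (2 * ((1 + \<delta>) * ln (real m)) + 2 * ln 2) \<le> B m" for m
  have ev_good: "\<forall>\<^sub>F m in sequentially. good m"
    unfolding good_def
  proof (intro eventually_conj)
    show "\<forall>\<^sub>F m::nat in sequentially. 2 \<le> m" by (rule eventually_ge_at_top)
    have ln_top: "filterlim (\<lambda>m::nat. ln (real m)) at_top sequentially" by real_asymp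
    then show "\<forall>\<^sub>F m::nat in sequentially. 1 \<le> ln (real m)" by (simp add: filterlim_at_top)
    have "(\<lambda>m::nat. exp (- (c * real m powr \<delta>))) \<longlonglongrightarrow> 0" if "0 < c" for c
      using \<delta> that by real_asymp
    from this[of "H * (1 - H)\<^sup>2"] have "\<xi> \<longlonglongrightarrow> (2 + b / r) * 0"
      unfolding \<xi>_def[abs_def] using H by (intro tendsto_mult tendsto_const) auto
    then have "\<forall>\<^sub>F m in sequentially. \<xi> m < 1" by (intro order_tendstoD(2)) auto
    then show "\<forall>\<^sub>F m in sequentially. \<xi> m \<le> 1" by eventually_elim simp
    show "\<forall>\<^sub>F m in sequentially. 0 < A m" using lims(1) by (rule order_tendstoD(1)) simp
    define \<kappa>' where "\<kappa>' = (1 - \<delta>) - (1 - e)\<^sup>2 * (1 + \<delta>)"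
    have "(1 - e)\<^sup>2 \<le> (1 - e) * 1" unfolding power2_eq_square using e by (intro mult_left_mono) auto
    then have "(1 - e)\<^sup>2 * (1 + \<delta>) \<le> (1 - e) * (1 + \<delta>)" using \<delta> by (intro mult_right_mono) auto
    also have "\<dots> = 1 - 3 * \<delta> - e * \<delta>" by (simp add: \<delta>_def field_simps)
    also have "\<dots> < 1 - \<delta>" using e \<delta> mult_pos_pos[OF e(1) \<delta>(1)] by linarith
    finally have \<kappa>': "0 < \<kappa>'" by (simp add: \<kappa>'_def)
    have "\<forall>\<^sub>F m::nat in sequentially. (1 - e)\<^sup>2 * ln 2 / \<kappa>' \<le> ln (real m)" using ln_top by (simp add: filterlim_at_top)
    then show "\<forall>\<^sub>F m::nat in sequentially. (1 - e)\<^sup>2 * (2 * ((1 + \<delta>) * ln (real m)) + 2 * ln 2) \<le> B m"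
    proof eventually_elim
      case (elim m)
      then have "(1 - e)\<^sup>2 * ln 2 \<le> ln (real m) * \<kappa>'" using \<kappa>' by (simp add: pos_divide_le_eq)
      then show ?case by (simp add: B_def \<kappa>'_def algebra_simps)
    qed
  qed
  have good_L: "1 \<le> L m j" "0 < T m j" "exp (- L m j) \<le> exp (- (2 * ((1 + \<delta>) * ln (real m))))"
    "(1 - e) * sqrt (L m j) \<le> sqrt (B m)" "sqrt (B m) \<le> sqrt (L m j)"
    if m: "good m" and j: "j < m" for m j
  proof -
    have m2: "2 \<le> m" and ln1: "1 \<le> ln (real m)" and B: "(1 - e)\<^sup>2 * (2 * ((1 + \<delta>) * ln (real m)) + 2 * ln 2) \<le> B m"
      using m by (auto simp: good_def)
    note Lb = loglog_block_time_bounds[OF H \<delta>(1) m2 j, folded u_def, folded L_def]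
    have "1 * 1 \<le> (1 + \<delta>) * ln (real m)" using \<delta> ln1 by (intro mult_mono) auto
    then show L1: "1 \<le> L m j" using Lb(1) by linarith
    then show "0 < T m j" unfolding T_def scale_at_def L_def[symmetric] by (simp add: u_def block_time_def)
    show "exp (- L m j) \<le> exp (- (2 * ((1 + \<delta>) * ln (real m))))" using Lb(1) by simp
    have "(1 - e)\<^sup>2 * L m j \<le> B m" using Lb(2) B by (meson mult_left_mono order_trans zero_le_power2)
    then have "sqrt ((1 - e)\<^sup>2 * L m j) \<le> sqrt (B m)" by simp
    then show "(1 - e) * sqrt (L m j) \<le> sqrt (B m)" using e by (simp add: real_sqrt_mult)
    have "(1 - \<delta>) * ln (real m) \<le> (1 + \<delta>) * ln (real m)" using \<delta> ln1 by (intro mult_right_mono) auto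
    then have "B m \<le> L m j" using Lb(1) unfolding B_def mult.assoc by linarith
    then show "sqrt (B m) \<le> sqrt (L m j)" by simp
  qed
  have u0: "0 < u m j" for m j by (simp add: u_def block_time_def)
  define F where "F m = {\<omega>\<in>space M. \<exists>j<m. \<bar>unit (u m j * b) \<omega> - r / x0 * sqrt (B m)\<bar> \<le> \<epsilon>1 * sqrt (B m)
    \<and> \<bar>unit (T m j * r) \<omega> - a * sqrt (B m)\<bar> \<le> \<epsilon>1 * sqrt (B m)}" for m
  \<comment> \<open>The \<open>m\<close> exceptional sets have total probability at most
    \<open>m * K * m powr (- 2 * (1 + \<delta>))\<close>, which tends to 0. For the remaining
    \<open>m\<close> the empty set keeps \<open>G m\<close> measurable.\<close>
  define G where "G m = (if good m then F m - (\<Union>j<m. Bad (T m j) (L m j)) else {})" for m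
  have F: "F m \<in> events" if m: "good m" for m
  proof -
    have [measurable]: "unit (u m j * b) \<in> borel_measurable M" "unit (T m j * r) \<in> borel_measurable M" if "j < m" for j
      using u0[of m j] good_L(2)[OF m that] b r by (auto intro!: measurable_G unit_in_span)
    have "F m = (\<Union>j<m. {\<omega>\<in>space M. \<bar>unit (u m j * b) \<omega> - r / x0 * sqrt (B m)\<bar> \<le> \<epsilon>1 * sqrt (B m)
      \<and> \<bar>unit (T m j * r) \<omega> - a * sqrt (B m)\<bar> \<le> \<epsilon>1 * sqrt (B m)})" by (auto simp: F_def)
    also have "\<dots> \<in> events" by (intro sets.finite_UN) auto
    finally show ?thesis .
  qed
  have U: "(\<Union>j<m. Bad (T m j) (L m j)) \<in> events" if m: "good m" for m
    using good_L[OF m] by (intro sets.finite_UN) (auto intro: Bad)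
  have G: "G m \<in> events" for m using F U by (simp add: G_def)
  have PF: "lb m \<le> prob (F m)" if m: "good m" for m
  proof -
    have m2: "2 \<le> m" and ln1: "1 \<le> ln (real m)" and \<xi>1: "\<xi> m \<le> 1" and A0: "0 < A m"
      using m by (auto simp: good_def)
    note cov = block_covariance_le[OF b r(1) \<delta>(1) m2 ln1 \<xi>1[unfolded \<xi>_def], folded \<xi>_def u_def, folded \<rho>_def T_def]
    have B0: "0 < B m" using \<delta> ln1 by (simp add: B_def)
    then have B: "(sqrt (B m))\<^sup>2 = B m" by simp
    have "(A m)\<^sup>2 / (exp (6 * (sqrt (B m))\<^sup>2 * \<rho> m) + exp ((sqrt (B m))\<^sup>2 * (1/2 + 2 * \<epsilon>1 + \<rho> m)) / real m) \<le> prob (F m)"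
      unfolding F_def
    proof (rule prob_ex_near_ge)
      show "A m = exp (- (sqrt (B m))\<^sup>2 * \<rho> m) - 4 * exp ((sqrt (B m))\<^sup>2 * (2 * \<rho> m - \<epsilon>1\<^sup>2 / 2))"
        unfolding B A_def ..
    qed (use good_L(2)[OF m] u0 b r cov a1 \<epsilon>1 A0 m2 B0 in \<open>auto intro!: unit_in_span expectation_unit_sq less_imp_le\<close>)
    then show ?thesis unfolding B lb_def .
  qed
  have PG: "lb m - real m * (K * exp (- (2 * ((1 + \<delta>) * ln (real m))))) \<le> prob (G m)" if m: "good m" for m
  proof -
    have "prob (\<Union>j<m. Bad (T m j) (L m j)) \<le> (\<Sum>j<m. prob (Bad (T m j) (L m j)))"
      using good_L[OF m] Bad(1) by (intro finite_measure_subadditive_finite) auto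
    also have "\<dots> \<le> (\<Sum>j<m. K * exp (- (2 * ((1 + \<delta>) * ln (real m)))))"
    proof (rule sum_mono)
      fix j assume "j \<in> {..<m}"
      then have j: "j < m" by simp
      have "prob (Bad (T m j) (L m j)) \<le> K * exp (- L m j)" by (intro Bad good_L[OF m j])
      also have "\<dots> \<le> K * exp (- (2 * ((1 + \<delta>) * ln (real m))))" by (intro mult_left_mono good_L[OF m j] \<delta>1)
      finally show "prob (Bad (T m j) (L m j)) \<le> K * exp (- (2 * ((1 + \<delta>) * ln (real m))))" .
    qed
    also have "\<dots> = real m * (K * exp (- (2 * ((1 + \<delta>) * ln (real m)))))" by simp
    finally have bad: "prob (\<Union>j<m. Bad (T m j) (L m j)) \<le> real m * (K * exp (- (2 * ((1 + \<delta>) * ln (real m)))))" .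
    have "prob (F m) \<le> prob (G m \<union> (\<Union>j<m. Bad (T m j) (L m j)))"
      using m F U G by (intro finite_measure_mono) (auto simp: G_def)
    also have "\<dots> \<le> prob (G m) + prob (\<Union>j<m. Bad (T m j) (L m j))"
      using m U G by (intro measure_Un_le) auto
    finally show ?thesis using bad PF[OF m] by linarith
  qed
  have "(\<lambda>m. prob (G m)) \<longlonglongrightarrow> 1"
  proof (rule tendsto_sandwich)
    have "(\<lambda>m::nat. real m * exp (- (2 * ((1 + \<delta>) * ln (real m))))) \<longlonglongrightarrow> 0"
    proof -
      define k where "k = 1 + 2 * \<delta>"
      have "(\<lambda>m::nat. real m powr (- k)) \<longlonglongrightarrow> 0"
        using \<delta> by (intro tendsto_neg_powr filterlim_real_sequentially) (simp add: k_def)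
      moreover have "\<forall>\<^sub>F m::nat in sequentially. real m powr (- k) = real m * exp (- (2 * ((1 + \<delta>) * ln (real m))))"
        using eventually_gt_at_top[of 0]
      proof eventually_elim
        case (elim m)
        have "real m powr (- k) = exp (ln (real m) + (- (2 * ((1 + \<delta>) * ln (real m)))))"
          using elim by (simp add: powr_def k_def algebra_simps)
        then show ?case using elim by (simp only: exp_add) simp
      qed
      ultimately show ?thesis by (subst tendsto_cong[symmetric]) auto
    qed
    then have "(\<lambda>m::nat. lb m - K * (real m * exp (- (2 * ((1 + \<delta>) * ln (real m)))))) \<longlonglongrightarrow> 1 - K * 0"
      by (intro tendsto_diff tendsto_mult tendsto_const lims)
    then show "(\<lambda>m. lb m - real m * (K * exp (- (2 * ((1 + \<delta>) * ln (real m)))))) \<longlonglongrightarrow> 1" by (simp add: mult_ac)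
    show "\<forall>\<^sub>F m in sequentially. lb m - real m * (K * exp (- (2 * ((1 + \<delta>) * ln (real m))))) \<le> prob (G m)"
      using ev_good by eventually_elim (rule PG)
    show "\<forall>\<^sub>F m in sequentially. prob (G m) \<le> 1" by simp
  qed simp
  then have "AE \<omega> in M. \<exists>\<^sub>F m in sequentially. \<omega> \<in> G m" by (rule AE_frequently_of_prob_tendsto_1[OF G])
  then show ?thesis
  proof eventually_elim
    case (elim \<omega>)
    let ?Q = "\<lambda>u. \<bar>iterate b \<omega> u - a * (sqrt V * r powr H) * normalizer u\<bar> \<le> \<epsilon> * normalizer u"
    \<comment> \<open>The times of block \<open>m\<close> are at most \<open>exp (- m)\<close>, so
      successes in infinitely many blocks occur arbitrarily close to 0.\<close>
    have G_Q: "\<exists>u>0. u \<le> exp (- real m) \<and> ?Q u" if w: "\<omega> \<in> G m" for m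
    proof -
      have m: "good m" using w by (auto simp: G_def split: if_splits)
      then have m2: "2 \<le> m" by (simp add: good_def)
      obtain j where j: "j < m" and near: "\<bar>unit (u m j * b) \<omega> - r / x0 * sqrt (B m)\<bar> \<le> \<epsilon>1 * sqrt (B m)"
        "\<bar>unit (T m j * r) \<omega> - a * sqrt (B m)\<bar> \<le> \<epsilon>1 * sqrt (B m)" and nb: "\<omega> \<in> space M - Bad (T m j) (L m j)"
        using w m by (auto simp: G_def F_def)
      have md: "modulus_le (r+1) \<delta>2 (\<epsilon> / 2) (T m j) (L m j) \<omega>"
        using Bad(3)[OF good_L(2)[OF m j] good_L(1)[OF m j] nb] by (simp add: \<delta>2_def)
      have Lpos: "0 < loglog (u m j)" using good_L(1)[OF m j] by (simp add: L_def)
      have "\<bar>iterate b \<omega> (u m j) - a * (sqrt V * r powr H) * normalizer (u m j)\<bar> \<le> 2 * (\<epsilon> / 2) * normalizer (u m j)"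
        using good_L(4,5)[OF m j] \<epsilon>1 e small near md unfolding T_def L_def v_def
        by (intro near_point[OF b r(1) u0 Lpos x0_def, where \<beta> = "sqrt (B m)" and e = \<epsilon>1 and e' = e and \<delta> = \<delta>2] a1 a2) auto
      then have "?Q (u m j)" by simp
      moreover have "u m j \<le> exp (- real m)"
        using block_log_bounds(3)[OF H \<delta>(1) m2 j] by (simp add: u_def block_time_def)
      ultimately show ?thesis using u0 by blast
    qed
    show "\<exists>\<^sub>F u in at_right 0. ?Q u"
      unfolding frequently_def
    proof
      assume "\<forall>\<^sub>F u in at_right 0. \<not> ?Q u"
      then obtain d where d: "0 < d" "\<And>u. 0 < u \<Longrightarrow> u < d \<Longrightarrow> \<not> ?Q u"
        by (auto simp: eventually_at_right_field)
      have "(\<lambda>m::nat. exp (- real m)) \<longlonglongrightarrow> 0" by real_asymp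
      then have "\<forall>\<^sub>F m in sequentially. exp (- real m) < d" using d by (intro order_tendstoD(2)) auto
      then have "\<forall>\<^sub>F m in sequentially. \<omega> \<notin> G m"
        by eventually_elim (meson G_Q d(2) le_less_trans)
      with elim show False by (simp add: frequently_def)
    qed
  qed
qed

end

section \<open>The limit set\<close>

text \<open>Eventual boundedness gives compactness and confines the limits. Conversely, values near
  \<open>\<sigma>\<close> and near \<open>- \<sigma>\<close> recur arbitrarily close to 0, and the
  intermediate value theorem between them yields every point of the interval.\<close>

lemma oscillation_limit_set:
  fixes z :: "real \<Rightarrow> real"
  assumes c: "0 < c" and cont: "continuous_on {0<..<c} z"
    and up: "\<And>\<epsilon>. 0 < \<epsilon> \<Longrightarrow> \<forall>\<^sub>F u in at_right 0. \<bar>z u\<bar> \<le> \<sigma> + \<epsilon>"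
    and hi: "\<And>\<epsilon>. 0 < \<epsilon> \<Longrightarrow> \<exists>\<^sub>F u in at_right 0. \<sigma> - \<epsilon> \<le> z u"
    and lo: "\<And>\<epsilon>. 0 < \<epsilon> \<Longrightarrow> \<exists>\<^sub>F u in at_right 0. z u \<le> - \<sigma> + \<epsilon>"
  shows "relatively_compact_at_0 z" "limit_set_at_0 z = {- \<sigma>..\<sigma>}"
proof -
  show "relatively_compact_at_0 z"
    unfolding relatively_compact_at_0_def
  proof (intro allI impI)
    fix s :: "nat \<Rightarrow> real" assume s: "filterlim s (at_right 0) sequentially"
    from up[of 1] s have "\<forall>\<^sub>F n in sequentially. \<bar>z (s n)\<bar> \<le> \<sigma> + 1"
      by (auto simp: filterlim_iff)
    then obtain n0 where n0: "\<And>n. n0 \<le> n \<Longrightarrow> \<bar>z (s n)\<bar> \<le> \<sigma> + 1" by (auto simp: eventually_sequentially)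
    have "\<forall>n. z (s (n + n0)) \<in> {- (\<sigma> + 1)..\<sigma> + 1}" using n0 by (auto simp: abs_le_iff minus_le_iff)
    moreover have "seq_compact {- (\<sigma> + 1)..\<sigma> + 1}" by (simp add: compact_imp_seq_compact)
    ultimately obtain l r where r: "strict_mono r" "((\<lambda>n. z (s (n + n0))) \<circ> r) \<longlonglongrightarrow> l"
      by (elim seq_compactE)
    show "\<exists>r. strict_mono r \<and> convergent (\<lambda>n. z (s (r n)))"
    proof (intro exI conjI)
      show "strict_mono (\<lambda>n. r n + n0)" using r(1) by (simp add: strict_mono_def)
      show "convergent (\<lambda>n. z (s (r n + n0)))" using r(2) by (auto simp: convergent_def o_def)
    qed
  qed
  show "limit_set_at_0 z = {- \<sigma>..\<sigma>}"
  proof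
    show "limit_set_at_0 z \<subseteq> {- \<sigma>..\<sigma>}"
    proof
      fix l assume "l \<in> limit_set_at_0 z"
      then obtain s :: "nat \<Rightarrow> real" where s: "filterlim s (at_right 0) sequentially" and l: "(\<lambda>n. z (s n)) \<longlonglongrightarrow> l"
        by (auto simp: limit_set_at_0_def)
      have "\<bar>l\<bar> \<le> \<sigma> + \<epsilon>" if "0 < \<epsilon>" for \<epsilon>
      proof (rule tendsto_upperbound[OF tendsto_rabs[OF l] _ trivial_limit_sequentially])
        show "\<forall>\<^sub>F n in sequentially. \<bar>z (s n)\<bar> \<le> \<sigma> + \<epsilon>" using up[OF that] s by (auto simp: filterlim_iff)
      qed
      then have "\<bar>l\<bar> \<le> \<sigma>" by (rule field_le_epsilon)
      then show "l \<in> {- \<sigma>..\<sigma>}" by auto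
    qed
    show "{- \<sigma>..\<sigma>} \<subseteq> limit_set_at_0 z"
    proof
      fix l assume l: "l \<in> {- \<sigma>..\<sigma>}"
      have ex: "\<exists>u. 0 < u \<and> u < d \<and> \<bar>z u - l\<bar> \<le> d" if d: "0 < d" for d
      proof -
        \<comment> \<open>The minimum keeps both points inside the interval on which
          \<open>z\<close> is continuous.\<close>
        define d' where "d' = min c d"
        have d': "0 < d'" using c d by (simp add: d'_def)
        have freqD: "\<exists>u. 0 < u \<and> u < d' \<and> P u" if "\<exists>\<^sub>F u in at_right 0. P u" for P
          using that d' by (auto simp: frequently_def eventually_at_right_field)
        obtain p where p: "0 < p" "p < d'" "\<sigma> - d \<le> z p" using freqD[OF hi[OF d]] by auto
        obtain q where q: "0 < q" "q < d'" "z q \<le> - \<sigma> + d" using freqD[OF lo[OF d]] by auto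
        \<comment> \<open>If \<open>l\<close> exceeds \<open>z p\<close>, then
          \<open>\<sigma> - d \<le> z p < l \<le> \<sigma>\<close>, so \<open>p\<close> itself is
          close enough; symmetrically for \<open>q\<close>.\<close>
        consider "z p < l" | "l < z q" | "z q \<le> l" "l \<le> z p" by linarith
        then show ?thesis
        proof cases
          case 1 then show ?thesis using p l by (intro exI[of _ p]) (auto simp: d'_def)
        next
          case 2 then show ?thesis using q l by (intro exI[of _ q]) (auto simp: d'_def)
        next
          case 3
          have "connected (z ` {0<..<d'})"
            by (intro connected_continuous_image continuous_on_subset[OF cont]) (auto simp: d'_def)
          moreover have "z q \<in> z ` {0<..<d'}" "z p \<in> z ` {0<..<d'}" using p q by auto
          ultimately have "l \<in> z ` {0<..<d'}" using 3 by (rule connectedD_interval)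
          then show ?thesis using d by (auto simp: d'_def)
        qed
      qed
      have "\<exists>u. 0 < u \<and> u < 1 / real (Suc n) \<and> \<bar>z u - l\<bar> \<le> 1 / real (Suc n)" for n by (rule ex) simp
      then obtain s where s: "\<And>n. 0 < s n" "\<And>n. s n < 1 / real (Suc n)" "\<And>n. \<bar>z (s n) - l\<bar> \<le> 1 / real (Suc n)" by metis
      have inv: "(\<lambda>n. 1 / real (Suc n)) \<longlonglongrightarrow> 0" using LIMSEQ_inverse_real_of_nat by (simp add: inverse_eq_divide)
      have "s \<longlonglongrightarrow> 0" using s by (intro tendsto_sandwich[OF _ _ tendsto_const inv]) (auto intro!: always_eventually less_imp_le)
      then have "filterlim s (at_right 0) sequentially"
        unfolding filterlim_at using s(1) by (auto intro!: always_eventually simp: less_imp_neq[symmetric])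
      moreover have "(\<lambda>n. z (s n)) \<longlonglongrightarrow> l"
      proof (rule LIM_zero_cancel, rule tendsto_rabs_zero_cancel)
        show "(\<lambda>n. \<bar>z (s n) - l\<bar>) \<longlonglongrightarrow> 0"
          using s by (intro tendsto_sandwich[OF _ _ tendsto_const inv]) auto
      qed
      ultimately show "l \<in> limit_set_at_0 z" by (auto simp: limit_set_at_0_def)
    qed
  qed
qed

section \<open>The limit set of the normalised iterate\<close>

context self_similar_gaussian
begin

text \<open>The maximised function vanishes at both ends of its interval while the supremum is
  positive, so near-maximisers can be taken in the interior, as the lower bound demands. The sign of
  \<open>a\<close> selects the end of the limit set that is approached.\<close>

theorem iterated_limit_set:
  assumes b: "0 < b"
    and \<sigma>: "\<sigma> = (SUP r\<in>{0..sqrt V * b powr H}. sqrt V * r powr H * sqrt (1 - r\<^sup>2 / (V * b powr (2 * H))))"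
  shows "AE \<omega> in M. relatively_compact_at_0 (\<lambda>u. iterate b \<omega> u / normalizer u)
    \<and> limit_set_at_0 (\<lambda>u. iterate b \<omega> u / normalizer u) = {- \<sigma>..\<sigma>}"
proof -
  define x0 where "x0 = sqrt V * b powr H"
  define f where "f r = sqrt V * r powr H * sqrt (1 - r\<^sup>2 / (V * b powr (2 * H)))" for r
  have x0: "0 < x0" using V b by (simp add: x0_def)
  have x0_sq: "x0\<^sup>2 = V * b powr (2 * H)"
    unfolding x0_def by (rule sqrt_V_powr_sq)
  have f_le: "f r \<le> sqrt V * x0 powr H" if "r \<in> {0..x0}" for r
  proof -
    have "r\<^sup>2 \<le> x0\<^sup>2" using that by (intro power_mono) auto
    then have 1: "0 \<le> sqrt (1 - r\<^sup>2 / x0\<^sup>2)" using x0 by (simp add: divide_le_eq)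
    have "sqrt V * r powr H \<le> sqrt V * x0 powr H" using that V H by (intro mult_left_mono powr_mono2) auto
    then have "f r \<le> (sqrt V * x0 powr H) * 1"
      unfolding f_def x0_sq[symmetric] using V 1 by (intro mult_mono) auto
    then show ?thesis by simp
  qed
  then have bdd: "bdd_above (f ` {0..x0})" by (rule bdd_aboveI2)
  have \<sigma>_eq: "\<sigma> = (SUP r\<in>{0..x0}. f r)" by (simp add: \<sigma> f_def x0_def)
  have f_\<sigma>: "f r \<le> \<sigma>" if "0 \<le> r" "r \<le> x0" for r
    unfolding \<sigma>_eq using that bdd by (intro cSUP_upper) auto
  have "0 < f (x0 / 2)"
    using V x0 by (simp add: f_def x0_sq[symmetric] power_divide)
  then have \<sigma>_pos: "0 < \<sigma>" using f_\<sigma>[of "x0 / 2"] x0 by simp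
  \<comment> \<open>The maximum with 0 forces \<open>f r > 0\<close>, which rules out both endpoints
    even when \<open>\<epsilon>\<close> exceeds \<open>\<sigma>\<close>.\<close>
  have near: "\<exists>r. 0 < r \<and> r < x0 \<and> \<sigma> - \<epsilon> < f r" if "0 < \<epsilon>" for \<epsilon>
  proof -
    have "max 0 (\<sigma> - \<epsilon>) < (SUP r\<in>{0..x0}. f r)" using \<sigma>_pos that by (simp add: \<sigma>_eq[symmetric])
    then obtain r where r: "r \<in> {0..x0}" "max 0 (\<sigma> - \<epsilon>) < f r"
      using bdd x0 by (subst (asm) less_cSUP_iff) auto
    have "r \<noteq> 0" "r \<noteq> x0" using r(2) x0 by (auto simp: f_def x0_sq[symmetric])
    then show ?thesis using r by (intro exI[of _ r]) auto
  qed
  have upper: "AE \<omega> in M. \<forall>\<^sub>F u in at_right 0. \<bar>iterate b \<omega> u\<bar> \<le> (\<sigma> + \<epsilon>) * normalizer u" if "0 < \<epsilon>" for \<epsilon>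
    using f_\<sigma> by (intro iterated_upper b that) (simp add: f_def x0_def)
  have lower: "AE \<omega> in M. \<exists>\<^sub>F u in at_right 0. (\<sigma> - \<epsilon>) * normalizer u \<le> s * iterate b \<omega> u"
    if \<epsilon>: "0 < \<epsilon>" and s: "s = 1 \<or> s = -1" for \<epsilon> s
  proof -
    from near[of "\<epsilon> / 2"] \<epsilon> obtain r where r: "0 < r" "r < x0" "\<sigma> - \<epsilon> / 2 < f r" by auto
    define a where "a = s * sqrt (1 - r\<^sup>2 / (V * b powr (2 * H)))"
    have "r\<^sup>2 \<le> x0\<^sup>2" using r by (intro power_mono) auto
    then have "a\<^sup>2 = 1 - r\<^sup>2 / (V * b powr (2 * H))"
      unfolding a_def power_mult_distrib x0_sq[symmetric] using s x0 by auto
    from iterated_lower[OF b r(1) r(2)[unfolded x0_def] this, of "\<epsilon> / 2"] \<epsilon>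
    have "AE \<omega> in M. \<exists>\<^sub>F u in at_right 0. \<bar>iterate b \<omega> u - a * (sqrt V * r powr H) * normalizer u\<bar> \<le> (\<epsilon> / 2) * normalizer u" by simp
    then show ?thesis
    proof eventually_elim
      case (elim \<omega>)
      then show ?case
      proof (rule frequently_elim1)
        fix u assume u: "\<bar>iterate b \<omega> u - a * (sqrt V * r powr H) * normalizer u\<bar> \<le> (\<epsilon> / 2) * normalizer u"
        have a_f: "a * (sqrt V * r powr H) = s * f r" by (simp add: a_def f_def)
        have "(\<sigma> - \<epsilon>) * normalizer u \<le> (f r - \<epsilon> / 2) * normalizer u" using r by (intro mult_right_mono) auto
        also have "\<dots> = f r * normalizer u - (\<epsilon> / 2) * normalizer u" by (simp only: left_diff_distrib)
        also have "\<dots> \<le> s * iterate b \<omega> u"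
        proof -
          have "s * iterate b \<omega> u - f r * normalizer u = s * (iterate b \<omega> u - s * f r * normalizer u)"
            using s by (auto simp: algebra_simps)
          then have "\<bar>s * iterate b \<omega> u - f r * normalizer u\<bar> = \<bar>iterate b \<omega> u - s * f r * normalizer u\<bar>"
            using s by (auto simp: abs_mult)
          then show ?thesis using u unfolding a_f by linarith
        qed
        finally show "(\<sigma> - \<epsilon>) * normalizer u \<le> s * iterate b \<omega> u" .
      qed
    qed
  qed
  \<comment> \<open>Only countably many null sets may be collected, so \<open>\<epsilon>\<close>
    runs through the values \<open>1 / (k + 1)\<close>.\<close>
  have "AE \<omega> in M. \<forall>k::nat. (\<forall>\<^sub>F u in at_right 0. \<bar>iterate b \<omega> u\<bar> \<le> (\<sigma> + 1 / real (Suc k)) * normalizer u)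
    \<and> (\<exists>\<^sub>F u in at_right 0. (\<sigma> - 1 / real (Suc k)) * normalizer u \<le> 1 * iterate b \<omega> u)
    \<and> (\<exists>\<^sub>F u in at_right 0. (\<sigma> - 1 / real (Suc k)) * normalizer u \<le> -1 * iterate b \<omega> u)"
    unfolding AE_all_countable by (intro allI AE_conjI upper lower) auto
  then show ?thesis
    using AE_space
  proof eventually_elim
    case (elim \<omega>)
    define z where "z u = iterate b \<omega> u / normalizer u" for u
    have n_pos: "0 < loglog u" "0 < normalizer u" if "0 < u" "u < exp (-1)" for u
    proof -
      have "exp 1 < 1 / u" using that by (simp add: exp_minus field_simps)
      then have "ln (exp 1) < ln (1 / u)" using that by (subst ln_less_cancel_iff) auto
      then have "1 < ln (1 / u)" by simp
      then show "0 < loglog u" by (simp add: loglog_def)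
      then show "0 < normalizer u" using that by simp
    qed
    have ev_u: "\<forall>\<^sub>F u in at_right 0. 0 < u \<and> u < exp (-1 :: real)"
      unfolding eventually_at_right_field by (intro exI[of _ "exp (-1)"]) auto
    have small: "\<exists>k. 1 / real (Suc k) < \<epsilon>" if "0 < \<epsilon>" for \<epsilon> :: real
      using reals_Archimedean[OF that] by (simp add: inverse_eq_divide)
    have z_cont: "continuous_on {0<..<exp (-1)} z"
    proof -
      have X_cont: "continuous_on S (\<lambda>u. X (g u) \<omega>)" if "continuous_on S g" "\<And>u. u \<in> S \<Longrightarrow> 0 \<le> g u" for S g
        using that by (intro continuous_on_compose2[OF cont[OF elim(2)]]) auto
      have ln_pos: "0 < ln (1 / u)" if "0 < u" "u < exp (-1)" for u :: real
      proof -
        have "u < 1" using that by (meson exp_le_one_iff less_le_trans neg_le_0_iff_le zero_le_one)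
        then show ?thesis using that by (intro ln_gt_zero) auto
      qed
      show ?thesis
        unfolding z_def loglog_def using b n_pos ln_pos
        by (intro continuous_on_divide X_cont continuous_intros) (auto simp: loglog_def less_imp_neq[symmetric])
    qed
    have osc: "(\<forall>\<^sub>F u in at_right 0. \<bar>z u\<bar> \<le> \<sigma> + \<epsilon>) \<and> (\<exists>\<^sub>F u in at_right 0. \<sigma> - \<epsilon> \<le> z u)
      \<and> (\<exists>\<^sub>F u in at_right 0. z u \<le> - \<sigma> + \<epsilon>)" if pos: "0 < \<epsilon>" for \<epsilon>
    proof (intro conjI)
      obtain k where k: "1 / real (Suc k) < \<epsilon>" using small[OF pos] by blast
      let ?k = "1 / real (Suc k)"
      have e: "\<forall>\<^sub>F u in at_right 0. \<bar>iterate b \<omega> u\<bar> \<le> (\<sigma> + ?k) * normalizer u"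
        "\<exists>\<^sub>F u in at_right 0. (\<sigma> - ?k) * normalizer u \<le> 1 * iterate b \<omega> u"
        "\<exists>\<^sub>F u in at_right 0. (\<sigma> - ?k) * normalizer u \<le> -1 * iterate b \<omega> u"
        using elim(1) by blast+
      show "\<forall>\<^sub>F u in at_right 0. \<bar>z u\<bar> \<le> \<sigma> + \<epsilon>"
        using e(1) ev_u
      proof eventually_elim
        case (elim u)
        have "\<bar>z u\<bar> = \<bar>iterate b \<omega> u\<bar> / normalizer u" using n_pos[of u] elim unfolding z_def abs_divide by simp
        also have "\<dots> \<le> \<sigma> + ?k" using n_pos[of u] elim by (subst pos_divide_le_eq) auto
        finally show ?case using k by linarith
      qed
      show "\<exists>\<^sub>F u in at_right 0. \<sigma> - \<epsilon> \<le> z u"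
      proof (rule frequently_mp[OF _ e(2)], use ev_u in eventually_elim, intro impI)
        fix u assume u: "0 < u \<and> u < exp (-1 :: real)" "(\<sigma> - ?k) * normalizer u \<le> 1 * iterate b \<omega> u"
        then have "\<sigma> - ?k \<le> z u" unfolding z_def using n_pos[of u] by (subst pos_le_divide_eq) auto
        then show "\<sigma> - \<epsilon> \<le> z u" using k by linarith
      qed
      show "\<exists>\<^sub>F u in at_right 0. z u \<le> - \<sigma> + \<epsilon>"
      proof (rule frequently_mp[OF _ e(3)], use ev_u in eventually_elim, intro impI)
        fix u assume u: "0 < u \<and> u < exp (-1 :: real)" "(\<sigma> - ?k) * normalizer u \<le> -1 * iterate b \<omega> u"
        then have "z u \<le> - (\<sigma> - ?k)" unfolding z_def using n_pos[of u] by (subst pos_divide_le_eq) (auto simp only: minus_mult_left[symmetric])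
        then show "z u \<le> - \<sigma> + \<epsilon>" using k by linarith
      qed
    qed
    have "relatively_compact_at_0 z \<and> limit_set_at_0 z = {- \<sigma>..\<sigma>}"
      using osc by (intro conjI oscillation_limit_set[OF _ z_cont, of \<sigma>]) auto
    then show ?case by (simp add: z_def[abs_def])
  qed
qed

end

section \<open>Application to generalized fractional Brownian motion\<close>

theorem theorem6p2:
  fixes N :: "'b measure" and B :: "real set \<Rightarrow> 'b \<Rightarrow> real"
    and M :: "'a measure" and X :: "real \<Rightarrow> 'a \<Rightarrow> real"
    and \<alpha> \<gamma> H b \<sigma> :: real and \<Psi> :: "real \<Rightarrow> real \<Rightarrow> real"
  assumes "0 \<le> \<gamma>" and "\<gamma> < 1"
    and "- (1/2) + \<gamma>/2 < \<alpha>" and "\<alpha> < 1/2 + \<gamma>/2"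
    and "gaussian_random_measure N lborel B"
    and "generalized_fbm N B \<alpha> \<gamma> M X"
    and "\<And>s t. 0 \<le> s \<Longrightarrow> 0 \<le> t \<Longrightarrow> \<Psi> s t = (LINT \<omega>|M. X s \<omega> * X t \<omega>)"
    and "H = \<alpha> - \<gamma>/2 + 1/2"
    and "b > 0"
    and "\<alpha> > 0"
    and "\<sigma> = (SUP r\<in>{0..sqrt (\<Psi> b b)}. sqrt (\<Psi> r r) * (1 - r\<^sup>2 / \<Psi> b b) powr (1/2))"
  shows "AE \<omega> in M.
      (let z = (\<lambda>u. X \<bar>X (u * b) \<omega>\<bar> \<omega> /
                      (u powr (H\<^sup>2) * (2 * ln (ln (1 / u))) powr ((H + 1) / 2)))
       in relatively_compact_at_0 z \<and> limit_set_at_0 z = {- \<sigma>..\<sigma>})"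
proof -
  define \<eta> where "\<eta> = min ((1 - \<gamma>) / 4) (1/2 + \<gamma>/2 - \<alpha>)"
  have H_bounds: "0 < H" "H < 1" and \<eta>: "0 < \<eta>"
    using assms(1-4) assms(8,10) by (auto simp: \<eta>_def field_simps)
  obtain V C where VC: "0 < V" "0 < C"
    and var: "\<And>t. 0 \<le> t \<Longrightarrow> (LINT \<omega>|M. (X t \<omega>)\<^sup>2) = V * t powr (2 * H)"
    and cov: "\<And>s t. 0 < s \<Longrightarrow> s \<le> t \<Longrightarrow> \<bar>LINT \<omega>|M. X s \<omega> * X t \<omega>\<bar> \<le> C * (s powr H * t powr H * (s / t) powr \<eta>)"
    and inc: "\<And>l s t. 0 < l \<Longrightarrow> 0 \<le> s \<Longrightarrow> s \<le> t \<Longrightarrow> t \<le> 1 \<Longrightarrow>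
      (LINT \<omega>|M. X (l * s) \<omega> * X (l * s) \<omega>) + (LINT \<omega>|M. X (l * t) \<omega> * X (l * t) \<omega>)
        - 2 * (LINT \<omega>|M. X (l * s) \<omega> * X (l * t) \<omega>) \<le> C * (l powr (2 * H) * (t - s) powr (2 * \<alpha>))"
    using gfbm_moments[OF assms(1,2,10,4) assms(5,6), folded assms(8) \<eta>_def] by blast
  have M: "prob_space M" and gauss: "centered_gaussian_process M {0..} X"
    and cont: "\<And>\<omega>. \<omega> \<in> space M \<Longrightarrow> continuous_on {0..} (\<lambda>t. X t \<omega>)"
    using assms(6) by (auto simp: generalized_fbm_def)
  interpret G: gaussian_space M "gaussian_span X" by (rule gaussian_space_span[OF M gauss])
  have X_in: "X t \<in> gaussian_span X" if "0 \<le> t" for t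
    using that by (intro gaussian_spanI[of "{t}" _ "\<lambda>_. 1"]) auto
  \<comment> \<open>The Holder exponent \<open>\<kappa>\<close> of the increments is
    \<open>\<alpha>\<close>; its positivity is the hypothesis \<open>\<alpha> > 0\<close>.\<close>
  interpret self_similar_gaussian M X H V C \<alpha> \<eta>
  proof
    show "(LINT \<omega>|M. (X (l * t) \<omega> - X (l * s) \<omega>)\<^sup>2) \<le> C * (l powr (2 * H) * (t - s) powr (2 * \<alpha>))"
      if l: "0 < l" and st: "0 \<le> s" "s \<le> t" "t \<le> 1" for l s t
    proof -
      have nn: "0 \<le> l * s" "0 \<le> l * t" using l st by auto
      have "(LINT \<omega>|M. (1 * X (l * s) \<omega> + -1 * X (l * t) \<omega>)\<^sup>2) = (LINT \<omega>|M. X (l * s) \<omega> * X (l * s) \<omega>)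
        + (LINT \<omega>|M. X (l * t) \<omega> * X (l * t) \<omega>) - 2 * (LINT \<omega>|M. X (l * s) \<omega> * X (l * t) \<omega>)"
        unfolding G.expectation_square_lincomb[OF X_in[OF nn(1)] X_in[OF nn(2)]] by (simp add: power2_eq_square)
      then show ?thesis using inc[OF l st] by (simp add: power2_commute)
    qed
  qed (use H_bounds VC \<eta> assms(10) var cov gauss cont in auto)
  have \<Psi>: "\<Psi> r r = V * r powr (2 * H)" if "0 \<le> r" for r
    using assms(7)[OF that that] var[OF that] by (simp add: power2_eq_square)
  have sqrt_\<Psi>: "sqrt (\<Psi> r r) = sqrt V * r powr H" if "0 \<le> r" for r
  proof -
    have "r powr (2 * H) = (r powr H)\<^sup>2" by (simp add: power2_eq_square powr_add[symmetric])
    then show ?thesis using \<Psi>[OF that] by (simp add: real_sqrt_mult)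
  qed
  have b0: "0 \<le> b" using assms(9) by simp
  have "\<sigma> = (SUP r\<in>{0..sqrt V * b powr H}. sqrt V * r powr H * sqrt (1 - r\<^sup>2 / (V * b powr (2 * H))))"
    unfolding assms(11) sqrt_\<Psi>[OF b0]
  proof (rule SUP_cong[OF refl])
    \<comment> \<open>On this range \<open>1 - r\<^sup>2 / \<Psi> b b\<close> is nonnegative, which
      is what identifies the power \<open>1/2\<close> with the square root.\<close>
    fix r assume r: "r \<in> {0..sqrt V * b powr H}"
    have "r\<^sup>2 \<le> (sqrt V * b powr H)\<^sup>2" using r by (intro power_mono) auto
    also have "\<dots> = V * b powr (2 * H)" by (rule sqrt_V_powr_sq)
    finally have "0 \<le> 1 - r\<^sup>2 / (V * b powr (2 * H))" using VC assms(9) by (simp add: divide_le_eq)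
    then show "sqrt (\<Psi> r r) * (1 - r\<^sup>2 / \<Psi> b b) powr (1/2) = sqrt V * r powr H * sqrt (1 - r\<^sup>2 / (V * b powr (2 * H)))"
      using r by (simp add: sqrt_\<Psi> \<Psi>[OF b0] powr_half_sqrt)
  qed
  from iterated_limit_set[OF assms(9) this] show ?thesis
    unfolding loglog_def Let_def .
qed

end
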